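(* Let $\kappa\in(0,1)$, and let $\{\phi_{j,k},\ j\ge0,\ k=1,\dots,2^j\}$ be an $L^2([0,1],dx)$-orthonormal family of compactly supported wavelets with regularity $r$. For any $p,R>0$ and $\alpha\in(1/p,r)$, there exists a constant $C$, not depending on $n$ and $\sigma^2$, such that the estimator $\hat\mu$ defined in the context (which does not use $\alpha$, $p$, $R$ or $\sigma$) fulfills $$\mathbb{E}\big(\|\mu-\hat\mu\|_n^2\big)\ \le\ C\max\Big\{\Big(\frac{\sigma^2}{n}\Big)^{2\alpha/(2\alpha+1)},\ \frac{1}{n^{2(\alpha-1/p)}},\ \frac{\sigma^2}{n}\Big\}$$ for any $\mu$ given by $\mu_i=f(x_i)$, $i=1,\dots,n$, with $f$ in the Besov ball $\mathcal B^\alpha_{p,\infty}(R)$. Here $n\ge3$ is any integer for which the estimator is defined (that is, $J_*\ge1$ and $N_*>2$ in the notation of the context), $x_1,\dots,x_n\in[0,1]$ are deterministic points, and $\sigma>0$.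
   Context: Observations: $Y_i=\mu_i+\sigma\varepsilon_i$, $i=1,\dots,n$, with $\varepsilon_i$ i.i.d. standard Gaussian and $\mu_i=f(x_i)$, $f:[0,1]\to\mathbb{R}$ unknown. $\|\cdot\|$ is the Euclidean norm on $\mathbb{R}^n$, $\|\cdot\|_n^2=\|\cdot\|^2/n$, and $\Pi_{\mathcal S}$ is the orthogonal projector in $\mathbb{R}^n$ onto $\mathcal S$. $\mathcal B^\alpha_{p,\infty}(R)$ is the ball of radius $R$ of the Besov space $\mathcal B^\alpha_{p,\infty}[0,1]$. The wavelet family is understood in the usual sense: an orthonormal wavelet basis of $L^2([0,1])$, compactly supported at scale $2^{-j}$ (with uniformly bounded overlap at each level $j$, and $\|\phi_{j,k}\|_\infty=O(2^{j/2})$), whose regularity $r$ is such that for $1/p<\alpha<r$ the quasi-norm of $\mathcal B^\alpha_{p,\infty}[0,1]$ is equivalent to $\sup_{j\ge0}2^{j(\alpha+1/2-1/p)}\big(\sum_k|\langle f,\phi_{j,k}\rangle_{L^2}|^p\big)^{1/p}$. Models. Let $J_*=\lfloor \log(\kappa n/2)/\log 2\rfloor$ and $\mathcal F_*=\mathrm{span}\{\phi_{j,k},\ j=0,\dots,J_*,\ k=1,\dots,2^j\}$. For $1\le J\le J_*$ let $$\mathcal M_J=\Big\{m=\bigcup_{j=0}^{J_*}\{j\}\times A_j:\ A_j\in\Lambda_{j,J}\Big\},$$ where $\Lambda_{j,J}=\{\{1,\dots,2^j\}\}$ if $j\le J-1$ and $\Lambda_{j,J}=\{A\subset\{1,\dots,2^j\}:\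 |A|=\lfloor 2^J/(j-J+1)^3\rfloor\}$ if $J\le j\le J_*$. Let $\mathcal M=\bigcup_{J=1}^{J_*}\mathcal M_J$, $\mathcal F_m=\mathrm{span}\{\phi_{j,k},\ (j,k)\in m\}$, $\mathcal S_m=\{(g(x_1),\dots,g(x_n)):\ g\in\mathcal F_m\}$ and $\mathcal S_*=\{(g(x_1),\dots,g(x_n)):\ g\in\mathcal F_*\}$. Estimator. Let $N_*=n-\dim(\mathcal S_* )$, $\hat\sigma^2=\|Y-\Pi_{\mathcal S_*}Y\|^2/N_*$, $\hat\mu_m=\Pi_{\mathcal S_m}Y$, and, with $\phi(x)=(x-1-\log x)/2$ (a decreasing bijection from $(0,1)$ onto $(0,\infty)$), $$\beta=\frac14\,\phi^{-1}\Big(\frac{\log n}{N_*-2}\Big).$$ For $m\in\mathcal M_J$ set $$L_m=1.1\cdot2^J,\qquad \pi_m=\Big[2^J(1-2^{-J_*})\prod_{j=J}^{J_*}\binom{2^j}{\lfloor 2^J/(j-J+1)^3\rfloor}\Big]^{-1}.$$ The estimator is $$\hat\mu=\sum_{m\in\mathcal M}w_m\hat\mu_m,\qquad w_m=\frac{\pi_m}{\mathcal Z}\exp\Big(\beta\frac{\|\hat\mu_m\|^2}{\hat\sigma^2}-L_m\Big),$$ with $\mathcal Z$ normalizing the sum of the $w_m$ to one. *)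

theory Defs
  imports "HOL-Probability.Probability" "HOL-Library.Function_Algebras"
begin

definition Lp_qnorm :: "real \<Rightarrow> real set \<Rightarrow> (real \<Rightarrow> real) \<Rightarrow> ennreal" where
  "Lp_qnorm p S f =
     (if set_integrable lborel S (\<lambda>x. \<bar>f x\<bar> powr p)
      then ennreal ((LINT x:S|lborel. \<bar>f x\<bar> powr p) powr (1 / p)) else \<infinity>)"

definition forward_diff :: "nat \<Rightarrow> real \<Rightarrow> (real \<Rightarrow> real) \<Rightarrow> real \<Rightarrow> real" where
  "forward_diff m h f x = (\<Sum>i\<le>m. (-1) ^ (m - i) * real (m choose i) * f (x + real i * h))"

definition Lp_modulus :: "nat \<Rightarrow> real \<Rightarrow> (real \<Rightarrow> real) \<Rightarrow> real \<Rightarrow> ennreal" where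
  "Lp_modulus m p f t =
     (SUP h\<in>{0<..t}. Lp_qnorm p {0..1 - real m * h} (forward_diff m h f))"

(* The quasi-norm of B^alpha_{p,infinity}[0,1] for finite p, with the modulus of smoothness
   of order floor(alpha) + 1. *)
definition besov_qnorm :: "real \<Rightarrow> real \<Rightarrow> (real \<Rightarrow> real) \<Rightarrow> ennreal" where
  "besov_qnorm \<alpha> p f = Lp_qnorm p {0..1} f +
     (SUP t\<in>{0<..}. ennreal (t powr (- \<alpha>)) * Lp_modulus (nat \<lfloor>\<alpha>\<rfloor> + 1) p f t)"

(* The quasi-norm only sees f almost everywhere, whereas f is evaluated at the design points.
   For alpha > 1/p every element of the Besov space has a unique continuous representative
   on [0,1]; that representative is meant. *)
definition besov_ball :: "real \<Rightarrow> real \<Rightarrow> real \<Rightarrow> (real \<Rightarrow> real) set" where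
  "besov_ball \<alpha> p R = {f. continuous_on {0..1} f \<and> besov_qnorm \<alpha> p f \<le> ennreal R}"

definition L2_unit :: "(real \<Rightarrow> real) set" where
  "L2_unit = {f. set_borel_measurable lborel {0..1} f \<and>
                 set_integrable lborel {0..1} (\<lambda>x. (f x)\<^sup>2)}"

definition L2_inner :: "(real \<Rightarrow> real) \<Rightarrow> (real \<Rightarrow> real) \<Rightarrow> real" where
  "L2_inner f g = (LINT x:{0..1}|lborel. f x * g x)"

definition wavelet_qnorm ::
    "(nat \<Rightarrow> nat \<Rightarrow> real \<Rightarrow> real) \<Rightarrow> real \<Rightarrow> real \<Rightarrow> (real \<Rightarrow> real) \<Rightarrow> ennreal" where
  "wavelet_qnorm \<phi> \<alpha> p f =
     (SUP j::nat. ennreal (2 powr (real j * (\<alpha> + 1/2 - 1/p)) *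
        (\<Sum>k\<in>{1..2^j}. \<bar>L2_inner f (\<phi> j k)\<bar> powr p) powr (1 / p)))"

(* The wavelets are only used through their values on [0,1]; level j carries k = 1..2^j.
   Each phi j k is taken to be its continuous representative. The last clause is the role of the
   regularity r: the coefficient quasi-norm characterises B^alpha_{p,infinity}[0,1]
   in the range 1/p < alpha < r, with both sides possibly infinite. *)
definition wavelet_basis :: "(nat \<Rightarrow> nat \<Rightarrow> real \<Rightarrow> real) \<Rightarrow> real \<Rightarrow> bool" where
  "wavelet_basis \<phi> r \<longleftrightarrow>
     (\<forall>j. \<forall>k\<in>{1..2^j}. continuous_on {0..1} (\<phi> j k)) \<and>
     (\<forall>j. \<forall>k\<in>{1..2^j}. \<forall>j'. \<forall>k'\<in>{1..2^j'}.
        L2_inner (\<phi> j k) (\<phi> j' k') = (if j = j' \<and> k = k' then 1 else 0)) \<and>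
     (\<forall>f\<in>L2_unit.
        (\<lambda>J. LINT x:{0..1}|lborel.
               (f x - (\<Sum>j\<le>J. \<Sum>k\<in>{1..2^j}. L2_inner f (\<phi> j k) * \<phi> j k x))\<^sup>2)
          \<longlonglongrightarrow> 0) \<and>
     (\<exists>K::real. \<forall>j. \<forall>k\<in>{1..2^j}. \<exists>a. \<forall>x\<in>{0..1}.
        \<phi> j k x \<noteq> 0 \<longrightarrow> x \<in> {a..a + K * 2 powr (- real j)}) \<and>
     (\<exists>K::nat. \<forall>j. \<forall>x\<in>{0..1}. card {k\<in>{1..2^j}. \<phi> j k x \<noteq> 0} \<le> K) \<and>
     (\<exists>K::real. \<forall>j. \<forall>k\<in>{1..2^j}. \<forall>x\<in>{0..1}. \<bar>\<phi> j k x\<bar> \<le> K * 2 powr (real j / 2)) \<and>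
     (\<forall>p \<alpha>. 0 < p \<and> 1 / p < \<alpha> \<and> \<alpha> < r \<longrightarrow>
        (\<exists>c C::real. 0 < c \<and> 0 < C \<and>
           (\<forall>f\<in>L2_unit.
              ennreal c * wavelet_qnorm \<phi> \<alpha> p f \<le> besov_qnorm \<alpha> p f \<and>
              besov_qnorm \<alpha> p f \<le> ennreal C * wavelet_qnorm \<phi> \<alpha> p f)))"


interpretation fun_vs: vector_space "\<lambda>(c::real) (v::'i \<Rightarrow> real) i. c * v i"
  by unfold_locales (auto simp: algebra_simps fun_eq_iff)

(* R^n is the set of functions nat => real vanishing outside {1..n}. *)
definition sample :: "nat \<Rightarrow> (nat \<Rightarrow> real) \<Rightarrow> (real \<Rightarrow> real) \<Rightarrow> nat \<Rightarrow> real" where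
  "sample n x g = (\<lambda>i. if i \<in> {1..n} then g (x i) else 0)"

definition inner_n :: "nat \<Rightarrow> (nat \<Rightarrow> real) \<Rightarrow> (nat \<Rightarrow> real) \<Rightarrow> real" where
  "inner_n n u v = (\<Sum>i=1..n. u i * v i)"

definition sqnorm :: "nat \<Rightarrow> (nat \<Rightarrow> real) \<Rightarrow> real" where
  "sqnorm n v = inner_n n v v"

(* Orthogonal projection onto S, for S a linear subspace of R^n. *)
definition proj :: "nat \<Rightarrow> (nat \<Rightarrow> real) set \<Rightarrow> (nat \<Rightarrow> real) \<Rightarrow> nat \<Rightarrow> real" where
  "proj n S y = (THE v. v \<in> S \<and> (\<forall>u\<in>S. inner_n n (y - v) u = 0))"


definition J_star :: "real \<Rightarrow> nat \<Rightarrow> nat" where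
  "J_star \<kappa> n = nat \<lfloor>ln (\<kappa> * real n / 2) / ln 2\<rfloor>"

definition level_size :: "nat \<Rightarrow> nat \<Rightarrow> nat" where
  "level_size J j = 2 ^ J div (j - J + 1) ^ 3"

definition Lambda :: "nat \<Rightarrow> nat \<Rightarrow> nat set set" where
  "Lambda J j = (if j < J then {{1..2^j}}
                 else {A. A \<subseteq> {1..2^j} \<and> card A = level_size J j})"

definition models_at :: "nat \<Rightarrow> nat \<Rightarrow> (nat \<times> nat) set set" where
  "models_at Js J = {m. \<exists>A. (\<forall>j\<le>Js. A j \<in> Lambda J j) \<and> m = (\<Union>j\<le>Js. {j} \<times> A j)}"

definition models :: "nat \<Rightarrow> (nat \<times> nat) set set" where
  "models Js = (\<Union>J\<in>{1..Js}. models_at Js J)"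

lemma models_at_disjoint:
  assumes "1 \<le> J" "J < J'" "J' \<le> Js"
  shows "models_at Js J \<inter> models_at Js J' = {}"
proof -
  have False if m: "m \<in> models_at Js J" "m \<in> models_at Js J'" for m
  proof -
    from m(1) obtain A where A: "\<forall>j\<le>Js. A j \<in> Lambda J j" "m = (\<Union>j\<le>Js. {j} \<times> A j)"
      unfolding models_at_def by blast
    from m(2) obtain B where B: "\<forall>j\<le>Js. B j \<in> Lambda J' j" "m = (\<Union>j\<le>Js. {j} \<times> B j)"
      unfolding models_at_def by blast
    have le: "Suc J \<le> Js" using assms by simp
    have eq: "A (Suc J) = B (Suc J)"
    proof -
      have "A (Suc J) = {k. (Suc J, k) \<in> m}" using A(2) le by auto
      also have "\<dots> = B (Suc J)" using B(2) le by auto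
      finally show ?thesis .
    qed
    have "card (A (Suc J)) = 2 ^ J div 8"
    proof -
      have "A (Suc J) \<in> Lambda J (Suc J)" using A(1) le by blast
      moreover have "Suc J - J + 1 = 2" by simp
      ultimately show ?thesis by (simp add: Lambda_def level_size_def del: One_nat_def)
    qed
    moreover have "card (B (Suc J)) = 2 ^ Suc J"
    proof -
      have "B (Suc J) \<in> Lambda J' (Suc J)" using B(1) le by blast
      then show ?thesis
        using assms(2) by (cases "Suc J = J'") (auto simp: Lambda_def level_size_def)
    qed
    moreover have "(2::nat) ^ J div 8 < 2 ^ Suc J"
      by (rule le_less_trans[OF div_le_dividend]) simp
    ultimately show False using eq by simp
  qed
  then show ?thesis by blast
qed

(* Well defined on models Js by models_at_disjoint. *)
definition model_index :: "nat \<Rightarrow> (nat \<times> nat) set \<Rightarrow> nat" where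
  "model_index Js m = (THE J. J \<in> {1..Js} \<and> m \<in> models_at Js J)"

definition model_space ::
    "(nat \<Rightarrow> nat \<Rightarrow> real \<Rightarrow> real) \<Rightarrow> nat \<Rightarrow> (nat \<Rightarrow> real) \<Rightarrow> (nat \<times> nat) set \<Rightarrow> (nat \<Rightarrow> real) set" where
  "model_space \<phi> n x m = sample n x ` fun_vs.span ((\<lambda>(j, k). \<phi> j k) ` m)"

definition full_space ::
    "real \<Rightarrow> (nat \<Rightarrow> nat \<Rightarrow> real \<Rightarrow> real) \<Rightarrow> nat \<Rightarrow> (nat \<Rightarrow> real) \<Rightarrow> (nat \<Rightarrow> real) set" where
  "full_space \<kappa> \<phi> n x = model_space \<phi> n x (SIGMA j:{..J_star \<kappa> n}. {1..2^j})"


(* No truncation in the subtraction, since full_space is a subspace of R^n. *)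
definition N_star ::
    "real \<Rightarrow> (nat \<Rightarrow> nat \<Rightarrow> real \<Rightarrow> real) \<Rightarrow> nat \<Rightarrow> (nat \<Rightarrow> real) \<Rightarrow> nat" where
  "N_star \<kappa> \<phi> n x = n - fun_vs.dim (full_space \<kappa> \<phi> n x)"

definition var_est ::
    "real \<Rightarrow> (nat \<Rightarrow> nat \<Rightarrow> real \<Rightarrow> real) \<Rightarrow> nat \<Rightarrow> (nat \<Rightarrow> real) \<Rightarrow> (nat \<Rightarrow> real) \<Rightarrow> real" where
  "var_est \<kappa> \<phi> n x Y =
     sqnorm n (Y - proj n (full_space \<kappa> \<phi> n x) Y) / real (N_star \<kappa> \<phi> n x)"

definition phi_fun :: "real \<Rightarrow> real" where
  "phi_fun t = (t - 1 - ln t) / 2"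

definition beta ::
    "real \<Rightarrow> (nat \<Rightarrow> nat \<Rightarrow> real \<Rightarrow> real) \<Rightarrow> nat \<Rightarrow> (nat \<Rightarrow> real) \<Rightarrow> real" where
  "beta \<kappa> \<phi> n x =
     1 / 4 * inv_into {0<..<1} phi_fun (ln (real n) / (real (N_star \<kappa> \<phi> n x) - 2))"

definition L_pen :: "nat \<Rightarrow> (nat \<times> nat) set \<Rightarrow> real" where
  "L_pen Js m = 1.1 * 2 ^ model_index Js m"

definition prior :: "nat \<Rightarrow> (nat \<times> nat) set \<Rightarrow> real" where
  "prior Js m = (let J = model_index Js m in
     inverse (2 ^ J * (1 - 1 / 2 ^ Js) * (\<Prod>j=J..Js. real ((2 ^ j) choose (level_size J j)))))"

definition raw_weight ::
    "real \<Rightarrow> (nat \<Rightarrow> nat \<Rightarrow> real \<Rightarrow> real) \<Rightarrow> nat \<Rightarrow> (nat \<Rightarrow> real) \<Rightarrow> (nat \<Rightarrow> real)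
       \<Rightarrow> (nat \<times> nat) set \<Rightarrow> real" where
  "raw_weight \<kappa> \<phi> n x Y m =
     prior (J_star \<kappa> n) m *
     exp (beta \<kappa> \<phi> n x * sqnorm n (proj n (model_space \<phi> n x m) Y) / var_est \<kappa> \<phi> n x Y
          - L_pen (J_star \<kappa> n) m)"

definition weight ::
    "real \<Rightarrow> (nat \<Rightarrow> nat \<Rightarrow> real \<Rightarrow> real) \<Rightarrow> nat \<Rightarrow> (nat \<Rightarrow> real) \<Rightarrow> (nat \<Rightarrow> real)
       \<Rightarrow> (nat \<times> nat) set \<Rightarrow> real" where
  "weight \<kappa> \<phi> n x Y m =
     raw_weight \<kappa> \<phi> n x Y m / (\<Sum>m'\<in>models (J_star \<kappa> n). raw_weight \<kappa> \<phi> n x Y m')"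

definition mu_hat ::
    "real \<Rightarrow> (nat \<Rightarrow> nat \<Rightarrow> real \<Rightarrow> real) \<Rightarrow> nat \<Rightarrow> (nat \<Rightarrow> real) \<Rightarrow> (nat \<Rightarrow> real) \<Rightarrow> nat \<Rightarrow> real" where
  "mu_hat \<kappa> \<phi> n x Y =
     (\<lambda>i. \<Sum>m\<in>models (J_star \<kappa> n). weight \<kappa> \<phi> n x Y m * proj n (model_space \<phi> n x m) Y i)"


definition iid_std_gaussian :: "'a measure \<Rightarrow> nat \<Rightarrow> (nat \<Rightarrow> 'a \<Rightarrow> real) \<Rightarrow> bool" where
  "iid_std_gaussian M n \<epsilon> \<longleftrightarrow>
     prob_space M \<and>
     prob_space.indep_vars M (\<lambda>_. borel) \<epsilon> {1..n} \<and>
     (\<forall>i\<in>{1..n}. distributed M lborel (\<epsilon> i) std_normal_density)"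

end

theory Submission
  imports Defs "HOL-Real_Asymp.Real_Asymp"
begin

text \<open>
  The proof replaces the unbiased risk estimate of the literature by a PAC-Bayesian argument.
  Write \<open>T\<close> for the temperature \<open>var_est / beta\<close> and \<open>\<xi>\<close> for the noise. The weights minimise a free
  energy, so comparing them with a single model \<open>m0\<close> bounds the weighted mean of the losses
  \<open>\<parallel>\<mu> - P m Y\<parallel>\<^sup>2\<close> by the bias of \<open>m0\<close>, a penalty proportional to \<open>T\<close>, and the logarithm of an
  exponential moment. At temperature \<open>4 * \<sigma>\<^sup>2\<close> this moment has mean at most \<open>1\<close>, and a larger
  \<open>T\<close> only strengthens the comparison: the bias
  \<open>\<mu> - P m \<mu>\<close> and fitted noise \<open>P m \<xi>\<close> are orthogonal and the penalty \<open>L_pen\<close> is at least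
  \<open>11/25\<close> of the dimension. The value of \<open>beta\<close> is exactly the one for which a Chernoff bound gives
  \<open>T < 4 * \<sigma>\<^sup>2\<close> probability at most \<open>1 / n\<close>; on this event a cruder comparison inside the large
  model suffices. Finally the wavelet expansion converges uniformly, so keeping the largest
  coefficients gives a model in \<open>models_at Js J\<close> whose bias is small in the supremum norm,
  whatever the design points.
\<close>

section \<open>Orthogonal projections\<close>

text \<open>The obstacle is that the temperature \<open>T\<close> is random and built from the same
  data as the fits. The comparison is therefore pathwise: one inequality valid for every
  \<open>T\<close> above the deterministic \<tau> = 4 \<sigma>^2, in which \<open>T\<close> survives
  only as a factor of the penalty of \<open>m0\<close>. What remains to be known is the mean of
  \<open>T\<close> and the probability of \<open>T\<close> < \<tau>. The mean contains the bias of
  the large space, but divided by a multiple of n, and since the penalty is O(2^J) with 2^J at most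
  n, this costs only a multiple of that bias. Origin of the constants: moving a tenth of the loss
  gives the fitted noise the exponent (11/10)/4 = 11/40, below the critical 1/2, at a price of at
  most 11/25 per dimension. A model of index J has dimension at most 5/2 * 2^J, and 11/25 * 5/2 is
  the 1.1 of \<open>L_pen\<close>. On the bad event the fitted noise is typically of order n
  \<sigma>^2, which the probability 1/n reduces to \<sigma>^2. The signal need not lie in the large
  space, so the residual is noncentral. Its lower tail is controlled through characteristic
  functions, where the noncentrality is a mere phase.\<close>

definition euclid :: "nat \<Rightarrow> (nat \<Rightarrow> real) set" where
  "euclid n = {v. \<forall>i. i \<notin> {1..n} \<longrightarrow> v i = 0}"

definition orthonormal :: "nat \<Rightarrow> nat \<Rightarrow> (nat \<Rightarrow> nat \<Rightarrow> real) \<Rightarrow> bool" where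
  "orthonormal n d e \<longleftrightarrow> (\<forall>i<d. e i \<in> euclid n) \<and>
     (\<forall>i<d. \<forall>j<d. inner_n n (e i) (e j) = (if i = j then 1 else 0))"

definition lincomb :: "nat \<Rightarrow> (nat \<Rightarrow> nat \<Rightarrow> real) \<Rightarrow> (nat \<Rightarrow> real) \<Rightarrow> nat \<Rightarrow> real" where
  "lincomb d e c = (\<lambda>k. \<Sum>i<d. c i * e i k)"

lemma inner_n_commute: "inner_n n u v = inner_n n v u"
  by (simp add: inner_n_def mult.commute)

lemma inner_n_simps:
  "inner_n n (u + v) w = inner_n n u w + inner_n n v w"
  "inner_n n w (u + v) = inner_n n w u + inner_n n w v"
  "inner_n n (u - v) w = inner_n n u w - inner_n n v w"
  "inner_n n w (u - v) = inner_n n w u - inner_n n w v"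
  "inner_n n (\<lambda>i. c * u i) w = c * inner_n n u w"
  "inner_n n w (\<lambda>i. c * u i) = c * inner_n n w u"
  "inner_n n 0 w = 0" "inner_n n w 0 = 0" "inner_n n (\<lambda>_. 0) w = 0" "inner_n n w (\<lambda>_. 0) = 0"
  by (simp_all add: inner_n_def algebra_simps sum.distrib sum_subtractf sum_distrib_left)

lemma inner_n_cong:
  "(\<And>i. i \<in> {1..n} \<Longrightarrow> u i = u' i) \<Longrightarrow> inner_n n u v = inner_n n u' v"
  by (simp add: inner_n_def)

lemma inner_n_lincomb:
  "inner_n n (lincomb d e c) v = (\<Sum>i<d. c i * inner_n n (e i) v)"
proof -
  have "inner_n n (lincomb d e c) v = (\<Sum>k=1..n. \<Sum>i<d. c i * (e i k * v k))"
    by (simp add: inner_n_def lincomb_def sum_distrib_right mult.assoc)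
  also have "\<dots> = (\<Sum>i<d. c i * inner_n n (e i) v)"
    by (subst sum.swap) (simp add: inner_n_def sum_distrib_left)
  finally show ?thesis .
qed

lemma sqnorm_nonneg [simp]: "0 \<le> sqnorm n v"
  by (simp add: sqnorm_def inner_n_def sum_nonneg)

lemma sqnorm_zero [simp]: "sqnorm n 0 = 0"
  by (simp add: sqnorm_def inner_n_simps)

lemma sqnorm_eq_0: "v \<in> euclid n \<Longrightarrow> sqnorm n v = 0 \<Longrightarrow> v = 0"
  by (auto simp: sqnorm_def inner_n_def euclid_def sum_nonneg_eq_0_iff fun_eq_iff)

lemma sqnorm_scale: "sqnorm n (\<lambda>i. c * v i) = c\<^sup>2 * sqnorm n v"
  by (simp add: sqnorm_def inner_n_simps power2_eq_square)

lemma sqnorm_add: "sqnorm n (u + v) = sqnorm n u + 2 * inner_n n u v + sqnorm n v"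
  by (simp add: sqnorm_def inner_n_simps inner_n_commute[of n v u])

lemma sqnorm_diff: "sqnorm n (u - v) = sqnorm n u - 2 * inner_n n u v + sqnorm n v"
  by (simp add: sqnorm_def inner_n_simps inner_n_commute[of n v u])

lemma sqnorm_add_le: "sqnorm n (u + v) \<le> 2 * sqnorm n u + 2 * sqnorm n v"
proof -
  have "sqnorm n (u + v) + sqnorm n (u - v) = 2 * sqnorm n u + 2 * sqnorm n v"
    by (simp add: sqnorm_add sqnorm_diff)
  then show ?thesis using sqnorm_nonneg[of n "u - v"] by linarith
qed

lemma sqnorm_diff_le: "sqnorm n (u - v) \<le> 2 * sqnorm n u + 2 * sqnorm n v"
  using sqnorm_add[of n u v] sqnorm_diff[of n u v] sqnorm_nonneg[of n "u + v"] by linarith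

lemma euclid_subspace: "fun_vs.subspace (euclid n)"
  by (auto simp: fun_vs.subspace_def euclid_def)

lemma span_subset_euclid: "B \<subseteq> euclid n \<Longrightarrow> fun_vs.span B \<subseteq> euclid n"
  by (rule fun_vs.span_minimal[OF _ euclid_subspace])

lemma sum_fun_eq: "(\<lambda>k. \<Sum>i\<in>I. f i k) = (\<Sum>i\<in>I. f i)"
  for f :: "'a \<Rightarrow> 'b \<Rightarrow> real"
  by (induction I rule: infinite_finite_induct) (auto simp: fun_eq_iff)

lemma lincomb_in_span: "lincomb d e c \<in> fun_vs.span (e ` {..<d})"
  unfolding lincomb_def sum_fun_eq
  by (intro fun_vs.span_sum fun_vs.span_scale fun_vs.span_base) auto

lemma inner_n_lincomb_basis:
  assumes "orthonormal n d e" "j < d"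
  shows "inner_n n (lincomb d e c) (e j) = c j"
proof -
  have "inner_n n (lincomb d e c) (e j) = (\<Sum>i<d. if i = j then c i else 0)"
    unfolding inner_n_lincomb using assms by (intro sum.cong) (auto simp: orthonormal_def)
  then show ?thesis using assms(2) by simp
qed

lemma sqnorm_lincomb:
  assumes "orthonormal n d e"
  shows "sqnorm n (lincomb d e c) = (\<Sum>i<d. (c i)\<^sup>2)"
  unfolding sqnorm_def using inner_n_lincomb_basis[OF assms]
  by (simp add: inner_n_lincomb inner_n_commute[of n _ "lincomb d e c"] power2_eq_square)

lemma span_orthonormal:
  assumes "orthonormal n d e" "v \<in> fun_vs.span (e ` {..<d})"
  shows "v = lincomb d e (\<lambda>i. inner_n n v (e i))"
  using assms(2)
proof (induction rule: fun_vs.span_induct_alt)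
  case base
  show ?case by (simp add: lincomb_def inner_n_simps fun_eq_iff)
next
  case (step c x y)
  then obtain j where j: "j < d" "x = e j" by auto
  have x: "lincomb d e (\<lambda>i. inner_n n x (e i)) = x"
  proof
    fix k
    have "lincomb d e (\<lambda>i. inner_n n x (e i)) k = (\<Sum>i<d. if i = j then e i k else 0)"
      unfolding lincomb_def using j assms(1)
      by (intro sum.cong) (auto simp: orthonormal_def)
    then show "lincomb d e (\<lambda>i. inner_n n x (e i)) k = x k" using j by simp
  qed
  have "lincomb d e (\<lambda>i. inner_n n ((\<lambda>i. c * x i) + y) (e i)) =
        (\<lambda>k. c * lincomb d e (\<lambda>i. inner_n n x (e i)) k) + lincomb d e (\<lambda>i. inner_n n y (e i))"
    by (auto simp: lincomb_def inner_n_simps fun_eq_iff algebra_simps sum.distrib sum_distrib_left)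
  also have "\<dots> = (\<lambda>k. c * x k) + y" by (simp only: x step.IH[symmetric])
  finally show ?case by (rule sym)
qed

lemma lincomb_euclid: "orthonormal n d e \<Longrightarrow> lincomb d e c \<in> euclid n"
  by (auto simp: orthonormal_def euclid_def lincomb_def)

text \<open>The given family is kept as a prefix, so the lemma serves twice: from the empty family
  it yields bases of the model spaces, from a basis of the large space an adapted basis of R^n. The
  bound on \<open>d'\<close> later becomes "dimension at most \<open>card m\<close>".\<close>

lemma gram_schmidt:
  assumes "finite B" "B \<subseteq> euclid n" "orthonormal n d e"
  shows "\<exists>d' e'. d \<le> d' \<and> d' \<le> d + card B \<and> (\<forall>i<d. e' i = e i) \<and> orthonormal n d' e' \<and>
           fun_vs.span (e' ` {..<d'}) = fun_vs.span (e ` {..<d} \<union> B)"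
  using assms(1,2)
proof (induction B rule: finite_induct)
  case empty
  show ?case using assms(3) by (intro exI[of _ d] exI[of _ e]) auto
next
  case (insert v B)
  then obtain d' e' where IH: "d \<le> d'" "d' \<le> d + card B" "\<forall>i<d. e' i = e i"
    "orthonormal n d' e'" "fun_vs.span (e' ` {..<d'}) = fun_vs.span (e ` {..<d} \<union> B)" by auto
  have v: "v \<in> euclid n" using insert by simp
  let ?E = "e' ` {..<d'}"
  have sp: "fun_vs.span (insert x ?E) = fun_vs.span (insert x (e ` {..<d} \<union> B))" for x
    unfolding fun_vs.span_insert[of x ?E] fun_vs.span_insert[of x "e ` {..<d} \<union> B"] IH(5) ..
  define q where "q = lincomb d' e' (\<lambda>i. inner_n n v (e' i))"
  define u where "u = v - q"
  have q: "q \<in> fun_vs.span ?E" unfolding q_def by (rule lincomb_in_span)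
  have spu: "fun_vs.span (insert v ?E) = fun_vs.span (insert u ?E)"
    by (rule fun_vs.eq_span_insert_eq) (simp add: u_def q)
  show ?case
  proof (cases "u = 0")
    case True
    then have "fun_vs.span (insert v ?E) = fun_vs.span ?E"
      unfolding spu by (simp add: fun_vs.span_insert_0)
    then have "fun_vs.span ?E = fun_vs.span (e ` {..<d} \<union> insert v B)"
      using sp[of v] by simp
    then show ?thesis using IH insert(1,2) by (intro exI[of _ d'] exI[of _ e']) auto
  next
    case False
    have uE: "u \<in> euclid n"
      using v lincomb_euclid[OF IH(4)] fun_vs.subspace_diff[OF euclid_subspace]
      unfolding u_def q_def by blast
    define s where "s = sqrt (sqnorm n u)"
    have s: "s > 0" "s\<^sup>2 = sqnorm n u"
      using sqnorm_eq_0[OF uE] False sqnorm_nonneg[of n u] unfolding s_def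
      by (auto simp: less_le)
    define w where "w = (\<lambda>k. inverse s * u k)"
    have uperp: "inner_n n u (e' i) = 0" if "i < d'" for i
      using inner_n_lincomb_basis[OF IH(4) that] by (simp add: u_def q_def inner_n_simps)
    have "inner_n n w w = inverse s * inverse s * sqnorm n u"
      by (simp add: w_def inner_n_simps sqnorm_def)
    also have "\<dots> = 1" using s by (simp add: power2_eq_square[symmetric] power_inverse flip: s(2))
    finally have ww: "inner_n n w w = 1" .
    have wperp: "inner_n n w (e' i) = 0" "inner_n n (e' i) w = 0" if "i < d'" for i
      using uperp[OF that] inner_n_commute[of n "e' i" w] by (simp_all add: w_def inner_n_simps)
    have wE: "w \<in> euclid n" using uE by (auto simp: w_def euclid_def)
    define e'' where "e'' = e'(d' := w)"
    have on: "orthonormal n (Suc d') e''"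
      using IH(4) wE ww wperp unfolding orthonormal_def e''_def by (auto simp: less_Suc_eq)
    have im: "e'' ` {..<Suc d'} = insert w ?E"
      by (auto simp: e''_def lessThan_Suc)
    have usw: "u = (\<lambda>k. s * w k)" using s by (auto simp: w_def fun_eq_iff)
    have "fun_vs.span (insert w ?E) = fun_vs.span (insert u ?E)"
    proof (rule equalityI)
      have "w \<in> fun_vs.span (insert u ?E)"
        unfolding w_def by (rule fun_vs.span_scale, rule fun_vs.span_base) simp
      then show "fun_vs.span (insert w ?E) \<subseteq> fun_vs.span (insert u ?E)"
        by (intro fun_vs.span_minimal fun_vs.subspace_span) (auto intro: fun_vs.span_base)
      have "u \<in> fun_vs.span (insert w ?E)"
        by (subst usw, rule fun_vs.span_scale, rule fun_vs.span_base) simp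
      then show "fun_vs.span (insert u ?E) \<subseteq> fun_vs.span (insert w ?E)"
        by (intro fun_vs.span_minimal fun_vs.subspace_span) (auto intro: fun_vs.span_base)
    qed
    then have "fun_vs.span (e'' ` {..<Suc d'}) = fun_vs.span (e ` {..<d} \<union> insert v B)"
      unfolding im using spu sp[of v] by simp
    moreover have "\<forall>i<d. e'' i = e i" using IH(1,3) by (auto simp: e''_def)
    ultimately show ?thesis using IH insert(1,2) on
      by (intro exI[of _ "Suc d'"] exI[of _ e'']) auto
  qed
qed

lemma dim_orthonormal:
  assumes "orthonormal n d e"
  shows "fun_vs.dim (fun_vs.span (e ` {..<d})) = d"
proof -
  have inj: "inj_on e {..<d}"
  proof (rule inj_onI)
    fix i j assume "i \<in> {..<d}" "j \<in> {..<d}" "e i = e j"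
    then show "i = j" using assms unfolding orthonormal_def
      by (metis lessThan_iff zero_neq_one)
  qed
  have "fun_vs.independent (e ` {..<d})"
  proof (rule fun_vs.independent_if_scalars_zero)
    show "finite (e ` {..<d})" by simp
    fix f x assume f: "(\<Sum>x\<in>e ` {..<d}. (\<lambda>i. f x * x i)) = 0" and x: "x \<in> e ` {..<d}"
    then obtain j where j: "j < d" "x = e j" by auto
    have "lincomb d e (\<lambda>i. f (e i)) = 0"
      using f unfolding lincomb_def sum_fun_eq sum.reindex[OF inj] by (simp add: o_def)
    then show "f x = 0" using inner_n_lincomb_basis[OF assms j(1), of "\<lambda>i. f (e i)"] j
      by (simp add: inner_n_simps)
  qed
  then have "fun_vs.dim (e ` {..<d}) = card (e ` {..<d})"
    by (rule fun_vs.dim_eq_card_independent)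
  then show ?thesis using card_image[OF inj] by (simp add: fun_vs.dim_span)
qed

definition unit_vec :: "nat \<Rightarrow> nat \<Rightarrow> real" where
  "unit_vec i = (\<lambda>k. if k = i then 1 else 0)"

lemma euclid_eq_span: "euclid n = fun_vs.span (unit_vec ` {1..n})"
proof (rule equalityI)
  show "fun_vs.span (unit_vec ` {1..n}) \<subseteq> euclid n"
    by (rule span_subset_euclid) (auto simp: euclid_def unit_vec_def)
  show "euclid n \<subseteq> fun_vs.span (unit_vec ` {1..n})"
  proof
    fix v assume v: "v \<in> euclid n"
    have "v = (\<lambda>k. \<Sum>i\<in>{1..n}. v i * unit_vec i k)"
    proof
      fix k
      have "(\<Sum>i\<in>{1..n}. v i * unit_vec i k) = (\<Sum>i\<in>{1..n}. if i = k then v i else 0)"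
        by (intro sum.cong) (auto simp: unit_vec_def)
      also have "\<dots> = v k" using v by (auto simp: euclid_def)
      finally show "v k = (\<Sum>i\<in>{1..n}. v i * unit_vec i k)" ..
    qed
    also have "\<dots> \<in> fun_vs.span (unit_vec ` {1..n})"
      unfolding sum_fun_eq by (intro fun_vs.span_sum fun_vs.span_scale fun_vs.span_base) auto
    finally show "v \<in> fun_vs.span (unit_vec ` {1..n})" .
  qed
qed

lemma dim_euclid: "fun_vs.dim (euclid n) = n"
proof -
  have on: "orthonormal n n (\<lambda>i. unit_vec (Suc i))"
    unfolding orthonormal_def
  proof (intro conjI allI impI)
    fix i j assume "i < n" "j < n"
    have "inner_n n (unit_vec (Suc i)) (unit_vec (Suc j)) =
          (\<Sum>k=1..n. if k = Suc i then (if i = j then 1 else 0) else 0)"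
      unfolding inner_n_def by (intro sum.cong) (auto simp: unit_vec_def)
    then show "inner_n n (unit_vec (Suc i)) (unit_vec (Suc j)) = (if i = j then 1 else 0)"
      using \<open>i < n\<close> by simp
  qed (auto simp: euclid_def unit_vec_def)
  have "(\<lambda>i. unit_vec (Suc i)) ` {..<n} = unit_vec ` {1..n}"
    unfolding image_Suc_lessThan[symmetric] image_image ..
  then show ?thesis using dim_orthonormal[OF on] by (simp add: euclid_eq_span)
qed

lemma orthonormal_extend:
  assumes "orthonormal n d e"
  shows "\<exists>e'. d \<le> n \<and> (\<forall>i<d. e' i = e i) \<and> orthonormal n n e' \<and> fun_vs.span (e' ` {..<n}) = euclid n"
proof -
  have "finite (unit_vec ` {1..n})" "unit_vec ` {1..n} \<subseteq> euclid n"
    by (auto simp: euclid_def unit_vec_def)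
  from gram_schmidt[OF this assms] obtain d' e' where *: "d \<le> d'" "\<forall>i<d. e' i = e i"
     "orthonormal n d' e'" "fun_vs.span (e' ` {..<d'}) = fun_vs.span (e ` {..<d} \<union> unit_vec ` {1..n})"
    by blast
  have "e ` {..<d} \<subseteq> euclid n" using assms by (auto simp: orthonormal_def)
  then have "fun_vs.span (e ` {..<d} \<union> unit_vec ` {1..n}) = euclid n"
    using span_subset_euclid[of "e ` {..<d} \<union> unit_vec ` {1..n}" n]
      fun_vs.span_mono[of "unit_vec ` {1..n}" "e ` {..<d} \<union> unit_vec ` {1..n}"]
    unfolding euclid_eq_span by (auto simp: fun_vs.span_superset intro: fun_vs.span_base)
  with * have sp: "fun_vs.span (e' ` {..<d'}) = euclid n" by simp
  with dim_orthonormal[OF *(3)] have "d' = n" by (simp add: dim_euclid)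
  with * sp show ?thesis by auto
qed

lemma parseval:
  assumes on: "orthonormal n n e" and sp: "fun_vs.span (e ` {..<n}) = euclid n"
  shows "sqnorm n y = (\<Sum>i<n. (inner_n n y (e i))\<^sup>2)"
proof -
  \<comment> \<open>The signal and the data are arbitrary outside \<open>{1..n}\<close>, while
    \<open>inner_n\<close> reads only these indices, so truncation moves \<open>y\<close> into
    \<open>euclid n\<close> without changing any inner product.\<close>
  define y' where "y' = (\<lambda>i. if i \<in> {1..n} then y i else 0)"
  have y': "inner_n n y' v = inner_n n y v" for v by (rule inner_n_cong) (simp add: y'_def)
  have "y' \<in> fun_vs.span (e ` {..<n})" by (auto simp: sp euclid_def y'_def)
  from span_orthonormal[OF on this]
  have "sqnorm n y' = sqnorm n (lincomb n e (\<lambda>i. inner_n n y' (e i)))" by (rule arg_cong)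
  also have "\<dots> = (\<Sum>i<n. (inner_n n y (e i))\<^sup>2)" by (simp add: sqnorm_lincomb[OF on] y')
  finally have "sqnorm n y' = (\<Sum>i<n. (inner_n n y (e i))\<^sup>2)" .
  moreover have "sqnorm n y' = sqnorm n y"
    unfolding sqnorm_def y' by (subst inner_n_commute) (rule y')
  ultimately show ?thesis by simp
qed

text \<open>This gives meaning to the definite description in \<open>proj\<close>: the coordinate
  formula is a witness, and two candidates differ by a vector of the subspace that is orthogonal to
  itself. Measurability and the Gaussian computations go through this formula.\<close>

lemma proj_orthonormal:
  assumes on: "orthonormal n d e" and S: "S = fun_vs.span (e ` {..<d})"
  shows "proj n S y = lincomb d e (\<lambda>i. inner_n n y (e i))"
  unfolding proj_def
proof (rule the_equality)
  let ?p = "lincomb d e (\<lambda>i. inner_n n y (e i))"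
  have perp: "inner_n n (y - ?p) u = 0" if u: "u \<in> S" for u
  proof -
    have "u = lincomb d e (\<lambda>i. inner_n n u (e i))"
      using span_orthonormal[OF on] u S by blast
    then have "inner_n n (y - ?p) u = inner_n n (lincomb d e (\<lambda>i. inner_n n u (e i))) (y - ?p)"
      by (subst inner_n_commute) simp
    also have "\<dots> = (\<Sum>i<d. inner_n n u (e i) * inner_n n (y - ?p) (e i))"
      unfolding inner_n_lincomb by (simp add: inner_n_commute)
    also have "\<dots> = 0"
      using inner_n_lincomb_basis[OF on] by (intro sum.neutral) (simp add: inner_n_simps)
    finally show ?thesis .
  qed
  have pS: "?p \<in> S" unfolding S by (rule lincomb_in_span)
  then show "?p \<in> S \<and> (\<forall>u\<in>S. inner_n n (y - ?p) u = 0)" using perp by blast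
  fix v assume v: "v \<in> S \<and> (\<forall>u\<in>S. inner_n n (y - v) u = 0)"
  have d: "?p - v \<in> S" using v pS unfolding S by (simp add: fun_vs.span_diff)
  have "sqnorm n (?p - v) = inner_n n (y - v) (?p - v) - inner_n n (y - ?p) (?p - v)"
    by (simp add: sqnorm_def inner_n_simps)
  also have "\<dots> = 0" using perp v d by simp
  finally have "sqnorm n (?p - v) = 0" .
  moreover have "S \<subseteq> euclid n"
    unfolding S using on by (intro span_subset_euclid) (auto simp: orthonormal_def)
  ultimately have "?p - v = 0" using d by (intro sqnorm_eq_0) auto
  then show "v = ?p" by simp
qed

text \<open>A linear subspace of R^n, encoded by an orthonormal basis so that existence of the
  projection comes with the definition.\<close>

definition flat :: "nat \<Rightarrow> (nat \<Rightarrow> real) set \<Rightarrow> bool" where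
  "flat n S \<longleftrightarrow> (\<exists>d e. orthonormal n d e \<and> S = fun_vs.span (e ` {..<d}))"

lemma proj_perp:
  assumes "flat n S" "u \<in> S"
  shows "inner_n n (y - proj n S y) u = 0"
proof -
  from assms(1) obtain d e where on: "orthonormal n d e" and S: "S = fun_vs.span (e ` {..<d})"
    unfolding flat_def by blast
  have u: "u = lincomb d e (\<lambda>i. inner_n n u (e i))"
    using span_orthonormal[OF on] assms(2) S by blast
  have "inner_n n u (y - proj n S y) = (\<Sum>i<d. inner_n n u (e i) * inner_n n (e i) (y - proj n S y))"
    by (subst u) (rule inner_n_lincomb)
  also have "\<dots> = 0"
    unfolding proj_orthonormal[OF on S] inner_n_commute[of n "e _"]
    using inner_n_lincomb_basis[OF on]
    by (intro sum.neutral) (simp add: inner_n_simps)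
  finally show ?thesis by (simp only: inner_n_commute[of n u])
qed

lemma proj_in: "flat n S \<Longrightarrow> proj n S y \<in> S"
proof -
  assume "flat n S"
  then obtain d e where on: "orthonormal n d e" and S: "S = fun_vs.span (e ` {..<d})"
    unfolding flat_def by blast
  show ?thesis unfolding proj_orthonormal[OF on S] unfolding S by (rule lincomb_in_span)
qed

lemma flat_subspace: "flat n S \<Longrightarrow> fun_vs.subspace S"
  unfolding flat_def using fun_vs.subspace_span by blast

lemma flat_euclid: "flat n S \<Longrightarrow> S \<subseteq> euclid n"
proof -
  assume "flat n S"
  then obtain d e where on: "orthonormal n d e" and S: "S = fun_vs.span (e ` {..<d})"
    unfolding flat_def by blast
  show ?thesis unfolding S by (rule span_subset_euclid) (use on in \<open>auto simp: orthonormal_def\<close>)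
qed

lemma proj_unique:
  assumes "flat n S" "v \<in> S" "\<And>u. u \<in> S \<Longrightarrow> inner_n n (y - v) u = 0"
  shows "proj n S y = v"
proof -
  have d: "proj n S y - v \<in> S"
    using flat_subspace[OF assms(1)] proj_in[OF assms(1)] assms(2) by (rule fun_vs.subspace_diff)
  have "sqnorm n (proj n S y - v) = inner_n n (y - v) (proj n S y - v) - inner_n n (y - proj n S y) (proj n S y - v)"
    by (simp add: sqnorm_def inner_n_simps)
  also have "\<dots> = 0" using assms(3)[OF d] proj_perp[OF assms(1) d] by simp
  finally have "sqnorm n (proj n S y - v) = 0" .
  moreover have "S \<subseteq> euclid n"
    using assms(1) by (rule flat_euclid)
  ultimately have "proj n S y - v = 0" using d by (intro sqnorm_eq_0) auto
  then show ?thesis by simp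
qed

lemma proj_add: "flat n S \<Longrightarrow> proj n S (u + v) = proj n S u + proj n S v"
proof (rule proj_unique)
  assume S: "flat n S"
  then show "proj n S u + proj n S v \<in> S"
    by (intro fun_vs.subspace_add flat_subspace proj_in) auto
  fix w assume "w \<in> S"
  then show "inner_n n (u + v - (proj n S u + proj n S v)) w = 0"
    using proj_perp[OF S, of w u] proj_perp[OF S, of w v] by (simp add: inner_n_simps)
qed

lemma inner_proj_left: "flat n S \<Longrightarrow> inner_n n (proj n S u) v = inner_n n (proj n S u) (proj n S v)"
  using proj_perp[of n S "proj n S u" v] proj_in[of n S u]
    inner_n_commute[of n "proj n S u" v] inner_n_commute[of n "proj n S u" "proj n S v"]
  by (simp add: inner_n_simps)

lemma pythagoras: 
  assumes "flat n S" "u \<in> S"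
  shows "sqnorm n (y - u) = sqnorm n (y - proj n S y) + sqnorm n (proj n S y - u)"
proof -
  have "proj n S y - u \<in> S" 
    using flat_subspace[OF assms(1)] proj_in[OF assms(1)] assms(2) by (rule fun_vs.subspace_diff)
  then have "inner_n n (y - proj n S y) (proj n S y - u) = 0" using proj_perp assms by blast
  moreover have "y - u = (y - proj n S y) + (proj n S y - u)" by simp
  ultimately show ?thesis using sqnorm_add[of n "y - proj n S y" "proj n S y - u"] by simp
qed

lemma pythagoras_0: 
  assumes "flat n S"
  shows "sqnorm n y = sqnorm n (y - proj n S y) + sqnorm n (proj n S y)"
  using pythagoras[OF assms, of 0 y] flat_subspace[OF assms] by (simp add: fun_vs.subspace_0)

lemma proj_best:
  assumes "flat n S" "u \<in> S"
  shows "sqnorm n (y - proj n S y) \<le> sqnorm n (y - u)"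
  using pythagoras[OF assms, of y] sqnorm_nonneg[of n "proj n S y - u"] by linarith

lemma proj_proj:
  assumes "flat n S" "flat n S'" "S \<subseteq> S'"
  shows "proj n S (proj n S' y) = proj n S y"
proof (rule sym, rule proj_unique[OF assms(1)])
  show "proj n S (proj n S' y) \<in> S" using assms(1) by (rule proj_in)
  fix u assume u: "u \<in> S"
  have "inner_n n (y - proj n S (proj n S' y)) u
      = inner_n n (y - proj n S' y) u + inner_n n (proj n S' y - proj n S (proj n S' y)) u"
    by (simp add: inner_n_simps)
  also have "\<dots> = 0"
    using proj_perp[OF assms(2), of u y] proj_perp[OF assms(1), of u "proj n S' y"] u assms(3) by auto
  finally show "inner_n n (y - proj n S (proj n S' y)) u = 0" .
qed

section \<open>Sampling at the design points and the resulting model spaces\<close>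

lemma sample_add: "sample n x (f + g) = sample n x f + sample n x g"
  by (auto simp: sample_def fun_eq_iff)

lemma sample_scale: "sample n x (\<lambda>t. c * g t) = (\<lambda>i. c * sample n x g i)"
  by (auto simp: sample_def fun_eq_iff)

lemma sample_euclid: "sample n x f \<in> euclid n"
  by (auto simp: sample_def euclid_def)

lemma sample_span: "sample n x ` fun_vs.span F = fun_vs.span (sample n x ` F)"
proof (rule equalityI; rule subsetI)
  fix v assume "v \<in> sample n x ` fun_vs.span F"
  then obtain g where g: "g \<in> fun_vs.span F" "v = sample n x g" by blast
  from g(1) have "sample n x g \<in> fun_vs.span (sample n x ` F)"
  proof (induction rule: fun_vs.span_induct_alt)
    case base
    have z: "sample n x 0 = 0" by (auto simp: sample_def fun_eq_iff)
    show ?case unfolding z by (rule fun_vs.span_zero)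
  next
    case (step c y z)
    have "(\<lambda>i. c * sample n x y i) \<in> fun_vs.span (sample n x ` F)"
      by (intro fun_vs.span_scale fun_vs.span_base imageI step)
    then show ?case
      unfolding sample_add sample_scale by (rule fun_vs.span_add) (rule step)
  qed
  then show "v \<in> fun_vs.span (sample n x ` F)" using g by simp
next
  fix v assume "v \<in> fun_vs.span (sample n x ` F)"
  then show "v \<in> sample n x ` fun_vs.span F"
  proof (induction rule: fun_vs.span_induct_alt)
    case base
    have "0 = sample n x 0" by (auto simp: sample_def fun_eq_iff)
    then show ?case using fun_vs.span_zero by (rule image_eqI)
  next
    case (step c y z)
    then obtain f g where fg: "f \<in> F" "y = sample n x f" "g \<in> fun_vs.span F" "z = sample n x g" by blast
    have "(\<lambda>i. c * y i) + z = sample n x ((\<lambda>t. c * f t) + g)"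
      by (simp add: sample_add sample_scale fg)
    moreover have "(\<lambda>t. c * f t) + g \<in> fun_vs.span F"
      by (intro fun_vs.span_add fun_vs.span_scale fun_vs.span_base fg)
    ultimately show ?case by blast
  qed
qed

text \<open>Linearity turns the sampled span into the span of the sampled wavelets. These may be
  dependent or vanish, the design points being arbitrary, hence only an upper bound on
  \<open>d\<close>.\<close>

lemma model_space_onb:
  assumes "finite m"
  shows "\<exists>d e. orthonormal n d e \<and> model_space \<phi> n x m = fun_vs.span (e ` {..<d}) \<and> d \<le> card m"
proof -
  let ?B = "sample n x ` (\<lambda>(j, k). \<phi> j k) ` m"
  have "finite ?B" "?B \<subseteq> euclid n" "orthonormal n 0 (\<lambda>_. 0)"
    using assms sample_euclid by (auto simp: orthonormal_def)
  from gram_schmidt[OF this] obtain d e where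
    "d \<le> card ?B" "orthonormal n d e" "fun_vs.span (e ` {..<d}) = fun_vs.span ?B" by auto
  moreover have "card ?B \<le> card m"
    by (meson assms card_image_le finite_imageI le_trans)
  ultimately show ?thesis unfolding model_space_def sample_span by (metis le_trans)
qed

lemma flat_model_space: "finite m \<Longrightarrow> flat n (model_space \<phi> n x m)"
  using model_space_onb unfolding flat_def by blast

lemma model_space_mono: "m \<subseteq> m' \<Longrightarrow> model_space \<phi> n x m \<subseteq> model_space \<phi> n x m'"
  unfolding model_space_def by (intro image_mono fun_vs.span_mono)

section \<open>Gaussian quadratic exponential moments\<close>

lemma nn_integral_normal_density:
  "0 < \<sigma> \<Longrightarrow> (\<integral>\<^sup>+x. ennreal (normal_density \<mu> \<sigma> x) \<partial>lborel) = 1"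
  using prob_space.emeasure_space_1[OF prob_space_normal_density[of \<sigma> \<mu>]]
  by (simp add: emeasure_density)

lemma nn_integral_std_normal_exp:
  "(\<integral>\<^sup>+x. ennreal (exp (c * x)) \<partial>std_normal_distribution) = ennreal (exp (c\<^sup>2 / 2))"
proof -
  have *: "std_normal_density x * exp (c * x) = exp (c\<^sup>2 / 2) * normal_density c 1 x" for x
    by (simp add: normal_density_def mult_exp_exp power2_eq_square algebra_simps
        add_divide_distrib diff_divide_distrib)
  have "(\<integral>\<^sup>+x. ennreal (exp (c * x)) \<partial>std_normal_distribution) =
        (\<integral>\<^sup>+x. ennreal (exp (c\<^sup>2 / 2)) * ennreal (normal_density c 1 x) \<partial>lborel)"
    by (subst nn_integral_density)
       (auto simp: * ennreal_mult[symmetric] simp del: ennreal_mult intro!: nn_integral_cong)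
  also have "\<dots> = ennreal (exp (c\<^sup>2 / 2))"
    by (subst nn_integral_cmult) (auto simp: nn_integral_normal_density)
  finally show ?thesis .
qed

lemma nn_integral_std_normal_exp_square:
  assumes "t < 1 / 2"
  shows "(\<integral>\<^sup>+x. ennreal (exp (t * x\<^sup>2)) \<partial>std_normal_distribution) = ennreal (1 / sqrt (1 - 2 * t))"
proof -
  \<comment> \<open>Multiplying the density by exp(t x^2) leaves, up to the factor \<open>s\<close>,
    the centred Gaussian density of standard deviation \<open>s\<close>.\<close>
  define s where "s = 1 / sqrt (1 - 2 * t)"
  have s: "s > 0" "s\<^sup>2 = 1 / (1 - 2 * t)"
    using assms by (auto simp: s_def power_divide)
  have *: "std_normal_density x * exp (t * x\<^sup>2) = s * normal_density 0 s x" for x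
  proof -
    have e: "- (x\<^sup>2 / 2) + t * x\<^sup>2 = - (x\<^sup>2 / (2 * s\<^sup>2))"
      using assms by (simp add: s field_simps)
    have "sqrt (2 * pi * s\<^sup>2) = s * sqrt (2 * pi)"
      using s(1) by (simp add: real_sqrt_mult)
    then have "s * normal_density 0 s x = 1 / sqrt (2 * pi) * exp (- (x\<^sup>2 / (2 * s\<^sup>2)))"
      using s(1) by (simp add: normal_density_def)
    also have "\<dots> = std_normal_density x * exp (t * x\<^sup>2)"
      by (simp add: normal_density_def e[symmetric] mult_exp_exp algebra_simps)
    finally show ?thesis ..
  qed
  have "(\<integral>\<^sup>+x. ennreal (exp (t * x\<^sup>2)) \<partial>std_normal_distribution) =
        (\<integral>\<^sup>+x. ennreal s * ennreal (normal_density 0 s x) \<partial>lborel)"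
    using s by (subst nn_integral_density)
       (auto simp: * ennreal_mult[symmetric] simp del: ennreal_mult intro!: nn_integral_cong)
  also have "\<dots> = ennreal s"
    using s by (subst nn_integral_cmult) (auto simp: nn_integral_normal_density)
  finally show ?thesis by (simp add: s_def)
qed

lemma iid_measurable:
  "iid_std_gaussian M n \<epsilon> \<Longrightarrow> i \<in> {1..n} \<Longrightarrow> \<epsilon> i \<in> borel_measurable M"
  by (auto simp: iid_std_gaussian_def dest!: distributed_measurable)

lemma iid_inner_measurable:
  assumes "iid_std_gaussian M n \<epsilon>"
  shows "(\<lambda>\<omega>. inner_n n (\<lambda>i. \<epsilon> i \<omega>) b) \<in> borel_measurable M"
  unfolding inner_n_def
  by (intro borel_measurable_sum borel_measurable_times iid_measurable[OF assms]) auto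

lemma iid_distr:
  assumes "iid_std_gaussian M n \<epsilon>" "i \<in> {1..n}"
  shows "distr M borel (\<epsilon> i) = std_normal_distribution"
  using assms unfolding iid_std_gaussian_def
  by (metis distributed_distr_eq_density distr_cong sets_lborel)

lemma iid_nn_integral:
  assumes "iid_std_gaussian M n \<epsilon>" "i \<in> {1..n}" "f \<in> borel_measurable borel"
  shows "(\<integral>\<^sup>+\<omega>. f (\<epsilon> i \<omega>) \<partial>M) = (\<integral>\<^sup>+x. f x \<partial>std_normal_distribution)"
  using iid_measurable[OF assms(1,2)] assms(3)
  by (subst iid_distr[OF assms(1,2), symmetric], subst nn_integral_distr) auto

lemma gaussian_mgf:
  assumes "iid_std_gaussian M n \<epsilon>"
  shows "(\<integral>\<^sup>+\<omega>. ennreal (exp (inner_n n (\<lambda>i. \<epsilon> i \<omega>) b)) \<partial>M) = ennreal (exp (sqnorm n b / 2))"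
proof -
  interpret prob_space M using assms by (simp add: iid_std_gaussian_def)
  have ind: "indep_vars (\<lambda>_. borel) (\<lambda>i \<omega>. ennreal (exp (b i * \<epsilon> i \<omega>))) {1..n}"
    by (rule indep_vars_compose2[where X = \<epsilon> and M' = "\<lambda>_. borel"])
       (use assms in \<open>auto simp: iid_std_gaussian_def\<close>)
  have "(\<integral>\<^sup>+\<omega>. ennreal (exp (inner_n n (\<lambda>i. \<epsilon> i \<omega>) b)) \<partial>M)
      = (\<integral>\<^sup>+\<omega>. (\<Prod>i\<in>{1..n}. ennreal (exp (b i * \<epsilon> i \<omega>))) \<partial>M)"
    by (intro nn_integral_cong) (simp add: inner_n_def exp_sum prod_ennreal mult.commute)
  also have "\<dots> = (\<Prod>i\<in>{1..n}. \<integral>\<^sup>+\<omega>. ennreal (exp (b i * \<epsilon> i \<omega>)) \<partial>M)"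
    by (rule indep_vars_nn_integral[OF _ ind]) auto
  also have "\<dots> = (\<Prod>i\<in>{1..n}. ennreal (exp ((b i)\<^sup>2 / 2)))"
  proof (rule prod.cong)
    fix i assume "i \<in> {1..n}"
    then show "(\<integral>\<^sup>+\<omega>. ennreal (exp (b i * \<epsilon> i \<omega>)) \<partial>M) = ennreal (exp ((b i)\<^sup>2 / 2))"
      using iid_nn_integral[OF assms, of i "\<lambda>x. ennreal (exp (b i * x))"]
      by (simp add: nn_integral_std_normal_exp)
  qed simp
  also have "\<dots> = ennreal (exp (sqnorm n b / 2))"
    by (simp add: prod_ennreal exp_sum[symmetric] sqnorm_def inner_n_def power2_eq_square sum_divide_distrib)
  finally show ?thesis .
qed

text \<open>The oscillating counterpart of \<open>gaussian_mgf\<close>, needed for negative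
  quadratic exponents, where the square root in the linearisation becomes imaginary.\<close>

lemma gaussian_char:
  assumes "iid_std_gaussian M n \<epsilon>"
  shows "(\<integral>\<omega>. iexp (inner_n n (\<lambda>i. \<epsilon> i \<omega>) b) \<partial>M) = complex_of_real (exp (- (sqnorm n b / 2)))"
proof -
  interpret prob_space M using assms by (simp add: iid_std_gaussian_def)
  have ind: "indep_vars (\<lambda>_. borel) (\<lambda>i \<omega>. iexp (b i * \<epsilon> i \<omega>)) {1..n}"
    by (rule indep_vars_compose2[where X = \<epsilon> and M' = "\<lambda>_. borel"])
       (use assms in \<open>auto simp: iid_std_gaussian_def\<close>)
  have "(\<integral>\<omega>. iexp (inner_n n (\<lambda>i. \<epsilon> i \<omega>) b) \<partial>M)
      = (\<integral>\<omega>. (\<Prod>i\<in>{1..n}. iexp (b i * \<epsilon> i \<omega>)) \<partial>M)"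
    by (intro Bochner_Integration.integral_cong)
       (simp_all add: inner_n_def exp_sum[symmetric] sum_distrib_left mult.commute)
  also have "\<dots> = (\<Prod>i\<in>{1..n}. \<integral>\<omega>. iexp (b i * \<epsilon> i \<omega>) \<partial>M)"
  proof (rule indep_vars_lebesgue_integral[OF _ ind])
    fix i assume i: "i \<in> {1..n}"
    show "integrable M (\<lambda>\<omega>. iexp (b i * \<epsilon> i \<omega>))"
      using iid_measurable[OF assms i] by (intro integrable_iexp) auto
  qed simp
  also have "\<dots> = (\<Prod>i\<in>{1..n}. complex_of_real (exp (- ((b i)\<^sup>2 / 2))))"
  proof (rule prod.cong)
    fix i assume i: "i \<in> {1..n}"
    have "(\<integral>\<omega>. iexp (b i * \<epsilon> i \<omega>) \<partial>M) = char (distr M borel (\<epsilon> i)) (b i)"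
      unfolding char_def using iid_measurable[OF assms i] by (subst integral_distr) auto
    then show "(\<integral>\<omega>. iexp (b i * \<epsilon> i \<omega>) \<partial>M) = complex_of_real (exp (- ((b i)\<^sup>2 / 2)))"
      unfolding iid_distr[OF assms i] char_std_normal_distribution by simp
  qed simp
  also have "\<dots> = complex_of_real (exp (- (sqnorm n b / 2)))"
    by (simp add: exp_sum[symmetric] sqnorm_def inner_n_def power2_eq_square sum_divide_distrib
        sum_negf flip: of_real_prod)
  finally show ?thesis .
qed

lemma prob_space_std_normal: "prob_space std_normal_distribution"
  by (rule prob_space_normal_density) simp

interpretation std_normal_prod: product_sigma_finite "\<lambda>_. std_normal_distribution"
  by (rule product_sigma_finite.intro)
     (rule prob_space_imp_sigma_finite[OF prob_space_std_normal])

text \<open>The law of the auxiliary vector \<open>g\<close> that linearises squares; it lives on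
  its own space, so that Fubini applies on the product with \<open>M\<close>.\<close>

abbreviation std_normal_pow :: "nat \<Rightarrow> (nat \<Rightarrow> real) measure" where
  "std_normal_pow d \<equiv> Pi\<^sub>M {..<d} (\<lambda>_. std_normal_distribution)"

lemma lincomb_inner_measurable [measurable]:
  assumes "iid_std_gaussian M n \<epsilon>"
  shows "(\<lambda>(g, \<omega>). inner_n n (\<lambda>i. \<epsilon> i \<omega>) (lincomb d e g)) \<in> borel_measurable (std_normal_pow d \<Otimes>\<^sub>M M)"
proof -
  have [measurable]: "\<epsilon> i \<in> borel_measurable M" if "i \<in> {1..n}" for i
    using iid_measurable[OF assms that] .
  have "(\<lambda>(g, \<omega>). inner_n n (\<lambda>i. \<epsilon> i \<omega>) (lincomb d e g)) =
        (\<lambda>z. \<Sum>k\<in>{1..n}. \<epsilon> k (snd z) * (\<Sum>i<d. fst z i * e i k))"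
    by (auto simp: fun_eq_iff inner_n_def lincomb_def)
  also have "\<dots> \<in> borel_measurable (std_normal_pow d \<Otimes>\<^sub>M M)"
    by measurable
  finally show ?thesis .
qed

lemma inner_lincomb_sum:
  "inner_n n y (lincomb d e g) = (\<Sum>i<d. inner_n n y (e i) * g i)"
  by (subst inner_n_commute, subst inner_n_lincomb) (simp add: inner_n_commute mult.commute)

text \<open>Writing \<open>exp (t u\<^sup>2)\<close> as the Gaussian mean of \<open>exp (sqrt (2 t) u g)\<close> and exchanging the two
  integrations reduces quadratic exponential moments to linear ones.\<close>

lemma gaussian_quadratic_mgf:
  assumes iid: "iid_std_gaussian M n \<epsilon>" and on: "orthonormal n d e"
    and t: "0 \<le> t" "t < 1 / 2" and perp: "\<And>i. i < d \<Longrightarrow> inner_n n b (e i) = 0"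
  shows "(\<integral>\<^sup>+\<omega>. ennreal (exp (t * (\<Sum>i<d. (inner_n n (\<lambda>i. \<epsilon> i \<omega>) (e i))\<^sup>2) + inner_n n (\<lambda>i. \<epsilon> i \<omega>) b)) \<partial>M)
       = ennreal ((1 / sqrt (1 - 2 * t)) ^ d * exp (sqnorm n b / 2))"
proof -
  interpret M: prob_space M using iid by (simp add: iid_std_gaussian_def)
  interpret P: prob_space "std_normal_pow d" by (rule prob_space_PiM) (rule prob_space_std_normal)
  interpret PM: pair_prob_space "std_normal_pow d" M ..
  define r where "r = sqrt (2 * t)"
  have r: "r\<^sup>2 = 2 * t" using t by (simp add: r_def)
  let ?y = "\<lambda>\<omega> i. \<epsilon> i \<omega>"
  note [measurable] = iid_inner_measurable[OF iid] lincomb_inner_measurable[OF iid]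
  have decouple: "ennreal (exp (t * (\<Sum>i<d. (inner_n n (?y \<omega>) (e i))\<^sup>2))) =
     (\<integral>\<^sup>+g. ennreal (exp (r * inner_n n (?y \<omega>) (lincomb d e g))) \<partial>std_normal_pow d)" for \<omega>
  proof -
    let ?u = "\<lambda>i. inner_n n (?y \<omega>) (e i)"
    have "ennreal (exp (t * (\<Sum>i<d. (?u i)\<^sup>2))) = (\<Prod>i<d. ennreal (exp ((r * ?u i)\<^sup>2 / 2)))"
      by (simp add: prod_ennreal exp_sum[symmetric] sum_distrib_left power_mult_distrib r)
    also have "\<dots> = (\<Prod>i<d. \<integral>\<^sup>+x. ennreal (exp (r * ?u i * x)) \<partial>std_normal_distribution)"
      by (simp only: nn_integral_std_normal_exp)
    also have "\<dots> = (\<integral>\<^sup>+g. (\<Prod>i<d. ennreal (exp (r * ?u i * g i))) \<partial>std_normal_pow d)"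
      by (rule std_normal_prod.product_nn_integral_prod[symmetric]) auto
    also have "\<dots> = (\<integral>\<^sup>+g. ennreal (exp (r * inner_n n (?y \<omega>) (lincomb d e g))) \<partial>std_normal_pow d)"
      by (simp add: prod_ennreal exp_sum[symmetric] inner_lincomb_sum sum_distrib_left mult.assoc)
    finally show ?thesis .
  qed
  have "(\<integral>\<^sup>+\<omega>. ennreal (exp (t * (\<Sum>i<d. (inner_n n (?y \<omega>) (e i))\<^sup>2) + inner_n n (?y \<omega>) b)) \<partial>M)
      = (\<integral>\<^sup>+\<omega>. (\<integral>\<^sup>+g. ennreal (exp (r * inner_n n (?y \<omega>) (lincomb d e g) + inner_n n (?y \<omega>) b)) \<partial>std_normal_pow d) \<partial>M)"
  proof (rule nn_integral_cong)
    fix \<omega> assume "\<omega> \<in> space M"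
    then have "(\<lambda>g. inner_n n (?y \<omega>) (lincomb d e g)) \<in> borel_measurable (std_normal_pow d)"
      using measurable_compose[OF measurable_Pair2' lincomb_inner_measurable[OF iid]] by auto
    then show "ennreal (exp (t * (\<Sum>i<d. (inner_n n (?y \<omega>) (e i))\<^sup>2) + inner_n n (?y \<omega>) b)) =
       (\<integral>\<^sup>+g. ennreal (exp (r * inner_n n (?y \<omega>) (lincomb d e g) + inner_n n (?y \<omega>) b)) \<partial>std_normal_pow d)"
      unfolding exp_add
      by (simp add: ennreal_mult decouple nn_integral_multc)
  qed
  also have "\<dots> = (\<integral>\<^sup>+g. (\<integral>\<^sup>+\<omega>. ennreal (exp (r * inner_n n (?y \<omega>) (lincomb d e g) + inner_n n (?y \<omega>) b)) \<partial>M) \<partial>std_normal_pow d)"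
    by (rule PM.Fubini') measurable
  also have "\<dots> = (\<integral>\<^sup>+g. ennreal (exp (sqnorm n b / 2)) * (\<Prod>i<d. ennreal (exp (t * (g i)\<^sup>2))) \<partial>std_normal_pow d)"
  proof (rule nn_integral_cong)
    fix g
    let ?l = "lincomb d e g"
    have eq: "r * inner_n n y ?l + inner_n n y b = inner_n n y ((\<lambda>k. r * ?l k) + b)" for y
      by (simp only: inner_n_simps)
    \<comment> \<open>Orthogonality removes the cross term, so the norm of the combined direction
      splits and the moment is an exact product.\<close>
    have "inner_n n ?l b = 0"
      unfolding inner_n_lincomb using perp by (simp add: inner_n_commute)
    then have "sqnorm n ((\<lambda>k. r * ?l k) + b) = 2 * t * (\<Sum>i<d. (g i)\<^sup>2) + sqnorm n b"
      by (simp only: sqnorm_add inner_n_simps sqnorm_scale sqnorm_lincomb[OF on] r)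
    then have "(\<integral>\<^sup>+\<omega>. ennreal (exp (r * inner_n n (?y \<omega>) ?l + inner_n n (?y \<omega>) b)) \<partial>M)
         = ennreal (exp (t * (\<Sum>i<d. (g i)\<^sup>2) + sqnorm n b / 2))"
      unfolding eq gaussian_mgf[OF iid] by (simp add: add_divide_distrib)
    also have "\<dots> = ennreal (exp (sqnorm n b / 2)) * (\<Prod>i<d. ennreal (exp (t * (g i)\<^sup>2)))"
      by (simp add: exp_add ennreal_mult prod_ennreal exp_sum[symmetric] sum_distrib_left mult.commute)
    finally show "(\<integral>\<^sup>+\<omega>. ennreal (exp (r * inner_n n (?y \<omega>) ?l + inner_n n (?y \<omega>) b)) \<partial>M) = \<dots>" .
  qed
  also have "\<dots> = ennreal (exp (sqnorm n b / 2)) * (\<Prod>i<d. ennreal (1 / sqrt (1 - 2 * t)))"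
  proof -
    have "(\<integral>\<^sup>+g. (\<Prod>i<d. ennreal (exp (t * (g i)\<^sup>2))) \<partial>std_normal_pow d)
        = (\<Prod>i<d. \<integral>\<^sup>+x. ennreal (exp (t * x\<^sup>2)) \<partial>std_normal_distribution)"
      by (rule std_normal_prod.product_nn_integral_prod) auto
    then show ?thesis
      by (subst nn_integral_cmult) (auto simp: nn_integral_std_normal_exp_square[OF t(2)])
  qed
  also have "\<dots> = ennreal ((1 / sqrt (1 - 2 * t)) ^ d * exp (sqnorm n b / 2))"
    using t by (subst prod_ennreal) (auto simp: ennreal_mult mult.commute)
  finally show ?thesis .
qed

text \<open>exp(-s u^2) is the Gaussian mean of exp(i sqrt(2 s) u g). After exchanging the
  integrations the shift \<open>a\<close> occurs only in a factor of modulus one, so absolute values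
  leave the centred case: a noncentral sum of squares has no larger Laplace transform than a central
  one. Hence the lower tail bound for the variance estimate is blind to the signal.\<close>

lemma gaussian_quadratic_laplace:
  assumes iid: "iid_std_gaussian M n \<epsilon>" and on: "orthonormal n d e" and s: "0 \<le> s"
  shows "(\<integral>\<omega>. exp (- s * (\<Sum>i<d. (a i + inner_n n (\<lambda>i. \<epsilon> i \<omega>) (e i))\<^sup>2)) \<partial>M) \<le> (1 / sqrt (1 + 2 * s)) ^ d"
proof -
  interpret M: prob_space M using iid by (simp add: iid_std_gaussian_def)
  interpret P: prob_space "std_normal_pow d" by (rule prob_space_PiM) (rule prob_space_std_normal)
  interpret PM: pair_prob_space "std_normal_pow d" M ..
  define r where "r = sqrt (2 * s)"
  have r: "r\<^sup>2 = 2 * s" using s by (simp add: r_def)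
  let ?y = "\<lambda>\<omega> i. \<epsilon> i \<omega>"
  note [measurable] = iid_inner_measurable[OF iid] lincomb_inner_measurable[OF iid]
  have N: "real_distribution std_normal_distribution" by (rule real_dist_normal_dist)
  have Nint: "integrable std_normal_distribution (\<lambda>x. iexp (c * x))" for c
    using N by (intro prob_space.integrable_iexp) (auto simp: real_distribution_def)
  have Nint2: "integrable std_normal_distribution (\<lambda>x. exp (- s * x\<^sup>2))"
    using s by (intro finite_measure.integrable_const_bound[where B=1])
      (auto simp: prob_space.finite_measure[OF prob_space_normal_density])
  have char1: "complex_of_real (exp (- c\<^sup>2 / 2)) = (\<integral>x. iexp (c * x) \<partial>std_normal_distribution)" for c
    using fun_cong[OF char_std_normal_distribution, of c] by (simp only: char_def)
  let ?F = "\<lambda>g \<omega>. iexp (r * ((\<Sum>i<d. a i * g i) + inner_n n (?y \<omega>) (lincomb d e g)))"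
  have decouple: "complex_of_real (exp (- s * (\<Sum>i<d. (a i + inner_n n (?y \<omega>) (e i))\<^sup>2))) =
     (\<integral>g. ?F g \<omega> \<partial>std_normal_pow d)" for \<omega>
  proof -
    let ?u = "\<lambda>i. a i + inner_n n (?y \<omega>) (e i)"
    have "complex_of_real (exp (- s * (\<Sum>i<d. (?u i)\<^sup>2))) = (\<Prod>i<d. complex_of_real (exp (- (r * ?u i)\<^sup>2 / 2)))"
      by (simp add: exp_sum[symmetric] sum_distrib_left power_mult_distrib r sum_negf flip: of_real_prod)
    also have "\<dots> = (\<Prod>i<d. \<integral>x. iexp (r * ?u i * x) \<partial>std_normal_distribution)"
      by (simp only: char1)
    also have "\<dots> = (\<integral>g. (\<Prod>i<d. iexp (r * ?u i * g i)) \<partial>std_normal_pow d)"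
      by (rule std_normal_prod.product_integral_prod[symmetric]) (rule finite_lessThan, rule Nint)
    also have "\<dots> = (\<integral>g. ?F g \<omega> \<partial>std_normal_pow d)"
    proof (intro Bochner_Integration.integral_cong refl)
      fix g
      have "(\<Prod>i<d. iexp (r * ?u i * g i)) = exp (\<Sum>i<d. \<i> * complex_of_real (r * ?u i * g i))"
        by (simp only: exp_sum finite_lessThan)
      also have "(\<Sum>i<d. \<i> * complex_of_real (r * ?u i * g i)) =
         \<i> * complex_of_real (r * ((\<Sum>i<d. a i * g i) + inner_n n (?y \<omega>) (lincomb d e g)))"
        by (simp add: inner_lincomb_sum sum_distrib_left sum.distrib algebra_simps)
      finally show "(\<Prod>i<d. iexp (r * ?u i * g i)) = ?F g \<omega>" .
    qed
    finally show ?thesis .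
  qed
  have Fint: "integrable (std_normal_pow d \<Otimes>\<^sub>M M) (\<lambda>(g, \<omega>). ?F g \<omega>)"
  proof (rule PM.integrable_const_bound[where B=1])
    show "AE x in std_normal_pow d \<Otimes>\<^sub>M M. cmod (case x of (g, \<omega>) \<Rightarrow> ?F g \<omega>) \<le> 1"
      by (simp add: case_prod_beta)
    show "(\<lambda>(g, \<omega>). ?F g \<omega>) \<in> borel_measurable (std_normal_pow d \<Otimes>\<^sub>M M)"
      by measurable
  qed
  have inner: "(\<integral>\<omega>. ?F g \<omega> \<partial>M) = iexp (r * (\<Sum>i<d. a i * g i)) * (\<Prod>i<d. complex_of_real (exp (- s * (g i)\<^sup>2)))" for g
  proof -
    let ?l = "\<lambda>k. r * lincomb d e g k"
    have "(\<integral>\<omega>. ?F g \<omega> \<partial>M) = (\<integral>\<omega>. iexp (r * (\<Sum>i<d. a i * g i)) * iexp (inner_n n (?y \<omega>) ?l) \<partial>M)"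
      unfolding inner_n_simps
      by (intro Bochner_Integration.integral_cong refl) (simp add: exp_add[symmetric] algebra_simps)
    also have "\<dots> = iexp (r * (\<Sum>i<d. a i * g i)) * complex_of_real (exp (- (sqnorm n ?l / 2)))"
      by (subst integral_mult_right_zero) (simp only: gaussian_char[OF iid])
    also have "exp (- (sqnorm n ?l / 2)) = (\<Prod>i<d. exp (- s * (g i)\<^sup>2))"
      unfolding sqnorm_scale sqnorm_lincomb[OF on] r
      by (simp add: exp_sum[symmetric] sum_negf mult.assoc flip: sum_distrib_left)
    finally show ?thesis by simp
  qed
  have "complex_of_real (\<integral>\<omega>. exp (- s * (\<Sum>i<d. (a i + inner_n n (?y \<omega>) (e i))\<^sup>2)) \<partial>M)
      = (\<integral>\<omega>. (\<integral>g. ?F g \<omega> \<partial>std_normal_pow d) \<partial>M)"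
    unfolding decouple[symmetric] by (rule integral_complex_of_real[symmetric])
  also have "\<dots> = (\<integral>g. (\<integral>\<omega>. ?F g \<omega> \<partial>M) \<partial>std_normal_pow d)"
    by (rule PM.Fubini_integral[OF Fint])
  also have "\<dots> = (\<integral>g. iexp (r * (\<Sum>i<d. a i * g i)) * (\<Prod>i<d. complex_of_real (exp (- s * (g i)\<^sup>2))) \<partial>std_normal_pow d)"
    by (simp only: inner)
  finally have "norm (complex_of_real (\<integral>\<omega>. exp (- s * (\<Sum>i<d. (a i + inner_n n (?y \<omega>) (e i))\<^sup>2)) \<partial>M)) \<le>
    (\<integral>g. norm (iexp (r * (\<Sum>i<d. a i * g i)) * (\<Prod>i<d. complex_of_real (exp (- s * (g i)\<^sup>2)))) \<partial>std_normal_pow d)"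
    by (simp only: integral_norm_bound)
  also have "\<dots> = (\<integral>g. (\<Prod>i<d. exp (- s * (g i)\<^sup>2)) \<partial>std_normal_pow d)"
    by (simp add: norm_mult prod_norm[symmetric])
  also have "\<dots> = (\<Prod>i<d. \<integral>x. exp (- s * x\<^sup>2) \<partial>std_normal_distribution)"
    using Nint2 by (intro std_normal_prod.product_integral_prod) auto
  also have "\<dots> = (1 / sqrt (1 + 2 * s)) ^ d"
    using nn_integral_std_normal_exp_square[of "- s"] s by (simp add: integral_eq_nn_integral)
  finally show ?thesis by (simp add: norm_of_real)
qed

section \<open>Exponential weights\<close>

text \<open>Duality between relative entropy and log-moments: \<open>w\<close> is the Gibbs measure
  with prior \<open>q\<close> and energy \<open>h\<close>, and its mean of \<open>h\<close> minus
  \<open>ln Z\<close> is its relative entropy with respect to \<open>q\<close>. So the bound for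
  arbitrary \<open>X\<close> is the Donsker-Varadhan inequality; the final claim holds because
  \<open>Z\<close> dominates each of its terms.\<close>

lemma gibbs_variational:
  fixes h :: "'i \<Rightarrow> real"
  assumes I: "finite I" "I \<noteq> {}" and q: "\<forall>i\<in>I. 0 < q i"
    and Z: "Z = (\<Sum>i\<in>I. q i * exp (h i))" and weights: "\<forall>i\<in>I. w i = q i * exp (h i) / Z"
  shows "0 < Z" "\<And>i. i \<in> I \<Longrightarrow> 0 < w i" "sum w I = 1"
    and "\<And>X. (\<Sum>i\<in>I. w i * X i) \<le> (\<Sum>i\<in>I. w i * h i) - ln Z + ln (\<Sum>i\<in>I. q i * exp (X i))"
    and "\<And>i. i \<in> I \<Longrightarrow> h i + ln (q i) \<le> ln Z"
proof -
  have pi: "0 < q i" and w: "w i = q i * exp (h i) / Z" if "i \<in> I" for i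
    using that q weights by auto
  show Zpos: "0 < Z" unfolding Z using I pi by (intro sum_pos) auto
  show wpos: "0 < w i" if "i \<in> I" for i using that Zpos pi by (simp add: w)
  show w1: "sum w I = 1"
    using Zpos by (simp add: w Z[symmetric] flip: sum_divide_distrib)
  show "h i + ln (q i) \<le> ln Z" if i: "i \<in> I" for i
  proof -
    have "q i * exp (h i) \<le> Z"
      unfolding Z using I i pi by (intro member_le_sum) (auto intro: less_imp_le)
    then have "ln (q i * exp (h i)) \<le> ln Z"
      using pi[OF i] Zpos by (subst ln_le_cancel_iff) auto
    then show ?thesis using pi[OF i] by (simp add: ln_mult)
  qed
  show "(\<Sum>i\<in>I. w i * X i) \<le> (\<Sum>i\<in>I. w i * h i) - ln Z + ln (\<Sum>i\<in>I. q i * exp (X i))" for X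
  proof -
    define V where "V = (\<Sum>i\<in>I. q i * exp (X i))"
    have V: "0 < V" unfolding V_def using I pi by (intro sum_pos) auto
    \<comment> \<open>Termwise y \<le> exp y - 1; the right side sums to zero because
      \<open>w\<close> and the \<open>q\<close> reweighted by \<open>exp (X i)\<close> both have
      mass one.\<close>
    have "(\<Sum>i\<in>I. w i * (X i - h i + ln Z - ln V)) \<le> (\<Sum>i\<in>I. q i * exp (X i) / V - w i)"
    proof (rule sum_mono)
      fix i assume i: "i \<in> I"
      have "w i * exp (X i - h i + ln Z - ln V) = q i * exp (X i) / V"
        using Zpos V by (simp add: w[OF i] exp_add exp_diff)
      moreover have "w i * (X i - h i + ln Z - ln V) \<le> w i * (exp (X i - h i + ln Z - ln V) - 1)"
        
      proof (rule mult_left_mono)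
        show "X i - h i + ln Z - ln V \<le> exp (X i - h i + ln Z - ln V) - 1"
          using exp_ge_add_one_self[of "X i - h i + ln Z - ln V"] by linarith
      qed (use wpos[OF i] in simp)
      ultimately show "w i * (X i - h i + ln Z - ln V) \<le> q i * exp (X i) / V - w i"
        by (simp add: right_diff_distrib)
    qed
    also have "\<dots> = 0"
      using V w1 by (simp add: sum_subtractf V_def[symmetric] flip: sum_divide_distrib)
    finally have "(\<Sum>i\<in>I. w i * X i) - (\<Sum>i\<in>I. w i * h i) + (ln Z - ln V) * sum w I \<le> 0"
      by (simp add: algebra_simps sum.distrib sum_subtractf sum_distrib_left)
    then show ?thesis unfolding w1 V_def by simp
  qed
qed

text \<open>Two inequalities at different temperatures: the variational one is multiplied by \<tau>,
  the domination of \<open>Z\<close> over its term \<open>i0\<close> by \<open>T\<close>. They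
  disagree only in the relative entropy and the mean penalty, both nonnegative, so \<tau> \<le>
  \<open>T\<close> closes the gap. \<open>G\<close> is a free centring common to all
  \<open>i\<close>. The logarithm of the moment is bounded by the moment itself, so that it can be
  integrated.\<close>

lemma gibbs_temperature:
  fixes Q L D :: "'i \<Rightarrow> real"
  assumes I: "finite I" "i0 \<in> I" and pi: "\<And>i. i \<in> I \<Longrightarrow> 0 < q i" "sum q I \<le> 1"
    and L: "\<And>i. i \<in> I \<Longrightarrow> 0 \<le> L i" and T: "0 < \<tau>" "\<tau> \<le> T"
    and w: "\<And>i. i \<in> I \<Longrightarrow> w i = q i * exp (Q i / T - L i) / (\<Sum>i\<in>I. q i * exp (Q i / T - L i))"
  shows "(\<Sum>i\<in>I. w i * D i) \<le> \<tau> * (\<Sum>i\<in>I. q i * exp ((D i + Q i - G) / \<tau> - L i))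
           + G - Q i0 + T * (L i0 - ln (q i0))"
proof -
  define Z where "Z = (\<Sum>i\<in>I. q i * exp (Q i / T - L i))"
  have ne: "I \<noteq> {}" using I by auto
  have "\<forall>i\<in>I. 0 < q i" "\<forall>i\<in>I. w i = q i * exp (Q i / T - L i) / Z"
    using pi w by (auto simp: Z_def)
  note g = gibbs_variational[OF I(1) ne this(1) Z_def this(2)]
  \<comment> \<open>The relative entropy of \<open>w\<close> with respect to \<open>q\<close>,
    nonnegative because \<open>q\<close> has mass at most one.\<close>
  let ?K = "(\<Sum>i\<in>I. w i * (Q i / T - L i)) - ln Z"
  have "0 \<le> ?K + ln (sum q I)" using g(4)[of "\<lambda>_. 0"] by simp
  moreover have "ln (sum q I) \<le> 0"
    using pi I by (simp add: sum_pos ne)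
  ultimately have K: "0 \<le> ?K" by linarith
  define V where "V = (\<Sum>i\<in>I. q i * exp ((D i + Q i - G) / \<tau> - L i))"
  have V: "0 < V" unfolding V_def using I ne pi by (intro sum_pos) auto
  have "(\<Sum>i\<in>I. w i * ((D i + Q i - G) / \<tau> - L i)) \<le> ?K + ln V"
    unfolding V_def by (rule g(4))
  then have "\<tau> * (\<Sum>i\<in>I. w i * ((D i + Q i - G) / \<tau> - L i)) \<le> \<tau> * (?K + ln V)"
    using T by (intro mult_left_mono) auto
  also have "\<tau> * (\<Sum>i\<in>I. w i * ((D i + Q i - G) / \<tau> - L i)) =
      (\<Sum>i\<in>I. w i * D i) + (\<Sum>i\<in>I. w i * Q i) - G * sum w I - \<tau> * (\<Sum>i\<in>I. w i * L i)"
    unfolding sum_distrib_left sum.distrib[symmetric] sum_subtractf[symmetric]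
    using T by (intro sum.cong) (auto simp: field_simps)
  finally have 1: "(\<Sum>i\<in>I. w i * D i) \<le>
      \<tau> * ?K + \<tau> * ln V - (\<Sum>i\<in>I. w i * Q i) + G + \<tau> * (\<Sum>i\<in>I. w i * L i)"
    using g(3) by (simp add: algebra_simps)
  have "T * (Q i0 / T - L i0 + ln (q i0)) \<le> T * ln Z"
    using T g(5)[OF I(2)] by (intro mult_left_mono) auto
  also have "T * ln Z = (\<Sum>i\<in>I. w i * Q i) - T * (\<Sum>i\<in>I. w i * L i) - T * ?K"
  proof -
    have "(\<Sum>i\<in>I. w i * (Q i / T - L i)) = (\<Sum>i\<in>I. w i * Q i) / T - (\<Sum>i\<in>I. w i * L i)"
      by (simp add: right_diff_distrib sum_subtractf sum_divide_distrib)
    then show ?thesis using T by (simp add: field_simps)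
  qed
  finally have 2: "Q i0 - T * (L i0 - ln (q i0)) \<le> (\<Sum>i\<in>I. w i * Q i) - T * (\<Sum>i\<in>I. w i * L i) - T * ?K"
    using T by (simp add: algebra_simps)
  have "\<tau> * ?K \<le> T * ?K" using K T by (intro mult_right_mono) auto
  moreover have "\<tau> * (\<Sum>i\<in>I. w i * L i) \<le> T * (\<Sum>i\<in>I. w i * L i)"
    using L g(2) T by (intro mult_right_mono sum_nonneg mult_nonneg_nonneg) (auto intro: less_imp_le)
  moreover have "\<tau> * ln V \<le> \<tau> * V"
    using T V ln_le_minus_one[OF V] by (intro mult_left_mono) auto
  ultimately show ?thesis using 1 2 unfolding V_def[symmetric] by linarith
qed

text \<open>Only the signs of the relative entropy and of the penalties enter, so this holds at
  every positive temperature; it serves the event where \<open>T\<close> falls below \<tau>.\<close>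

lemma gibbs_crude:
  fixes Q L :: "'i \<Rightarrow> real"
  assumes I: "finite I" "i0 \<in> I" and pi: "\<And>i. i \<in> I \<Longrightarrow> 0 < q i" "sum q I \<le> 1"
    and L: "\<And>i. i \<in> I \<Longrightarrow> 0 \<le> L i" and T: "0 < T"
    and w: "\<And>i. i \<in> I \<Longrightarrow> w i = q i * exp (Q i / T - L i) / (\<Sum>i\<in>I. q i * exp (Q i / T - L i))"
  shows "Q i0 - T * (L i0 - ln (q i0)) \<le> (\<Sum>i\<in>I. w i * Q i)"
proof -
  define Z where "Z = (\<Sum>i\<in>I. q i * exp (Q i / T - L i))"
  have ne: "I \<noteq> {}" using I by auto
  have "\<forall>i\<in>I. 0 < q i" "\<forall>i\<in>I. w i = q i * exp (Q i / T - L i) / Z"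
    using pi w by (auto simp: Z_def)
  note g = gibbs_variational[OF I(1) ne this(1) Z_def this(2)]
  have "0 \<le> (\<Sum>i\<in>I. w i * (Q i / T - L i)) - ln Z + ln (sum q I)" using g(4)[of "\<lambda>_. 0"] by simp
  moreover have "ln (sum q I) \<le> 0"
    using pi I by (simp add: sum_pos ne)
  ultimately have "ln Z \<le> (\<Sum>i\<in>I. w i * (Q i / T - L i))" by linarith
  also have "\<dots> \<le> (\<Sum>i\<in>I. w i * (Q i / T))"
    using L g(2) by (intro sum_mono mult_left_mono) (auto intro: less_imp_le)
  also have "\<dots> = (\<Sum>i\<in>I. w i * Q i) / T" by (simp add: sum_divide_distrib)
  finally have "Q i0 / T - L i0 + ln (q i0) \<le> (\<Sum>i\<in>I. w i * Q i) / T"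
    using g(5)[OF I(2)] by linarith
  then have "T * (Q i0 / T - L i0 + ln (q i0)) \<le> T * ((\<Sum>i\<in>I. w i * Q i) / T)"
    using T by (intro mult_left_mono) auto
  then show ?thesis using T by (simp add: algebra_simps)
qed

lemma sqnorm_convex:
  assumes I: "finite I" and w: "\<And>i. i \<in> I \<Longrightarrow> 0 \<le> w i" "sum w I = 1"
  shows "sqnorm n (u - (\<lambda>k. \<Sum>i\<in>I. w i * p i k)) \<le> (\<Sum>i\<in>I. w i * sqnorm n (u - p i))"
proof -
  have pt: "(u k - (\<Sum>i\<in>I. w i * p i k))\<^sup>2 \<le> (\<Sum>i\<in>I. w i * (u k - p i k)\<^sup>2)" for k
  proof -
    define m where "m = u k - (\<Sum>i\<in>I. w i * p i k)"
    have m: "(\<Sum>i\<in>I. w i * (u k - p i k)) = m"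
      using w(2) by (simp add: m_def right_diff_distrib sum_subtractf flip: sum_distrib_right)
    have "0 \<le> (\<Sum>i\<in>I. w i * ((u k - p i k) - m)\<^sup>2)"
      using w by (intro sum_nonneg) auto
    also have "\<dots> = (\<Sum>i\<in>I. w i * (u k - p i k)\<^sup>2) - 2 * m * (\<Sum>i\<in>I. w i * (u k - p i k)) + m\<^sup>2 * sum w I"
      unfolding sum_distrib_left sum.distrib[symmetric] sum_subtractf[symmetric]
      by (intro sum.cong) (auto simp: power2_eq_square algebra_simps)
    also have "\<dots> = (\<Sum>i\<in>I. w i * (u k - p i k)\<^sup>2) - m\<^sup>2"
      unfolding m w(2) by (simp add: power2_eq_square)
    finally show ?thesis unfolding m_def by simp
  qed
  have "sqnorm n (u - (\<lambda>k. \<Sum>i\<in>I. w i * p i k)) = (\<Sum>k=1..n. (u k - (\<Sum>i\<in>I. w i * p i k))\<^sup>2)"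
    by (simp add: sqnorm_def inner_n_def power2_eq_square)
  also have "\<dots> \<le> (\<Sum>k=1..n. \<Sum>i\<in>I. w i * (u k - p i k)\<^sup>2)" by (rule sum_mono) (rule pt)
  also have "\<dots> = (\<Sum>i\<in>I. w i * sqnorm n (u - p i))"
    by (subst sum.swap) (simp add: sqnorm_def inner_n_def power2_eq_square sum_distrib_left)
  finally show ?thesis .
qed

lemma sqnorm_estimate:
  assumes "flat n S"
  shows "sqnorm n (\<mu> - proj n S (\<mu> + \<xi>)) = sqnorm n (\<mu> - proj n S \<mu>) + sqnorm n (proj n S \<xi>)"
proof -
  have "inner_n n (\<mu> - proj n S \<mu>) (proj n S \<xi>) = 0"
    by (rule proj_perp[OF assms proj_in[OF assms]])
  moreover have eq: "\<mu> - proj n S (\<mu> + \<xi>) = (\<mu> - proj n S \<mu>) - proj n S \<xi>"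
    by (simp only: proj_add[OF assms] diff_diff_add)
  ultimately show ?thesis unfolding eq sqnorm_diff[of n _ "proj n S \<xi>"] by simp
qed

text \<open>The subtracted quantity does not depend on \<open>S\<close> and can serve as the common
  centring \<open>G\<close>. Apart from the negative bias it leaves only noise along the bias and
  noise fitted by \<open>S\<close>, which live in orthogonal directions.\<close>

lemma sqnorm_proj_excess:
  assumes S: "flat n S"
  shows "sqnorm n (proj n S (\<mu> + \<xi>)) - (sqnorm n \<mu> + 2 * inner_n n \<xi> \<mu>) =
     - sqnorm n (\<mu> - proj n S \<mu>) - 2 * inner_n n \<xi> (\<mu> - proj n S \<mu>) + sqnorm n (proj n S \<xi>)"
  using pythagoras_0[OF S, of \<mu>] inner_proj_left[OF S, of \<mu> \<xi>]
  unfolding proj_add[OF S] sqnorm_add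
  by (simp add: inner_n_simps inner_n_commute[of n \<xi> "proj n S \<mu>"])

text \<open>A tenth of each loss is moved into the exponent, which turns the coefficients \<open>1\<close> of bias and
  fitted noise into \<open>9/10\<close> and \<open>11/10\<close>; with \<open>\<tau> = 4 * \<sigma>\<^sup>2\<close> the exponential moment is still finite.\<close>

lemma mixture_pointwise:
  fixes S :: "'i \<Rightarrow> (nat \<Rightarrow> real) set"
  assumes I: "finite I" "i0 \<in> I" and pi: "\<And>i. i \<in> I \<Longrightarrow> 0 < q i" "sum q I \<le> 1"
    and L: "\<And>i. i \<in> I \<Longrightarrow> 0 \<le> L i"
    and S: "\<And>i. i \<in> I \<Longrightarrow> flat n (S i)" "\<And>i. i \<in> I \<Longrightarrow> S i \<subseteq> U" and U: "flat n U"
    and T: "0 < T" and Y: "Y = \<mu> + \<xi>"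
    and Q: "\<And>i. Q i = sqnorm n (proj n (S i) Y)"
    and w: "\<And>i. i \<in> I \<Longrightarrow> w i = q i * exp (Q i / T - L i) / (\<Sum>i\<in>I. q i * exp (Q i / T - L i))"
    and mh: "mh = (\<lambda>k. \<Sum>i\<in>I. w i * proj n (S i) Y k)"
    and a: "\<And>i. a i = sqnorm n (\<mu> - proj n (S i) \<mu>)"
  shows "0 < \<tau> \<Longrightarrow> \<tau> \<le> T \<Longrightarrow> sqnorm n (\<mu> - mh) \<le>
      10 * (\<tau> * (\<Sum>i\<in>I. q i * exp ((- (9/10) * a i - 2 * inner_n n \<xi> (\<mu> - proj n (S i) \<mu>)
                               + 11/10 * sqnorm n (proj n (S i) \<xi>)) / \<tau> - L i))
            + a i0 + 2 * inner_n n \<xi> (\<mu> - proj n (S i0) \<mu>) + T * (L i0 - ln (q i0)))"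
    and "sqnorm n (\<mu> - mh) \<le> 5 * a i0 + 6 * sqnorm n (proj n U \<xi>) + 2 * T * (L i0 - ln (q i0))"
proof -
  have ne: "I \<noteq> {}" using I by auto
  have "\<forall>i\<in>I. 0 < q i"
    "\<forall>i\<in>I. w i = q i * exp (Q i / T - L i) / (\<Sum>i\<in>I. q i * exp (Q i / T - L i))"
    using pi w by auto
  note g = gibbs_variational[OF I(1) ne this(1) refl this(2)]
  have cvx: "sqnorm n (\<mu> - mh) \<le> (\<Sum>i\<in>I. w i * sqnorm n (\<mu> - proj n (S i) Y))"
    unfolding mh using g(2,3) by (intro sqnorm_convex I) (auto intro: less_imp_le)
  have So: "flat n (S i0)" using S I by blast
  show "sqnorm n (\<mu> - mh) \<le>
      10 * (\<tau> * (\<Sum>i\<in>I. q i * exp ((- (9/10) * a i - 2 * inner_n n \<xi> (\<mu> - proj n (S i) \<mu>)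
                               + 11/10 * sqnorm n (proj n (S i) \<xi>)) / \<tau> - L i))
            + a i0 + 2 * inner_n n \<xi> (\<mu> - proj n (S i0) \<mu>) + T * (L i0 - ln (q i0)))"
    if \<tau>: "0 < \<tau>" "\<tau> \<le> T"
  proof -
    \<comment> \<open>A tenth of the loss of model \<open>i\<close>, in the form supplied by
      \<open>sqnorm_estimate\<close>.\<close>
    define D where "D i = a i / 10 + sqnorm n (proj n (S i) \<xi>) / 10" for i
    define G where "G = sqnorm n \<mu> + 2 * inner_n n \<xi> \<mu>"
    have ex: "Q i - G = - a i - 2 * inner_n n \<xi> (\<mu> - proj n (S i) \<mu>) + sqnorm n (proj n (S i) \<xi>)"
      if "i \<in> I" for i
      unfolding Q a G_def Y by (rule sqnorm_proj_excess) (rule S[OF that])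
    have ten: "(\<Sum>i\<in>I. w i * sqnorm n (\<mu> - proj n (S i) Y)) = 10 * (\<Sum>i\<in>I. w i * D i)"
      unfolding sum_distrib_left
      by (intro sum.cong) (auto simp: D_def Y sqnorm_estimate[OF S(1)] a)
    let ?v = "\<tau> * (\<Sum>i\<in>I. q i * exp ((- (9/10) * a i - 2 * inner_n n \<xi> (\<mu> - proj n (S i) \<mu>)
                               + 11/10 * sqnorm n (proj n (S i) \<xi>)) / \<tau> - L i))"
    let ?t = "T * (L i0 - ln (q i0))"
    have "(\<Sum>i\<in>I. w i * D i) \<le> \<tau> * (\<Sum>i\<in>I. q i * exp ((D i + Q i - G) / \<tau> - L i))
           + G - Q i0 + T * (L i0 - ln (q i0))"
      by (rule gibbs_temperature[OF I pi L \<tau> w])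
    also have "(\<Sum>i\<in>I. q i * exp ((D i + Q i - G) / \<tau> - L i)) =
       (\<Sum>i\<in>I. q i * exp ((- (9/10) * a i - 2 * inner_n n \<xi> (\<mu> - proj n (S i) \<mu>)
                               + 11/10 * sqnorm n (proj n (S i) \<xi>)) / \<tau> - L i))"
    proof (rule sum.cong)
      fix i assume "i \<in> I"
      have "D i + Q i - G = - (9/10) * a i - 2 * inner_n n \<xi> (\<mu> - proj n (S i) \<mu>)
                               + 11/10 * sqnorm n (proj n (S i) \<xi>)"
        using ex[OF \<open>i \<in> I\<close>] unfolding D_def by linarith
      then show "q i * exp ((D i + Q i - G) / \<tau> - L i) =
        q i * exp ((- (9/10) * a i - 2 * inner_n n \<xi> (\<mu> - proj n (S i) \<mu>)
                               + 11/10 * sqnorm n (proj n (S i) \<xi>)) / \<tau> - L i)" by simp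
    qed simp
    finally have "(\<Sum>i\<in>I. w i * D i) \<le> ?v + G - Q i0 + ?t" .
    moreover have "y \<le> 10 * (v + a0 + 2 * x + t)"
      \<comment> \<open>Pure arithmetic: \<open>p\<close> stands for the noise fitted by
        \<open>i0\<close>, which enters with the favourable sign and is dropped.\<close>
      if "y \<le> s" "s = 10 * d" "d \<le> v + g - q0 + t" "q0 - g = - a0 - 2 * x + p" "0 \<le> p"
      for y s d v g q0 t a0 x p :: real
      using that by argo
    ultimately show ?thesis
      using cvx ten ex[OF I(2)] sqnorm_nonneg[of n "proj n (S i0) \<xi>"] by blast
  qed
  have Uo: "sqnorm n (\<mu> - proj n U \<mu>) \<le> a i0"
    unfolding a by (rule proj_best[OF U]) (use S(2) I(2) proj_in[OF So] in blast)
  \<comment> \<open>For the second bound: all models lie in \<open>U\<close>, so a larger criterion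
    means a smaller distance to the common fit \<open>proj n U Y\<close>, and the comparison with
    \<open>i0\<close> becomes a comparison of these distances.\<close>
  let ?r = "\<lambda>i. sqnorm n (proj n U Y - proj n (S i) Y)"
  have r: "?r i = sqnorm n (proj n U Y) - Q i" if i: "i \<in> I" for i
    using pythagoras_0[OF S(1)[OF i], of "proj n U Y"] proj_proj[OF S(1)[OF i] U S(2)[OF i], of Y]
    by (simp add: Q)
  have fit: "(\<Sum>i\<in>I. w i * ?r i) \<le> ?r i0 + T * (L i0 - ln (q i0))"
  proof -
    have "(\<Sum>i\<in>I. w i * ?r i) = (\<Sum>i\<in>I. w i * sqnorm n (proj n U Y) - w i * Q i)"
      by (intro sum.cong) (simp_all only: r right_diff_distrib)
    also have "\<dots> = sqnorm n (proj n U Y) - (\<Sum>i\<in>I. w i * Q i)"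
      using g(3) by (simp add: sum_subtractf flip: sum_distrib_right)
    finally show ?thesis using gibbs_crude[OF I pi L T w] r[OF I(2)] by linarith
  qed
  have ro: "?r i0 \<le> 2 * a i0 + 2 * sqnorm n (proj n U \<xi>)"
  proof -
    have "?r i0 = sqnorm n (proj n U Y - proj n (S i0) (proj n U Y))"
      by (simp only: proj_proj[OF So U S(2)[OF I(2)]])
    also have "\<dots> \<le> sqnorm n (proj n U Y - proj n (S i0) \<mu>)"
      by (rule proj_best[OF So proj_in[OF So]])
    also have "\<dots> = sqnorm n ((proj n U \<mu> - proj n (S i0) \<mu>) + proj n U \<xi>)"
      unfolding Y proj_add[OF U] by (rule arg_cong[where f="sqnorm n"]) simp
    also have "\<dots> \<le> 2 * sqnorm n (proj n U \<mu> - proj n (S i0) \<mu>) + 2 * sqnorm n (proj n U \<xi>)"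
      by (rule sqnorm_add_le)
    finally have "?r i0 \<le> 2 * sqnorm n (proj n U \<mu> - proj n (S i0) \<mu>) + 2 * sqnorm n (proj n U \<xi>)" .
    moreover have "sqnorm n (proj n U \<mu> - proj n (S i0) \<mu>) \<le> a i0"
      using pythagoras[OF U, of "proj n (S i0) \<mu>" \<mu>] S(2)[OF I(2)] proj_in[OF So, of \<mu>]
        sqnorm_nonneg[of n "\<mu> - proj n U \<mu>"] unfolding a by auto
    ultimately show ?thesis by linarith
  qed
  have "(\<Sum>i\<in>I. w i * sqnorm n (\<mu> - proj n (S i) Y)) \<le>
        (\<Sum>i\<in>I. w i * (a i0 + 2 * ?r i + 2 * sqnorm n (proj n U \<xi>)))"
  proof (rule sum_mono, rule mult_left_mono)
    fix i assume i: "i \<in> I"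
    then show "0 \<le> w i" using g(2) by (auto intro: less_imp_le)
    have "proj n (S i) Y \<in> U" using S i proj_in by blast
    from pythagoras[OF U this, of \<mu>]
    have 1: "sqnorm n (\<mu> - proj n (S i) Y) = sqnorm n (\<mu> - proj n U \<mu>) + sqnorm n (proj n U \<mu> - proj n (S i) Y)" .
    have eq: "proj n U \<mu> - proj n (S i) Y = (proj n U Y - proj n (S i) Y) - proj n U \<xi>"
      unfolding Y proj_add[OF U] by simp
    have 2: "sqnorm n (proj n U \<mu> - proj n (S i) Y) \<le> 2 * ?r i + 2 * sqnorm n (proj n U \<xi>)"
      unfolding eq by (rule sqnorm_diff_le)
    show "sqnorm n (\<mu> - proj n (S i) Y) \<le> a i0 + 2 * ?r i + 2 * sqnorm n (proj n U \<xi>)"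
      using Uo 1 2 by linarith
  qed
  also have "\<dots> = a i0 * sum w I + 2 * (\<Sum>i\<in>I. w i * ?r i) + 2 * sqnorm n (proj n U \<xi>) * sum w I"
    unfolding sum_distrib_left sum.distrib[symmetric]
    by (intro sum.cong) (simp_all add: algebra_simps)
  \<comment> \<open>The mean of \<open>?r\<close> enters twice and \<open>ro\<close> bounds its
    reference value, hence 5 = 1 + 2 * 2 and 6 = 2 * 2 + 2.\<close>
  finally show "sqnorm n (\<mu> - mh) \<le> 5 * a i0 + 6 * sqnorm n (proj n U \<xi>) + 2 * T * (L i0 - ln (q i0))"
    using cvx fit ro g(3) by (simp add: algebra_simps)
qed

section \<open>The collection of models\<close>

lemma level_size_le: "level_size J j \<le> 2 ^ J"
  unfolding level_size_def by (rule div_le_dividend)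

lemma level_size_real: "real (level_size J j) \<le> 2 ^ J / real (j - J + 1) ^ 3"
proof -
  have "real (level_size J j) \<le> real (2 ^ J) / real ((j - J + 1) ^ 3)"
    unfolding level_size_def by (rule of_nat_div_le_of_nat)
  then show ?thesis by (simp only: of_nat_power) simp
qed

text \<open>The integer division may round down to 0, so \<open>level_size\<close> alone cannot
  dominate the fraction. In the approximation argument the extra 1 is matched by the rejected index
  itself.\<close>

lemma level_size_real_ge: "2 ^ J / real (j - J + 1) ^ 3 \<le> real (level_size J j) + 1"
proof -
  have "(2::nat) ^ J < (j - J + 1) ^ 3 * (level_size J j + 1)"
    unfolding level_size_def by (metis Suc_eq_plus1 dividend_less_times_div mult_Suc_right add.commute zero_less_Suc zero_less_power)
  then have "real (2 ^ J) \<le> real ((j - J + 1) ^ 3 * (level_size J j + 1))"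
    by (simp only: of_nat_le_iff less_imp_le)
  then have "2 ^ J \<le> real (j - J + 1) ^ 3 * (real (level_size J j) + 1)"
    by (simp only: of_nat_mult of_nat_power of_nat_add of_nat_numeral of_nat_1)
  then show ?thesis by (subst pos_divide_le_eq) (auto simp: mult.commute)
qed

lemma finite_Lambda: "finite (Lambda J j)"
  unfolding Lambda_def by (auto intro: finite_subset[OF _ finite_Collect_subsets])

lemma card_Lambda: "card (Lambda J j) = (if j < J then 1 else 2 ^ j choose level_size J j)"
  using n_subsets[of "{1..2^j::nat}" "level_size J j"] by (simp add: Lambda_def)

lemma Lambda_card:
  assumes "A \<in> Lambda J j"
  shows "A \<subseteq> {1..2^j}" "card A = (if j < J then 2 ^ j else level_size J j)"
  using assms by (auto simp: Lambda_def split: if_splits)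

definition assemble :: "nat \<Rightarrow> (nat \<Rightarrow> nat set) \<Rightarrow> (nat \<times> nat) set" where
  "assemble Js A = (\<Union>j\<le>Js. {j} \<times> A j)"

text \<open>The functions in \<open>models_at\<close> are arbitrary above \<open>Js\<close>;
  restricting them to \<open>{..Js}\<close> gives a finite product set, from which finiteness and
  cardinality follow.\<close>

lemma models_at_eq: "models_at Js J = assemble Js ` (PiE {..Js} (Lambda J))"
proof (rule equalityI; rule subsetI)
  fix m assume "m \<in> models_at Js J"
  then obtain A where A: "\<forall>j\<le>Js. A j \<in> Lambda J j" "m = assemble Js A"
    unfolding models_at_def assemble_def by blast
  have "m = assemble Js (restrict A {..Js})"
    unfolding A(2) assemble_def by (intro SUP_cong) auto
  moreover have "restrict A {..Js} \<in> PiE {..Js} (Lambda J)" using A(1) by auto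
  ultimately show "m \<in> assemble Js ` (PiE {..Js} (Lambda J))" by blast
next
  fix m assume "m \<in> assemble Js ` (PiE {..Js} (Lambda J))"
  then obtain A where A: "A \<in> PiE {..Js} (Lambda J)" "m = assemble Js A" by blast
  then have "\<forall>j\<le>Js. A j \<in> Lambda J j" by auto
  then show "m \<in> models_at Js J" using A(2) unfolding models_at_def assemble_def by blast
qed

lemma finite_models_at: "finite (models_at Js J)"
  unfolding models_at_eq by (intro finite_imageI finite_PiE finite_Lambda) auto

lemma finite_models: "finite (models Js)"
  unfolding models_def using finite_models_at by auto

lemma card_models_at:
  "card (models_at Js J) \<le> (\<Prod>j=J..Js. 2 ^ j choose level_size J j)"
proof -
  have "card (models_at Js J) \<le> card (PiE {..Js} (Lambda J))"
    unfolding models_at_eq by (intro card_image_le finite_PiE finite_Lambda) auto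
  also have "\<dots> = (\<Prod>j\<le>Js. card (Lambda J j))" by (rule card_PiE) auto
  also have "\<dots> = (\<Prod>j=J..Js. card (Lambda J j))"
    by (rule prod.mono_neutral_right) (auto simp: card_Lambda)
  also have "\<dots> = (\<Prod>j=J..Js. 2 ^ j choose level_size J j)"
    by (rule prod.cong) (auto simp: card_Lambda)
  finally show ?thesis .
qed

lemma model_subset:
  assumes "m \<in> models_at Js J"
  shows "m \<subseteq> (SIGMA j:{..Js}. {1..2^j})"
  using assms Lambda_card(1) unfolding models_at_def by fastforce

lemma finite_full_index: "finite (SIGMA j:{..Js}. {1..2^j::nat})"
  by auto

lemma finite_model: "m \<in> models_at Js J \<Longrightarrow> finite m"
  using model_subset finite_full_index by (rule finite_subset)

lemma card_full_index: "card (SIGMA j:{..Js}. {1..2^j::nat}) < 2 ^ (Js + 1)"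
proof -
  have "card (SIGMA j:{..Js}. {1..2^j::nat}) = (\<Sum>j\<le>Js. 2 ^ j)" by simp
  also have "\<dots> = 2 ^ (Js + 1) - 1"
    using mask_eq_sum_exp_nat[of "Js + 1"] by (simp add: lessThan_Suc_atMost flip: Suc_eq_plus1) (metis Suc_mask_eq_exp diff_Suc_1' lessThan_def lessThan_Suc_atMost)
  finally show ?thesis by simp
qed

lemma sum_inverse_squares: "(\<Sum>l<m. 1 / real (l + 1) ^ 2) \<le> 2"
proof -
  have "(\<Sum>l<m. 1 / real (l + 1) ^ 2) \<le> 2 - 1 / real m" if "m \<ge> 1"
    using that
  proof (induction m rule: dec_induct)
    case (step m)
    have "1 / real (m + 1) ^ 2 \<le> 1 / real m - 1 / real (m + 1)"
    proof -
      have "1 / real (m + 1) ^ 2 \<le> 1 / (real m * real (m + 1))"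
        using step(1) by (intro divide_left_mono) (auto simp: power2_eq_square)
      also have "\<dots> = 1 / real m - 1 / real (m + 1)"
        using step(1) by (simp add: field_simps)
      finally show ?thesis .
    qed
    then show ?case using step by simp
  qed simp
  moreover have "0 \<le> 1 / real m" by simp
  ultimately have "m \<ge> 1 \<Longrightarrow> ?thesis" by linarith
  then show ?thesis by (cases "m = 0") auto
qed

text \<open>Telescoping against 1/(2 m), from (m + 1)^2 \<ge> 2 m. The value 3/2 matters: with the
  full coarse levels it gives dimension 5/2 * 2^J, exactly what the penalty 1.1 * 2^J can pay at
  11/25 per dimension.\<close>

lemma sum_inverse_cubes: "(\<Sum>l<m. 1 / real (l + 1) ^ 3) \<le> 3 / 2"
proof -
  have "(\<Sum>l<m. 1 / real (l + 1) ^ 3) \<le> 3 / 2 - 1 / (2 * real m)" if "m \<ge> 1"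
    using that
  proof (induction m rule: dec_induct)
    case (step m)
    have m: "0 < real m" using step(1) by simp
    have "2 * real m * real (m + 1) \<le> real (m + 1) ^ 3"
    proof -
      have "2 * real m \<le> real (m + 1) ^ 2" using sum_squares_ge_zero[of "real m" 1]
        by (simp add: power2_eq_square algebra_simps)
      then have "2 * real m * real (m + 1) \<le> real (m + 1) ^ 2 * real (m + 1)"
        by (rule mult_right_mono) simp
      then show ?thesis by (simp only: power3_eq_cube power2_eq_square)
    qed
    then have "1 / real (m + 1) ^ 3 \<le> 1 / (2 * real m * real (m + 1))"
      using m by (intro divide_left_mono) auto
    also have "\<dots> = 1 / (2 * real m) - 1 / (2 * real (m + 1))"
      using m by (simp add: field_simps)
    finally show ?case using step by simp
  qed simp
  moreover have "0 \<le> 1 / (2 * real m)" by simp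
  ultimately have "m \<ge> 1 \<Longrightarrow> ?thesis" by linarith
  then show ?thesis by (cases "m = 0") auto
qed

lemma sum_shift_levels: "(\<Sum>j=J..Js. f (j - J)) = (\<Sum>l<Suc Js - J. f l)"
  for f :: "nat \<Rightarrow> real"
  by (rule sum.reindex_bij_witness[of _ "\<lambda>l. l + J" "\<lambda>j. j - J"]) auto

lemma card_model:
  assumes "m \<in> models_at Js J" "J \<le> Js"
  shows "real (card m) \<le> 5 / 2 * 2 ^ J"
proof -
  from assms(1) obtain A where A: "\<forall>j\<le>Js. A j \<in> Lambda J j" "m = (\<Union>j\<le>Js. {j} \<times> A j)"
    unfolding models_at_def by blast
  have m: "m = (SIGMA j:{..Js}. A j)" unfolding A(2) by auto
  have A1: "A j \<in> Lambda J j" if "j \<le> Js" for j using A(1) that by blast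
  have fin: "finite (A j)" if "j \<le> Js" for j
    by (rule finite_subset[OF Lambda_card(1)[OF A1[OF that]]]) simp
  have "card m = (\<Sum>j\<le>Js. card (A j))"
    unfolding m using fin by (intro card_SigmaI) auto
  also have "\<dots> = (\<Sum>j\<le>Js. if j < J then 2 ^ j else level_size J j)"
    using Lambda_card(2)[OF A1] by (intro sum.cong) auto
  finally have 1: "card m = (\<Sum>j\<le>Js. if j < J then 2 ^ j else level_size J j)" .
  have 2: "{..Js} = {..<J} \<union> {J..Js}" using assms(2) by auto
  have "card m = (\<Sum>j<J. if j < J then 2 ^ j else level_size J j) +
     (\<Sum>j=J..Js. if j < J then 2 ^ j else level_size J j)"
    unfolding 1 2 by (rule sum.union_disjoint) auto
  then have card: "real (card m) = (\<Sum>j<J. 2 ^ j) + (\<Sum>j=J..Js. real (level_size J j))" by simp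
  have low: "(\<Sum>j<J. 2 ^ j) = (2::real) ^ J - 1" by (simp add: geometric_sum)
  have "(\<Sum>j=J..Js. real (level_size J j)) \<le> (\<Sum>j=J..Js. 2 ^ J * (1 / real (j - J + 1) ^ 3))"
    by (rule sum_mono) (simp only: times_divide_eq_right mult_1_right level_size_real)
  also have "\<dots> = 2 ^ J * (\<Sum>l<Suc Js - J. 1 / real (l + 1) ^ 3)"
    unfolding sum_shift_levels[of "\<lambda>l. 2 ^ J * (1 / real (l + 1) ^ 3)"] by (simp only: sum_distrib_left)
  also have "\<dots> \<le> 2 ^ J * (3 / 2)"
    by (intro mult_left_mono sum_inverse_cubes) simp
  finally show ?thesis using card low by simp
qed

lemma model_index_eq:
  assumes "m \<in> models_at Js J" "J \<in> {1..Js}"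
  shows "model_index Js m = J"
  unfolding model_index_def
proof (rule the_equality)
  show "J \<in> {1..Js} \<and> m \<in> models_at Js J" using assms by simp
  fix J' assume J': "J' \<in> {1..Js} \<and> m \<in> models_at Js J'"
  then show "J' = J"
    using models_at_disjoint[of J J' Js] models_at_disjoint[of J' J Js] assms
    by (cases J J' rule: linorder_cases) auto
qed

lemma level_size_le_pow: "J \<le> j \<Longrightarrow> level_size J j \<le> 2 ^ j"
  using level_size_le[of J j] power_increasing[of J j "2::nat"] by linarith

lemma prior_pos:
  assumes "m \<in> models Js"
  shows "0 < prior Js m"
proof -
  from assms obtain J where J: "J \<in> {1..Js}" "m \<in> models_at Js J" unfolding models_def by blast
  then have "(1::real) < 2 ^ Js" by (auto intro!: one_less_power)
  then have "(1::real) / 2 ^ Js < 1" by simp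
  then show ?thesis
    unfolding prior_def model_index_eq[OF J(2,1)] Let_def
    by (auto intro!: mult_pos_pos prod_pos simp: zero_less_binomial_iff level_size_le_pow)
qed

text \<open>Each index J receives mass at most 2^(-J) / (1 - 2^(-Js)), because \<open>prior\<close>
  divides by a bound on the number of models; the geometric sum over J cancels the
  denominator.\<close>

lemma sum_prior:
  assumes "1 \<le> Js"
  shows "sum (prior Js) (models Js) \<le> 1"
proof -
  let ?c = "1 - 1 / 2 ^ Js :: real"
  have "(1::real) < 2 ^ Js" using assms by (auto intro!: one_less_power)
  then have c: "0 < ?c" by simp
  have "sum (prior Js) (models Js) \<le> (\<Sum>J\<in>{1..Js}. sum (prior Js) (models_at Js J))"
  proof -
    have "sum (prior Js) (models Js) = (\<Sum>J\<in>{1..Js}. sum (prior Js) (models_at Js J))"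
      unfolding models_def
    proof (rule sum.UNION_disjoint)
      show "\<forall>i\<in>{1..Js}. \<forall>j\<in>{1..Js}. i \<noteq> j \<longrightarrow> models_at Js i \<inter> models_at Js j = {}"
      proof (intro ballI impI)
        fix i j assume "i \<in> {1..Js}" "j \<in> {1..Js}" "i \<noteq> j"
        then show "models_at Js i \<inter> models_at Js j = {}"
          using models_at_disjoint[of i j Js] models_at_disjoint[of j i Js]
          by (cases i j rule: linorder_cases) auto
      qed
    qed (auto simp: finite_models_at)
    then show ?thesis by simp
  qed
  also have "\<dots> \<le> (\<Sum>J\<in>{1..Js}. (1 / 2) ^ J / ?c)"
  proof (rule sum_mono)
    fix J assume J: "J \<in> {1..Js}"
    let ?B = "\<Prod>j=J..Js. real (2 ^ j choose level_size J j)"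
    have B: "0 < ?B"
      by (auto intro!: prod_pos simp: zero_less_binomial_iff level_size_le_pow)
    have "sum (prior Js) (models_at Js J) = (\<Sum>m\<in>models_at Js J. inverse (2 ^ J * ?c * ?B))"
      by (rule sum.cong) (auto simp: prior_def model_index_eq[OF _ J] Let_def)
    also have "\<dots> = real (card (models_at Js J)) * inverse (2 ^ J * ?c * ?B)" by simp
    also have "\<dots> \<le> ?B * inverse (2 ^ J * ?c * ?B)"
    proof (rule mult_right_mono)
      have "real (card (models_at Js J)) \<le> real (\<Prod>j=J..Js. 2 ^ j choose level_size J j)"
        using card_models_at by (simp only: of_nat_le_iff)
      then show "real (card (models_at Js J)) \<le> ?B" by simp
      show "0 \<le> inverse (2 ^ J * ?c * ?B)" using B c by simp
    qed
    also have "\<dots> = (1 / 2) ^ J / ?c"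
    proof -
      have "b * inverse (2 ^ J * c * b) = (1 / 2) ^ J / c" if "0 < b" "0 < c" for b c :: real
        using that by (simp add: field_simps)
      then show ?thesis using B c by blast
    qed
    finally show "sum (prior Js) (models_at Js J) \<le> (1 / 2) ^ J / ?c" .
  qed
  also have "\<dots> = (\<Sum>J\<in>{1..Js}. (1 / 2) ^ J) / ?c" by (simp add: sum_divide_distrib)
  also have "(\<Sum>J\<in>{1..Js}. (1 / 2 :: real) ^ J) = ?c"
    by (induction Js) (auto simp: field_simps)
  finally show ?thesis using c by simp
qed

text \<open>One term of the expansion of (1 + x)^N, with 1 + x \<le> exp x. The free parameter
  \<open>x\<close> is to be chosen near k / N.\<close>

lemma ln_binomial_le:
  assumes "0 < x" "k \<le> N"
  shows "ln (real (N choose k)) \<le> real N * x - real k * ln x"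
proof -
  have pos: "0 < N choose k" using assms by simp
  have "real (N choose k) * x ^ k \<le> (\<Sum>i\<le>N. real (N choose i) * x ^ i * 1 ^ (N - i))"
    using assms member_le_sum[of k "{..N}" "\<lambda>i. real (N choose i) * x ^ i * 1 ^ (N - i)"] by simp
  also have "\<dots> = (x + 1) ^ N" by (rule binomial_ring[symmetric])
  also have "\<dots> \<le> exp x ^ N"
    using assms exp_ge_add_one_self[of x] by (intro power_mono) (auto simp: add.commute)
  also have "\<dots> = exp (real N * x)" by (simp add: exp_of_nat_mult)
  finally have "ln (real (N choose k) * x ^ k) \<le> ln (exp (real N * x))"
    using pos assms by (subst ln_le_cancel_iff) auto
  then show ?thesis using pos assms by (simp add: ln_mult ln_realpow)
qed

text \<open>The logarithm of the sparsity costs a factor linear in the level offset; the cube in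
  \<open>level_size\<close> absorbs it and leaves a summable 1/(l + 1)^2.\<close>

lemma ln_level_binomial:
  assumes "J \<le> j"
  shows "ln (real (2 ^ j choose level_size J j)) \<le> 2 ^ J * (4 / real (j - J + 1) ^ 2)"
proof -
  define l where "l = j - J"
  \<comment> \<open>The fraction of indices kept at level \<open>j\<close>, before rounding.\<close>
  define x where "x = 1 / (2 ^ l * real (l + 1) ^ 3)"
  have x: "0 < x" by (simp add: x_def)
  have lnx: "- ln x = real l * ln 2 + 3 * ln (real (l + 1))"
    by (simp add: x_def ln_div ln_mult ln_realpow del: of_nat_add)
  have l2: "- ln x \<le> 4 * real l"
  proof -
    have "ln 2 \<le> (1::real)" using ln_2_less_1 by simp
    then have "real l * ln 2 \<le> real l * 1" by (intro mult_left_mono) auto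
    moreover have "ln (real (l + 1)) \<le> real l" using ln_le_minus_one[of "real (l + 1)"] by simp
    ultimately show ?thesis unfolding lnx by linarith
  qed
  have l0: "0 \<le> - ln x" unfolding lnx by simp
  have jl: "(2::real) ^ j = 2 ^ J * 2 ^ l"
    using assms by (simp add: l_def power_add[symmetric])
  have "ln (real (2 ^ j choose level_size J j)) \<le> real (2 ^ j) * x - real (level_size J j) * ln x"
    by (rule ln_binomial_le[OF x level_size_le_pow[OF assms]])
  also have "\<dots> = 2 ^ J / real (l + 1) ^ 3 + real (level_size J j) * (- ln x)"
    by (simp add: jl x_def)
  also have "\<dots> \<le> 2 ^ J / real (l + 1) ^ 3 + 2 ^ J / real (l + 1) ^ 3 * (4 * real l)"
    using level_size_real[of J j] l2 l0 unfolding l_def[symmetric]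
    by (intro add_left_mono mult_mono) auto
  also have "\<dots> \<le> 2 ^ J / real (l + 1) ^ 3 * (4 * real (l + 1))"
  proof -
    have "X + X * (4 * t) \<le> X * (4 * (t + 1))" if "0 \<le> X" for X t :: real
      using that by (simp add: algebra_simps)
    from this[of "2 ^ J / real (l + 1) ^ 3" "real l"] show ?thesis by (simp add: add.commute)
  qed
  also have "\<dots> = 2 ^ J * (4 / real (l + 1) ^ 2)"
  proof -
    have "X / y ^ 3 * (4 * y) = X * (4 / y ^ 2)" if "0 < y" for X y :: real
      using that by (simp add: field_simps power3_eq_cube power2_eq_square)
    then show ?thesis by this simp
  qed
  finally show ?thesis by (simp add: l_def)
qed

lemma penalty_le:
  assumes J: "J \<in> {1..Js}" and m: "m \<in> models_at Js J"
  shows "L_pen Js m - ln (prior Js m) \<le> 11 * 2 ^ J"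
proof -
  let ?c = "1 - 1 / 2 ^ Js :: real"
  let ?B = "\<Prod>j=J..Js. real (2 ^ j choose level_size J j)"
  have "(1::real) < 2 ^ Js" using J by (auto intro!: one_less_power)
  then have c: "0 < ?c" by simp
  have B: "0 < ?B"
    by (auto intro!: prod_pos simp: zero_less_binomial_iff level_size_le_pow)
  have "- ln (prior Js m) = ln (2 ^ J * ?c * ?B)"
    using B c unfolding prior_def model_index_eq[OF m J] Let_def
    by (subst ln_inverse) auto
  also have "\<dots> = real J * ln 2 + ln ?c + ln ?B"
  proof -
    have "ln (2 ^ J * c * b) = real J * ln 2 + ln c + ln b" if "0 < c" "0 < b" for b c :: real
      using that by (simp add: ln_mult ln_realpow)
    then show ?thesis using B c by blast
  qed
  finally have 1: "- ln (prior Js m) = real J * ln 2 + ln ?c + ln ?B" .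
  have bpos: "0 < real (2 ^ j choose level_size J j)" if "j \<in> {J..Js}" for j
  proof -
    have "0 < (2 ^ j choose level_size J j)"
      using level_size_le_pow[of J j] that by (intro zero_less_binomial) auto
    then show ?thesis by simp
  qed
  have "ln ?B = (\<Sum>j=J..Js. ln (real (2 ^ j choose level_size J j)))"
    by (rule ln_prod[OF _ bpos[THEN less_imp_neq, THEN not_sym]]) auto
  also have "\<dots> \<le> (\<Sum>j=J..Js. 2 ^ J * (4 / real (j - J + 1) ^ 2))"
    by (intro sum_mono ln_level_binomial) auto
  also have "\<dots> = 4 * 2 ^ J * (\<Sum>l<Suc Js - J. 1 / real (l + 1) ^ 2)"
    unfolding sum_shift_levels[of "\<lambda>l. 2 ^ J * (4 / real (l + 1) ^ 2)"] sum_distrib_left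
    by (intro sum.cong) auto
  also have "\<dots> \<le> 4 * 2 ^ J * 2"
    by (intro mult_left_mono sum_inverse_squares) simp
  finally have 2: "ln ?B \<le> 4 * 2 ^ J * 2" .
  have 3: "ln ?c \<le> 0" using c by simp
  have 4: "real J * ln 2 \<le> 2 ^ J * 1"
  proof (rule mult_mono)
    have "real J \<le> real (2 ^ J)" by (simp only: of_nat_le_iff less_imp_le less_exp)
    then show "real J \<le> 2 ^ J" by simp
  qed (use ln_2_less_1 in auto)
  \<comment> \<open>In multiples of 2^J: 1 for the index, 8 for the binomials and 1.1 for
    \<open>L_pen\<close>, together 10.1, below 11.\<close>
  have "- ln (prior Js m) \<le> 2 ^ J * 1 + 0 + 4 * 2 ^ J * 2" using 1 2 3 4 by linarith
  moreover have "L_pen Js m = 1.1 * 2 ^ J" by (simp add: L_pen_def model_index_eq[OF m J])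
  moreover have "(0::real) < 2 ^ J" by simp
  ultimately show ?thesis by argo
qed

section \<open>Wavelet approximation\<close>

lemma exists_top_subset:
  fixes v :: "'a \<Rightarrow> real"
  assumes "finite X" "s \<le> card X"
  shows "\<exists>A\<subseteq>X. card A = s \<and> (\<forall>a\<in>A. \<forall>b\<in>X - A. v b \<le> v a)"
  using assms(2)
proof (induction s)
  case 0
  show ?case by (intro exI[of _ "{}"]) auto
next
  case (Suc s)
  then obtain A where A: "A \<subseteq> X" "card A = s" "\<forall>a\<in>A. \<forall>b\<in>X - A. v b \<le> v a" by auto
  have fin: "finite (X - A)" "finite A" using assms(1) A(1) finite_subset by auto
  have "X - A \<noteq> {}" using Suc.prems A fin card_mono[of A X] by auto
  then have "Max (v ` (X - A)) \<in> v ` (X - A)" using fin by (intro Max_in) auto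
  then obtain c where c: "c \<in> X - A" "v c = Max (v ` (X - A))" by (metis imageE)
  have "\<forall>b\<in>X - A. v b \<le> v c" unfolding c(2) using fin by auto
  then show ?case using A c fin by (intro exI[of _ "insert c A"]) auto
qed

lemma continuous_L2_unit:
  assumes "continuous_on {0..1} f"
  shows "f \<in> L2_unit"
  unfolding L2_unit_def
  using borel_measurable_continuous_on_indicator[OF _ assms]
    borel_integrable_atLeastAtMost'[of 0 1 "\<lambda>x. (f x)\<^sup>2"] assms
  by (auto simp: set_borel_measurable_def intro!: continuous_intros)

lemma LINT_mono_continuous:
  fixes f g :: "real \<Rightarrow> real"
  assumes "continuous_on {0..1} f" "continuous_on {0..1} g" "\<And>x. x \<in> {0..1} \<Longrightarrow> f x \<le> g x"
  shows "(LINT x:{0..1}|lborel. f x) \<le> (LINT x:{0..1}|lborel. g x)"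
  using assms by (intro set_integral_mono borel_integrable_atLeastAtMost') auto

lemma L2_zero_continuous:
  fixes h :: "real \<Rightarrow> real"
  assumes "continuous_on {0..1} h" "(LINT x:{0..1}|lborel. (h x)\<^sup>2) \<le> 0" "x \<in> {0..1}"
  shows "h x = 0"
proof -
  have c: "continuous_on {0..1} (\<lambda>x. (h x)\<^sup>2)" using assms(1) by (intro continuous_intros)
  have "set_integrable lborel {0..1} (\<lambda>x. (h x)\<^sup>2)" by (rule borel_integrable_atLeastAtMost'[OF c])
  from set_borel_integral_eq_integral(2)[OF this]
  have "integral {0..1} (\<lambda>x. (h x)\<^sup>2) \<le> 0" using assms(2) by simp
  moreover have "0 \<le> integral {0..1} (\<lambda>x. (h x)\<^sup>2)" by (rule integral_nonneg[OF integrable_continuous_interval[OF c]]) simp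
  ultimately have "integral {0..1} (\<lambda>x. (h x)\<^sup>2) = 0" by simp
  then have "\<forall>x\<in>{0..1}. (h x)\<^sup>2 = 0"
    using integral_eq_0_iff[OF c] by simp
  then show ?thesis using assms(3) by simp
qed

text \<open>A Markov bound: if \<open>v\<close> copies of |b k|^p fit into the sum, then |b k| is at
  most v^(-1/p) times the l_p quasi-norm. \<open>v\<close> is real because it will be an unrounded
  level size.\<close>

lemma wavelet_coeff_le:
  fixes b :: "'k \<Rightarrow> real"
  assumes "0 < p" "finite X" "0 < v" "v * \<bar>b k\<bar> powr p \<le> (\<Sum>k\<in>X. \<bar>b k\<bar> powr p)"
    "(\<Sum>k\<in>X. \<bar>b k\<bar> powr p) powr (1 / p) \<le> N"
  shows "\<bar>b k\<bar> \<le> N * v powr (- (1 / p))"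
proof -
  let ?S = "\<Sum>k\<in>X. \<bar>b k\<bar> powr p"
  have S: "0 \<le> ?S" by (intro sum_nonneg) simp
  have "\<bar>b k\<bar> powr p \<le> ?S / v" using assms(3,4) by (simp add: field_simps)
  then have "(\<bar>b k\<bar> powr p) powr (1 / p) \<le> (?S / v) powr (1 / p)"
    using assms(1) by (intro powr_mono2) auto
  also have "(\<bar>b k\<bar> powr p) powr (1 / p) = \<bar>b k\<bar>"
    using assms(1) by (cases "b k = 0") (simp_all add: powr_powr)
  also have "(?S / v) powr (1 / p) = ?S powr (1 / p) * v powr (- (1 / p))"
    using S assms(3) by (simp add: powr_divide powr_minus_divide)
  also have "\<dots> \<le> N * v powr (- (1 / p))"
    using assms(5) by (intro mult_right_mono) auto
  finally show ?thesis .
qed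

text \<open>Bounded overlap: at a fixed point at most \<open>K\<close> wavelets of a level are
  nonzero, so the largest coefficient controls the sum whatever the number of terms.\<close>

lemma local_sum_le:
  fixes ph b :: "'k \<Rightarrow> real"
  assumes "finite X" "card {k\<in>X. ph k \<noteq> 0} \<le> K" "Y \<subseteq> X" "0 \<le> B" "0 \<le> H"
    and "\<And>k. k \<in> Y \<Longrightarrow> \<bar>b k\<bar> \<le> B" "\<And>k. k \<in> X \<Longrightarrow> \<bar>ph k\<bar> \<le> H"
  shows "\<bar>\<Sum>k\<in>Y. b k * ph k\<bar> \<le> real K * (B * H)"
proof -
  let ?Z = "{k\<in>Y. ph k \<noteq> 0}"
  have fin: "finite Y" using assms(1,3) finite_subset by blast
  have "(\<Sum>k\<in>Y. b k * ph k) = (\<Sum>k\<in>?Z. b k * ph k)"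
    using fin by (intro sum.mono_neutral_right) auto
  also have "\<bar>\<dots>\<bar> \<le> (\<Sum>k\<in>?Z. \<bar>b k * ph k\<bar>)" by (rule sum_abs)
  also have "\<dots> \<le> (\<Sum>k\<in>?Z. B * H)"
    unfolding abs_mult using assms by (intro sum_mono mult_mono) auto
  also have "\<dots> = real (card ?Z) * (B * H)" by simp
  also have "\<dots> \<le> real K * (B * H)"
  proof (rule mult_right_mono)
    have "card ?Z \<le> card {k\<in>X. ph k \<noteq> 0}" using assms(1,3) by (intro card_mono) auto
    then show "real (card ?Z) \<le> real K" using assms(2) by simp
  qed (use assms in simp)
  finally show ?thesis .
qed

lemma summable_powr_geometric:
  fixes u a :: real
  assumes "0 < u"
  shows "summable (\<lambda>l. 2 powr (- (real l * u)) * real (l + 1) powr a)"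
proof (rule summable_comparison_test_bigo)
  show "summable (\<lambda>l. norm (1 / real l ^ 2))"
    using inverse_power_summable[of 2, where 'a = real] by (simp add: inverse_eq_divide)
  show "(\<lambda>l. 2 powr (- (real l * u)) * real (l + 1) powr a) \<in> O(\<lambda>l. 1 / real l ^ 2)"
    using assms by real_asymp
qed

lemma wavelet_basisD:
  assumes "wavelet_basis \<phi> r"
  shows "\<And>j k. k \<in> {1..2^j} \<Longrightarrow> continuous_on {0..1} (\<phi> j k)"
    and "\<And>f. f \<in> L2_unit \<Longrightarrow> (\<lambda>J. LINT x:{0..1}|lborel.
      (f x - (\<Sum>j\<le>J. \<Sum>k\<in>{1..2^j}. L2_inner f (\<phi> j k) * \<phi> j k x))\<^sup>2) \<longlonglongrightarrow> 0"
    and "\<exists>K::nat. \<forall>j. \<forall>x\<in>{0..1}. card {k\<in>{1..2^j}. \<phi> j k x \<noteq> 0} \<le> K"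
    and "\<exists>K::real. \<forall>j. \<forall>k\<in>{1..2^j}. \<forall>x\<in>{0..1}. \<bar>\<phi> j k x\<bar> \<le> K * 2 powr (real j / 2)"
    and "\<And>p \<alpha>. 0 < p \<Longrightarrow> 1 / p < \<alpha> \<Longrightarrow> \<alpha> < r \<Longrightarrow> \<exists>c>0. \<forall>f\<in>L2_unit.
      ennreal c * wavelet_qnorm \<phi> \<alpha> p f \<le> besov_qnorm \<alpha> p f"
proof -
  note w = assms[unfolded wavelet_basis_def]
  show "continuous_on {0..1} (\<phi> j k)" if "k \<in> {1..2^j}" for j k
    using conjunct1[OF w] that by simp
  show "(\<lambda>J. LINT x:{0..1}|lborel.
      (f x - (\<Sum>j\<le>J. \<Sum>k\<in>{1..2^j}. L2_inner f (\<phi> j k) * \<phi> j k x))\<^sup>2) \<longlonglongrightarrow> 0"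
    if "f \<in> L2_unit" for f
    using w[THEN conjunct2, THEN conjunct2, THEN conjunct1] that by (rule bspec)
  show "\<exists>K::nat. \<forall>j. \<forall>x\<in>{0..1}. card {k\<in>{1..2^j}. \<phi> j k x \<noteq> 0} \<le> K"
    by (rule w[THEN conjunct2, THEN conjunct2, THEN conjunct2, THEN conjunct2, THEN conjunct1])
  show "\<exists>K::real. \<forall>j. \<forall>k\<in>{1..2^j}. \<forall>x\<in>{0..1}. \<bar>\<phi> j k x\<bar> \<le> K * 2 powr (real j / 2)"
    by (rule w[THEN conjunct2, THEN conjunct2, THEN conjunct2, THEN conjunct2, THEN conjunct2, THEN conjunct1])
  fix p \<alpha> assume "0 < p" "1 / p < \<alpha>" "\<alpha> < r"
  with w[THEN conjunct2, THEN conjunct2, THEN conjunct2, THEN conjunct2, THEN conjunct2, THEN conjunct2]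
  obtain c C :: real where c: "0 < c" "\<forall>f\<in>L2_unit.
      ennreal c * wavelet_qnorm \<phi> \<alpha> p f \<le> besov_qnorm \<alpha> p f \<and>
      besov_qnorm \<alpha> p f \<le> ennreal C * wavelet_qnorm \<phi> \<alpha> p f"
    by meson
  then show "\<exists>c>0. \<forall>f\<in>L2_unit. ennreal c * wavelet_qnorm \<phi> \<alpha> p f \<le> besov_qnorm \<alpha> p f"
    by blast
qed

lemma besov_coefficients:
  assumes wb: "wavelet_basis \<phi> r" and p: "0 < p" "1 / p < \<alpha>" "\<alpha> < r" and R: "0 < R"
  shows "\<exists>N>0. \<forall>f\<in>besov_ball \<alpha> p R. \<forall>j.
           (\<Sum>k\<in>{1..2^j}. \<bar>L2_inner f (\<phi> j k)\<bar> powr p) powr (1 / p) \<le> N * 2 powr (- (real j * (\<alpha> + 1/2 - 1/p)))"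
proof -
  from wavelet_basisD(5)[OF wb p] obtain c :: real where c: "0 < c"
    "\<forall>f\<in>L2_unit. ennreal c * wavelet_qnorm \<phi> \<alpha> p f \<le> besov_qnorm \<alpha> p f" by blast
  show ?thesis
  proof (intro exI[of _ "R / c"] conjI ballI allI)
    show "0 < R / c" using R c by simp
    fix f j assume f: "f \<in> besov_ball \<alpha> p R"
    let ?N = "(\<Sum>k\<in>{1..2^j}. \<bar>L2_inner f (\<phi> j k)\<bar> powr p) powr (1 / p)"
    let ?e = "real j * (\<alpha> + 1/2 - 1/p)"
    have L2: "f \<in> L2_unit" using f continuous_L2_unit by (auto simp: besov_ball_def)
    have "ennreal (2 powr ?e * ?N) \<le> wavelet_qnorm \<phi> \<alpha> p f"
      unfolding wavelet_qnorm_def by (rule SUP_upper) simp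
    then have "ennreal c * ennreal (2 powr ?e * ?N) \<le> ennreal c * wavelet_qnorm \<phi> \<alpha> p f"
      by (rule mult_left_mono) simp
    also have "\<dots> \<le> ennreal R" using c(2) L2 f by (force simp: besov_ball_def intro: order_trans)
    finally have "ennreal (c * (2 powr ?e * ?N)) \<le> ennreal R"
      using c(1) by (simp add: ennreal_mult)
    then have "c * (2 powr ?e * ?N) \<le> R" using R by (simp add: ennreal_le_iff)
    then show "?N \<le> R / c * 2 powr (- ?e)"
      using c(1) by (simp add: powr_minus field_simps)
  qed
qed

text \<open>At level j = J + l the rejected coefficients are, by their rank, at most a constant
  times 2^(-j (\<alpha> + 1/2 - 1/p)) v^(-1/p) with v = 2^J / (l + 1)^3. The wavelet height 2^(j/2)
  turns this into 2^(-J \<alpha>) times 2^(-l u) (l + 1)^(3/p), where u = \<alpha> - 1/p, and this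
  is summable in l. Selection thus gains the factor 2^(-J/p) over plain truncation; only the levels
  above \<open>Js\<close>, where nothing is kept, decay at the rate u.\<close>

lemma wavelet_approximation:
  assumes wb: "wavelet_basis \<phi> r" and p: "0 < p" "1 / p < \<alpha>" "\<alpha> < r" and R: "0 < R"
  shows "\<exists>C>0. \<forall>f\<in>besov_ball \<alpha> p R. \<forall>J Js. J \<le> Js \<longrightarrow>
     (\<exists>m\<in>models_at Js J. \<exists>g\<in>fun_vs.span ((\<lambda>(j, k). \<phi> j k) ` m). \<forall>x\<in>{0..1}.
        \<bar>f x - g x\<bar> \<le> C * (2 powr (- (real J * \<alpha>)) + 2 powr (- (real Js * (\<alpha> - 1/p)))))"
proof -
  from besov_coefficients[OF wb p R] obtain N where N: "N > 0"
    "\<And>f j. f \<in> besov_ball \<alpha> p R \<Longrightarrow>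
      (\<Sum>k\<in>{1..2^j}. \<bar>L2_inner f (\<phi> j k)\<bar> powr p) powr (1 / p) \<le> N * 2 powr (- (real j * (\<alpha> + 1/2 - 1/p)))"
    by blast
  from wavelet_basisD(3)[OF wb] obtain K :: nat where K: "\<And>j x. x \<in> {0..1} \<Longrightarrow> card {k\<in>{1..2^j}. \<phi> j k x \<noteq> 0} \<le> K"
    by blast
  from wavelet_basisD(4)[OF wb] obtain H0 :: real where H0: "\<And>j k x. k \<in> {1..2^j} \<Longrightarrow> x \<in> {0..1} \<Longrightarrow>
      \<bar>\<phi> j k x\<bar> \<le> H0 * 2 powr (real j / 2)"
    by blast
  define H where "H = max H0 0"
  have H: "\<bar>\<phi> j k x\<bar> \<le> H * 2 powr (real j / 2)" if "k \<in> {1..2^j}" "x \<in> {0..1}" for j k x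
    by (rule order_trans[OF H0[OF that] mult_right_mono]) (simp_all add: H_def)
  have H_nn: "0 \<le> H" by (simp add: H_def)
  note cont = wavelet_basisD(1)[OF wb] and compl = wavelet_basisD(2)[OF wb]
  define u where "u = \<alpha> - 1 / p"
  have u: "0 < u" using p by (simp add: u_def)
  define q where "q = 2 powr (- u)"
  have q: "0 < q" "q < 1" using u by (auto simp: q_def powr_less_one)
  have qpow: "2 powr (- (real j * u)) = q ^ j" for j
    by (simp add: q_def powr_realpow[symmetric] powr_powr mult.commute)
  define D where "D = real K * (N * H)"
  have D: "0 \<le> D" using N H_nn by (simp add: D_def)
  define W where "W = (\<Sum>l. 2 powr (- (real l * u)) * real (l + 1) powr (3 / p))"
  note W_sum = summable_powr_geometric[OF u, of "3 / p"]
  have W: "0 \<le> W" unfolding W_def by (intro suminf_nonneg W_sum) simp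
  \<comment> \<open>\<open>D * W\<close> pays for the rejected coefficients and
    \<open>D / (1 - q)\<close> for the levels above \<open>Js\<close>; the 1 secures
    positivity.\<close>
  define C where "C = D * W + D / (1 - q) + 1"
  have C: "0 < C" using D W q unfolding C_def by (intro add_nonneg_pos add_nonneg_nonneg) auto
  have "\<exists>m\<in>models_at Js J. \<exists>g\<in>fun_vs.span ((\<lambda>(j, k). \<phi> j k) ` m). \<forall>x\<in>{0..1}.
        \<bar>f x - g x\<bar> \<le> C * (2 powr (- (real J * \<alpha>)) + 2 powr (- (real Js * u)))"
    if f: "f \<in> besov_ball \<alpha> p R" and J: "J \<le> Js" for f J Js
  proof -
    have fcont: "continuous_on {0..1} f" using f by (simp add: besov_ball_def)
    define b where "b j k = L2_inner f (\<phi> j k)" for j k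
    define lev where "lev j x = (\<Sum>k\<in>{1..2^j}. b j k * \<phi> j k x)" for j x
    have levcont: "continuous_on {0..1} (lev j)" for j
      unfolding lev_def by (intro continuous_on_sum continuous_on_mult continuous_on_const cont)
    have coeff: "\<bar>b j k\<bar> \<le> N * 2 powr (- (real j * (\<alpha> + 1/2 - 1/p))) * v powr (- (1 / p))"
      if "0 < v" "v * \<bar>b j k\<bar> powr p \<le> (\<Sum>k\<in>{1..2^j}. \<bar>b j k\<bar> powr p)" for j k v
      using p(1) that N(2)[OF f, of j] unfolding b_def
      by (intro wavelet_coeff_le[of p "{1..2^j}"]) auto
    \<comment> \<open>Used with v = 1 for a whole level and with the unrounded level size for its
      rejected part.\<close>
    have sumle: "\<bar>\<Sum>k\<in>Y. b j k * \<phi> j k x\<bar> \<le> D * (q ^ j * v powr (- (1 / p)))"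
      if Y: "Y \<subseteq> {1..2^j}" and x: "x \<in> {0..1}" and v: "0 < v"
        "\<And>k. k \<in> Y \<Longrightarrow> v * \<bar>b j k\<bar> powr p \<le> (\<Sum>k\<in>{1..2^j}. \<bar>b j k\<bar> powr p)" for Y j x v
    proof -
      have "\<bar>\<Sum>k\<in>Y. b j k * \<phi> j k x\<bar> \<le>
        real K * ((N * 2 powr (- (real j * (\<alpha> + 1/2 - 1/p))) * v powr (- (1 / p))) * (H * 2 powr (real j / 2)))"
        using N(1) H_nn by (intro local_sum_le[OF _ K[OF x] Y] coeff v H x) auto
      also have "\<dots> = D * ((2 powr (- (real j * (\<alpha> + 1/2 - 1/p))) * 2 powr (real j / 2)) * v powr (- (1 / p)))"
        by (simp add: D_def mult_ac)
      also have "2 powr (- (real j * (\<alpha> + 1/2 - 1/p))) * 2 powr (real j / 2) = q ^ j"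
        unfolding qpow[symmetric] powr_add[symmetric] u_def by (simp add: algebra_simps)
      finally show ?thesis .
    qed
    have levle: "\<bar>lev j x\<bar> \<le> D * q ^ j" if "x \<in> {0..1}" for j x
    proof -
      have "\<bar>\<Sum>k\<in>{1..2^j}. b j k * \<phi> j k x\<bar> \<le> D * (q ^ j * 1 powr (- (1 / p)))"
      proof (rule sumle[OF _ that])
        fix k assume "k \<in> {1..2^j::nat}"
        then show "1 * \<bar>b j k\<bar> powr p \<le> (\<Sum>k\<in>{1..2^j}. \<bar>b j k\<bar> powr p)"
          unfolding mult_1 by (intro member_le_sum) auto
      qed auto
      then show ?thesis by (simp add: lev_def)
    qed
    have geo: "summable (\<lambda>j. D * q ^ j)" using q by (intro summable_mult summable_geometric) auto
    define F where "F x = (\<Sum>j. lev j x)" for x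
    have ul: "uniform_limit {0..1} (\<lambda>n x. \<Sum>j<n. lev j x) F sequentially"
      unfolding F_def using levle by (intro Weierstrass_m_test[OF _ geo]) auto
    have Fcont: "continuous_on {0..1} F"
      by (rule uniform_limit_theorem[OF _ ul]) (auto intro!: always_eventually continuous_on_sum levcont)
    \<comment> \<open>The series converges to \<open>F\<close> uniformly and to \<open>f\<close> in
      mean square. Both are continuous, so they agree at every point, design points
      included.\<close>
    have fF: "f x = F x" if x: "x \<in> {0..1}" for x
    proof -
      have "(LINT x:{0..1}|lborel. (f x - F x)\<^sup>2) \<le> 0"
      proof (rule field_le_epsilon)
        fix e :: real assume e: "0 < e"
        define e' where "e' = sqrt (e / 4)"
        have e': "0 < e'" "e'\<^sup>2 = e / 4" using e by (auto simp: e'_def)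
        have "\<forall>\<^sub>F n in sequentially. \<forall>x\<in>{0..1}. dist (\<Sum>j<n. lev j x) (F x) < e'"
          by (rule uniform_limitD[OF ul e'(1)])
        then have ev1: "\<forall>\<^sub>F n in sequentially. \<forall>x\<in>{0..1}. dist (\<Sum>j\<le>n. lev j x) (F x) < e'"
          unfolding eventually_sequentially lessThan_Suc_atMost[symmetric] by (metis le_SucI)
        have "\<forall>\<^sub>F n in sequentially. (LINT x:{0..1}|lborel. (f x - (\<Sum>j\<le>n. lev j x))\<^sup>2) < e / 4"
          using compl[OF continuous_L2_unit[OF fcont]] e unfolding lev_def b_def
          by (intro order_tendstoD(2)) auto
        from eventually_happens[OF eventually_conj[OF ev1 this]] obtain n where
          n: "\<forall>x\<in>{0..1}. dist (\<Sum>j\<le>n. lev j x) (F x) < e'"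
             "(LINT x:{0..1}|lborel. (f x - (\<Sum>j\<le>n. lev j x))\<^sup>2) < e / 4" by auto
        let ?S = "\<lambda>x. \<Sum>j\<le>n. lev j x"
        have Sc: "continuous_on {0..1} ?S" by (intro continuous_on_sum levcont)
        have c2: "continuous_on {0..1} (\<lambda>x. (f x - ?S x)\<^sup>2)"
          by (intro continuous_on_power continuous_on_diff fcont Sc)
        have "(LINT x:{0..1}|lborel. (f x - F x)\<^sup>2) \<le> (LINT x:{0..1}|lborel. 2 * (f x - ?S x)\<^sup>2 + 2 * e'\<^sup>2)"
        proof (rule LINT_mono_continuous)
          fix x :: real assume x: "x \<in> {0..1}"
          have "(f x - F x)\<^sup>2 + (f x - ?S x - (?S x - F x))\<^sup>2 = 2 * (f x - ?S x)\<^sup>2 + 2 * (?S x - F x)\<^sup>2"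
            by (simp add: power2_eq_square algebra_simps)
          moreover have "(?S x - F x)\<^sup>2 \<le> e'\<^sup>2"
            using n(1) x by (intro power2_le_iff_abs_le[THEN iffD2]) (auto simp: dist_real_def intro: less_imp_le)
          ultimately show "(f x - F x)\<^sup>2 \<le> 2 * (f x - ?S x)\<^sup>2 + 2 * e'\<^sup>2"
            using zero_le_power2[of "f x - ?S x - (?S x - F x)"] by linarith
        qed (intro continuous_on_power continuous_on_diff continuous_on_add continuous_on_mult continuous_on_const fcont Fcont Sc)+
        also have "\<dots> = 2 * (LINT x:{0..1}|lborel. (f x - ?S x)\<^sup>2) + (LINT x:{0..1::real}|lborel. 2 * e'\<^sup>2)"
          using borel_integrable_atLeastAtMost'[OF c2] borel_integrable_atLeastAtMost'[of 0 1 "\<lambda>_. 2 * e'\<^sup>2"]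
          by (subst set_integral_add(2)) auto
        also have "(LINT x:{0..1::real}|lborel. 2 * e'\<^sup>2) = e / 2"
          by (simp add: set_lebesgue_integral_def e')
        finally show "(LINT x:{0..1}|lborel. (f x - F x)\<^sup>2) \<le> 0 + e" using n(2) by simp
      qed
      then show ?thesis
        using L2_zero_continuous[OF continuous_on_diff[OF fcont Fcont] _ x] by simp
    qed
    have tail: "\<bar>f x - (\<Sum>j\<le>Js. lev j x)\<bar> \<le> D / (1 - q) * q ^ Js" if x: "x \<in> {0..1}" for x
    proof -
      have s: "summable (\<lambda>j. lev j x)"
        using levle[OF x] by (intro summable_comparison_test'[OF geo]) auto
      have "f x - (\<Sum>j\<le>Js. lev j x) = (\<Sum>j. lev (j + Suc Js) x)"
        using suminf_split_initial_segment[OF s, of "Suc Js"] fF[OF x]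
        by (simp add: F_def lessThan_Suc_atMost)
      also have "\<bar>\<dots>\<bar> \<le> (\<Sum>j. D * q ^ Suc Js * q ^ j)"
      proof -
        have g: "summable (\<lambda>j. D * q ^ Suc Js * q ^ j)" using q by (intro summable_mult summable_geometric) auto
        have "norm (\<Sum>j. lev (j + Suc Js) x) \<le> (\<Sum>j. D * q ^ Suc Js * q ^ j)"
        proof (rule norm_suminf_le[OF _ g])
          fix j
          show "norm (lev (j + Suc Js) x) \<le> D * q ^ Suc Js * q ^ j"
            using levle[OF x, of "j + Suc Js"] by (simp add: power_add mult_ac)
        qed
        then show ?thesis by simp
      qed
      also have "\<dots> = D * q ^ Suc Js / (1 - q)" using q by (simp add: suminf_mult suminf_geometric)
      also have "\<dots> \<le> D / (1 - q) * q ^ Js"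
      proof -
        have "D * q ^ Suc Js \<le> D * q ^ Js"
          using q D by (intro mult_left_mono power_decreasing) auto
        then have "D * q ^ Suc Js / (1 - q) \<le> D * q ^ Js / (1 - q)"
          using q by (intro divide_right_mono) auto
        then show ?thesis by simp
      qed
      finally show ?thesis .
    qed
    \<comment> \<open>What a selection at level \<open>j\<close> must achieve. Coarse levels keep
      every index, hence error 0; at the others the largest coefficients are kept.\<close>
    define P where "P j A \<longleftrightarrow> (\<forall>x\<in>{0..1}. \<bar>\<Sum>k\<in>{1..2^j} - A. b j k * \<phi> j k x\<bar> \<le>
        (if j < J then 0 else D * 2 powr (- (real J * \<alpha>)) *
           (2 powr (- (real (j - J) * u)) * real (j - J + 1) powr (3 / p))))" for j A
    have "\<exists>A\<in>Lambda J j. P j A" for j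
    proof (cases "j < J")
      case True
      then show ?thesis by (simp add: Lambda_def P_def)
    next
      case False
      define l where "l = j - J"
      have "level_size J j \<le> card {1..2^j::nat}" using False level_size_le_pow[of J j] by simp
      from exists_top_subset[OF _ this, of "\<lambda>k. \<bar>b j k\<bar>"] obtain A where
        A: "A \<subseteq> {1..2^j}" "card A = level_size J j" "\<forall>a\<in>A. \<forall>k\<in>{1..2^j} - A. \<bar>b j k\<bar> \<le> \<bar>b j a\<bar>" by auto
      define v where "v = 2 ^ J / real (l + 1) ^ 3"
      have v: "0 < v" by (simp add: v_def)
      have vA: "v \<le> real (card A) + 1" using level_size_real_ge[of J j] by (simp add: v_def l_def A(2))
      have finA: "finite A" using A(1) finite_subset by blast
      have vpow: "v powr (- (1 / p)) = 2 powr (- (real J * (1 / p))) * real (l + 1) powr (3 / p)"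
      proof -
        have "v = 2 powr real J * real (l + 1) powr (- 3)"
          unfolding v_def powr_minus by (simp add: powr_realpow divide_inverse)
        then show ?thesis by (simp add: powr_mult powr_powr)
      qed
      have main: "\<bar>\<Sum>k\<in>{1..2^j} - A. b j k * \<phi> j k x\<bar> \<le> D * 2 powr (- (real J * \<alpha>)) *
           (2 powr (- (real l * u)) * real (l + 1) powr (3 / p))" if x: "x \<in> {0..1}" for x
      proof -
        have "\<bar>\<Sum>k\<in>{1..2^j} - A. b j k * \<phi> j k x\<bar> \<le> D * (q ^ j * v powr (- (1 / p)))"
        proof (rule sumle[OF _ x v])
          fix k assume k: "k \<in> {1..2^j} - A"
          \<comment> \<open>The rejected \<open>k\<close> joins \<open>A\<close>: these
            \<open>card A + 1\<close> coefficients are all at least as large as that of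
            \<open>k\<close>, which recovers the 1 lost in rounding.\<close>
          have "v * \<bar>b j k\<bar> powr p \<le> (real (card A) + 1) * \<bar>b j k\<bar> powr p"
            using vA by (intro mult_right_mono) auto
          also have "\<dots> = (\<Sum>a\<in>insert k A. \<bar>b j k\<bar> powr p)"
            using k finA by (simp add: algebra_simps)
          also have "\<dots> \<le> (\<Sum>a\<in>insert k A. \<bar>b j a\<bar> powr p)"
            using A(3) k p(1) by (intro sum_mono powr_mono2) auto
          also have "\<dots> \<le> (\<Sum>k\<in>{1..2^j}. \<bar>b j k\<bar> powr p)"
            using A(1) k by (intro sum_mono2) auto
          finally show "v * \<bar>b j k\<bar> powr p \<le> (\<Sum>k\<in>{1..2^j}. \<bar>b j k\<bar> powr p)" .
        qed auto
        also have "q ^ j = 2 powr (- (real J * u)) * 2 powr (- (real l * u))"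
        proof -
          have "real j = real J + real l" using False by (simp add: l_def)
          then show ?thesis unfolding qpow[symmetric] powr_add[symmetric] by (simp add: algebra_simps)
        qed
        also have "D * (2 powr (- (real J * u)) * 2 powr (- (real l * u)) * v powr (- (1 / p))) =
          D * (2 powr (- (real J * u)) * 2 powr (- (real J * (1 / p)))) *
            (2 powr (- (real l * u)) * real (l + 1) powr (3 / p))"
          unfolding vpow by (simp only: mult_ac)
        also have "2 powr (- (real J * u)) * 2 powr (- (real J * (1 / p))) = 2 powr (- (real J * \<alpha>))"
          unfolding powr_add[symmetric] u_def by (simp add: algebra_simps)
        finally show ?thesis .
      qed
      have "A \<in> Lambda J j" using A False by (simp add: Lambda_def)
      then show ?thesis
        unfolding P_def if_not_P[OF False] l_def[symmetric] by (intro bexI ballI) (rule main)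
    qed
    then obtain A where A: "\<And>j. A j \<in> Lambda J j" "\<And>j. P j (A j)" by metis
    define m where "m = (\<Union>j\<le>Js. {j} \<times> A j)"
    have m: "m \<in> models_at Js J" unfolding models_at_def m_def using A(1) by blast
    define g where "g = (\<Sum>j\<le>Js. \<Sum>k\<in>A j. (\<lambda>x. b j k * \<phi> j k x))"
    have "\<phi> j k \<in> (\<lambda>(j, k). \<phi> j k) ` m" if "j \<le> Js" "k \<in> A j" for j k
      using that by (intro image_eqI[of _ _ "(j, k)"]) (auto simp: m_def)
    then have g: "g \<in> fun_vs.span ((\<lambda>(j, k). \<phi> j k) ` m)"
      unfolding g_def by (intro fun_vs.span_sum fun_vs.span_scale fun_vs.span_base) auto
    have gx: "g x = (\<Sum>j\<le>Js. \<Sum>k\<in>A j. b j k * \<phi> j k x)" for x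
      unfolding g_def by (simp add: sum_fun_eq[symmetric])
    have "\<bar>f x - g x\<bar> \<le> C * (2 powr (- (real J * \<alpha>)) + 2 powr (- (real Js * u)))" if x: "x \<in> {0..1}" for x
    proof -
      let ?d = "\<lambda>j. \<Sum>k\<in>{1..2^j} - A j. b j k * \<phi> j k x"
      have "lev j x = (\<Sum>k\<in>A j. b j k * \<phi> j k x) + ?d j" for j
        unfolding lev_def using Lambda_card(1)[OF A(1)[of j]]
        by (subst sum.subset_diff[of "A j"]) auto
      then have "(\<Sum>j\<le>Js. lev j x) = g x + (\<Sum>j\<le>Js. ?d j)"
        unfolding gx by (simp add: sum.distrib)
      then have "\<bar>f x - g x\<bar> \<le> \<bar>f x - (\<Sum>j\<le>Js. lev j x)\<bar> + \<bar>\<Sum>j\<le>Js. ?d j\<bar>" by linarith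
      moreover have "\<bar>\<Sum>j\<le>Js. ?d j\<bar> \<le> D * 2 powr (- (real J * \<alpha>)) * W"
      proof -
        let ?w = "\<lambda>l. 2 powr (- (real l * u)) * real (l + 1) powr (3 / p)"
        have "\<bar>\<Sum>j\<le>Js. ?d j\<bar> \<le> (\<Sum>j\<le>Js. \<bar>?d j\<bar>)" by (rule sum_abs)
        also have "\<dots> \<le> (\<Sum>j\<le>Js. if j < J then 0 else D * 2 powr (- (real J * \<alpha>)) * ?w (j - J))"
          by (rule sum_mono) (rule bspec[OF A(2)[unfolded P_def] x])
        also have "\<dots> = (\<Sum>j=J..Js. D * 2 powr (- (real J * \<alpha>)) * ?w (j - J))"
          by (rule sum.mono_neutral_cong_right) auto
        also have "\<dots> = D * 2 powr (- (real J * \<alpha>)) * (\<Sum>l<Suc Js - J. ?w l)"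
          unfolding sum_shift_levels[of "\<lambda>l. D * 2 powr (- (real J * \<alpha>)) * ?w l"]
          by (simp only: sum_distrib_left)
        also have "\<dots> \<le> D * 2 powr (- (real J * \<alpha>)) * W"
          unfolding W_def using D by (intro mult_left_mono sum_le_suminf W_sum) auto
        finally show ?thesis .
      qed
      moreover have "D / (1 - q) * q ^ Js \<le> C * 2 powr (- (real Js * u))"
        unfolding qpow using D W q unfolding C_def by (intro mult_right_mono) auto
      moreover have "D * 2 powr (- (real J * \<alpha>)) * W \<le> C * 2 powr (- (real J * \<alpha>))"
      proof -
        have "D * W * 2 powr (- (real J * \<alpha>)) \<le> C * 2 powr (- (real J * \<alpha>))"
          using D W q unfolding C_def by (intro mult_right_mono) auto
        then show ?thesis by (simp only: mult_ac)
      qed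
      ultimately show ?thesis using tail[OF x] unfolding distrib_left by linarith
    qed
    then show ?thesis using m g by blast
  qed
  then show ?thesis using C unfolding u_def by blast
qed

section \<open>The oracle inequality\<close>

text \<open>When a basis of \<open>U\<close> is extended to R^n, the added vectors \<open>f\<close>
  span the orthogonal complement, so the residual is a sum of exactly n - d squares, the degrees of
  freedom counted by \<open>N_star\<close>.\<close>

lemma residual_basis:
  assumes "flat n U"
  shows "\<exists>d e f. orthonormal n d e \<and> U = fun_vs.span (e ` {..<d}) \<and> d \<le> n \<and> fun_vs.dim U = d \<and>
     orthonormal n (n - d) f \<and> (\<forall>y. sqnorm n (y - proj n U y) = (\<Sum>i<n - d. (inner_n n y (f i))\<^sup>2))"
proof -
  from assms obtain d e where on: "orthonormal n d e" and U: "U = fun_vs.span (e ` {..<d})"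
    unfolding flat_def by blast
  from orthonormal_extend[OF on] obtain e' where e': "d \<le> n" "\<forall>i<d. e' i = e i"
    "orthonormal n n e'" "fun_vs.span (e' ` {..<n}) = euclid n" by blast
  define f where "f i = e' (d + i)" for i
  have "orthonormal n (n - d) f"
    using e'(1,3) unfolding orthonormal_def f_def by auto
  moreover have "sqnorm n (y - proj n U y) = (\<Sum>i<n - d. (inner_n n y (f i))\<^sup>2)" for y
  proof -
    have "sqnorm n (proj n U y) = (\<Sum>i<d. (inner_n n y (e' i))\<^sup>2)"
      unfolding proj_orthonormal[OF on U] sqnorm_lincomb[OF on]
      using e'(2) by (intro sum.cong) auto
    moreover have "(\<Sum>i<n. (inner_n n y (e' i))\<^sup>2) =
        (\<Sum>i<d. (inner_n n y (e' i))\<^sup>2) + (\<Sum>i<n - d. (inner_n n y (f i))\<^sup>2)"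
    proof -
      have "(\<Sum>i<n. (inner_n n y (e' i))\<^sup>2) =
          (\<Sum>i<d. (inner_n n y (e' i))\<^sup>2) + (\<Sum>i\<in>{d..<n}. (inner_n n y (e' i))\<^sup>2)"
        using e'(1) by (subst sum.union_disjoint[symmetric]) (auto simp: ivl_disj_un)
      also have "(\<Sum>i\<in>{d..<n}. (inner_n n y (e' i))\<^sup>2) = (\<Sum>i<n - d. (inner_n n y (f i))\<^sup>2)"
        unfolding f_def by (rule sum.reindex_bij_witness[of _ "\<lambda>i. d + i" "\<lambda>i. i - d"]) auto
      finally show ?thesis .
    qed
    ultimately show ?thesis
      using pythagoras_0[OF assms, of y] parseval[OF e'(3,4), of y] by linarith
  qed
  ultimately show ?thesis using on U e'(1) dim_orthonormal[OF on] by blast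
qed

lemma inv_phi_fun:
  assumes "0 < y"
  defines "x \<equiv> inv_into {0<..<1} phi_fun y"
  shows "0 < x" "x < 1" "phi_fun x = y" "exp (- (2 * y) - 1) \<le> x"
proof -
  \<comment> \<open>Here \<open>phi_fun ?a\<close> equals y + ?a / 2, so the intermediate value
    theorem on \<open>{?a..1}\<close> produces a preimage, without which \<open>inv_into\<close>
    would be unspecified.\<close>
  let ?a = "exp (- (2 * y) - 1)"
  have a: "0 < ?a" "?a \<le> 1" using assms by auto
  have "\<exists>t. ?a \<le> t \<and> t \<le> 1 \<and> phi_fun t = y"
  proof (rule IVT2')
    show "y \<le> phi_fun ?a" using a by (simp add: phi_fun_def)
    show "phi_fun 1 \<le> y" using assms by (simp add: phi_fun_def)
    show "continuous_on {?a..1} phi_fun"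
      unfolding phi_fun_def using a by (auto intro!: continuous_intros dest: order_trans)
  qed (rule a)
  then obtain t where t: "?a \<le> t" "t \<le> 1" "phi_fun t = y" by blast
  have "t \<noteq> 1" using t(3) assms(1) by (auto simp: phi_fun_def)
  then have "y \<in> phi_fun ` {0<..<1}"
    using t less_le_trans[OF a(1) t(1)] by (intro image_eqI[of _ _ t]) auto
  from inv_into_into[OF this] f_inv_into_f[OF this]
  show x: "0 < x" "x < 1" and phi: "phi_fun x = y" unfolding x_def by auto
  have "ln x = x - 1 - 2 * y" using phi by (simp add: phi_fun_def)
  then have "- (2 * y) - 1 \<le> ln x" using x by linarith
  then show "?a \<le> x" using x by (simp add: ln_ge_iff)
qed

lemma residual_measurable:
  assumes "iid_std_gaussian M n \<epsilon>"
  shows "(\<lambda>\<omega>. \<Sum>i<N. (a i + inner_n n (\<lambda>i. \<epsilon> i \<omega>) (f i))\<^sup>2) \<in> borel_measurable M"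
  using iid_inner_measurable[OF assms] by measurable

lemma residual_laplace_integrable:
  assumes "iid_std_gaussian M n \<epsilon>" "0 \<le> s"
  shows "integrable M (\<lambda>\<omega>. exp (- s * (\<Sum>i<N. (a i + inner_n n (\<lambda>i. \<epsilon> i \<omega>) (f i))\<^sup>2)))"
proof -
  interpret prob_space M using assms by (simp add: iid_std_gaussian_def)
  note [measurable] = residual_measurable[OF assms(1)]
  show ?thesis
    using assms(2) by (intro integrable_const_bound[where B=1]) (auto intro!: mult_nonneg_nonneg sum_nonneg)
qed

text \<open>A Chernoff bound with the optimal parameter, the solution of 1 + 2 s = 1/x. Its exponent
  is \<open>phi_fun\<close>, which explains this function in the definition of
  \<open>beta\<close>.\<close>

lemma residual_lower_tail:
  assumes iid: "iid_std_gaussian M n \<epsilon>" and f: "orthonormal n N f" and x: "0 < x" "x < 1"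
  shows "measure M {\<omega>\<in>space M. (\<Sum>i<N. (a i + inner_n n (\<lambda>i. \<epsilon> i \<omega>) (f i))\<^sup>2) < x * real N}
     \<le> exp (- (real N * phi_fun x))"
proof -
  interpret prob_space M using iid by (simp add: iid_std_gaussian_def)
  let ?Q = "\<lambda>\<omega>. \<Sum>i<N. (a i + inner_n n (\<lambda>i. \<epsilon> i \<omega>) (f i))\<^sup>2"
  note [measurable] = residual_measurable[OF iid]
  define s where "s = (1 / x - 1) / 2"
  have s: "0 \<le> s" "1 + 2 * s = 1 / x" using x by (auto simp: s_def field_simps)
  note int = residual_laplace_integrable[OF iid s(1), where N=N and a=a and f=f]
  have "measure M {\<omega>\<in>space M. ?Q \<omega> < x * real N} = (\<integral>\<omega>. indicator {\<omega>\<in>space M. ?Q \<omega> < x * real N} \<omega> \<partial>M)"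
    by (simp add: Int_absorb1)
  also have "\<dots> \<le> (\<integral>\<omega>. exp (s * x * real N) * exp (- s * ?Q \<omega>) \<partial>M)"
  proof (rule integral_mono)
    fix \<omega>
    have "0 \<le> s * (x * real N - ?Q \<omega>)" if "?Q \<omega> < x * real N"
      using s that by (intro mult_nonneg_nonneg) auto
    then show "indicator {\<omega>\<in>space M. ?Q \<omega> < x * real N} \<omega> \<le> exp (s * x * real N) * exp (- s * ?Q \<omega>)"
      by (auto simp: indicator_def exp_add[symmetric] algebra_simps)
  qed (use int in \<open>auto intro!: integrable_real_indicator simp: emeasure_eq_measure\<close>)
  also have "\<dots> = exp (s * x * real N) * (\<integral>\<omega>. exp (- s * ?Q \<omega>) \<partial>M)" by simp
  also have "\<dots> \<le> exp (s * x * real N) * (1 / sqrt (1 + 2 * s)) ^ N"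
    by (intro mult_left_mono gaussian_quadratic_laplace[OF iid f s(1)]) simp
  also have "1 / sqrt (1 + 2 * s) = exp (ln x / 2)"
  proof -
    have "sqrt x = exp (ln x / 2)" using x by (simp add: ln_sqrt[symmetric])
    then show ?thesis unfolding s by (simp add: real_sqrt_divide)
  qed
  also have "exp (s * x * real N) * exp (ln x / 2) ^ N = exp (- (real N * phi_fun x))"
    using x by (simp add: exp_of_nat_mult[symmetric] exp_add[symmetric] phi_fun_def s_def field_simps)
  finally show ?thesis .
qed

text \<open>\<open>var_est\<close> stands in a denominator. The indicator of a vanishing residual is
  at most exp(-k Q) for every k, and the Laplace bound tends to 0 as k grows.\<close>

lemma residual_AE_pos:
  assumes iid: "iid_std_gaussian M n \<epsilon>" and f: "orthonormal n N f" and N: "0 < N"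
  shows "AE \<omega> in M. 0 < (\<Sum>i<N. (a i + inner_n n (\<lambda>i. \<epsilon> i \<omega>) (f i))\<^sup>2)"
proof -
  interpret prob_space M using iid by (simp add: iid_std_gaussian_def)
  let ?Q = "\<lambda>\<omega>. \<Sum>i<N. (a i + inner_n n (\<lambda>i. \<epsilon> i \<omega>) (f i))\<^sup>2"
  note [measurable] = residual_measurable[OF iid]
  have le: "measure M {\<omega>\<in>space M. ?Q \<omega> = 0} \<le> 1 / sqrt (1 + 2 * real k)" for k :: nat
  proof -
    have "measure M {\<omega>\<in>space M. ?Q \<omega> = 0} = (\<integral>\<omega>. indicator {\<omega>\<in>space M. ?Q \<omega> = 0} \<omega> \<partial>M)"
      by (simp add: Int_absorb1)
    also have "\<dots> \<le> (\<integral>\<omega>. exp (- real k * ?Q \<omega>) \<partial>M)"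
    proof (rule integral_mono)
      show "integrable M (indicator {\<omega>\<in>space M. ?Q \<omega> = 0} :: _ \<Rightarrow> real)"
        by (rule integrable_real_indicator) (auto simp: emeasure_eq_measure)
      show "integrable M (\<lambda>\<omega>. exp (- real k * ?Q \<omega>))"
        by (rule residual_laplace_integrable[OF iid]) simp
    qed (auto simp: indicator_def)
    also have "\<dots> \<le> (1 / sqrt (1 + 2 * real k)) ^ N"
      by (rule gaussian_quadratic_laplace[OF iid f]) simp
    also have "\<dots> \<le> (1 / sqrt (1 + 2 * real k)) ^ 1"
      using N by (intro power_decreasing) auto
    finally show ?thesis by simp
  qed
  have "(\<lambda>k. 1 / sqrt (1 + 2 * real k)) \<longlonglongrightarrow> 0" by real_asymp
  then have "measure M {\<omega>\<in>space M. ?Q \<omega> = 0} \<le> 0"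
    using le by (intro LIMSEQ_le_const) auto
  then have "measure M {\<omega>\<in>space M. ?Q \<omega> = 0} = 0" by (simp add: measure_le_0_iff)
  then have "AE \<omega> in M. ?Q \<omega> \<noteq> 0"
    by (subst AE_iff_measurable[OF _ refl]) (auto simp: emeasure_eq_measure)
  then show ?thesis
    by (rule AE_mp) (auto intro!: AE_I2 simp: less_le sum_nonneg)
qed

text \<open>Integrability travels with the bound: the Bochner integral of a non-integrable function
  is 0, so a bound alone would say nothing.\<close>

definition mean_le :: "'a measure \<Rightarrow> ('a \<Rightarrow> real) \<Rightarrow> real \<Rightarrow> bool" where
  "mean_le M f c \<longleftrightarrow> integrable M f \<and> integral\<^sup>L M f \<le> c"

lemma mean_le_nn:
  assumes "f \<in> borel_measurable M" "\<And>\<omega>. 0 \<le> f \<omega>" "(\<integral>\<^sup>+\<omega>. ennreal (f \<omega>) \<partial>M) \<le> ennreal c" "0 \<le> c"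
  shows "mean_le M f c"
proof -
  have "integrable M f"
    using assms le_less_trans[OF assms(3)] by (intro integrableI_nonneg) auto
  moreover have "integral\<^sup>L M f \<le> c"
    using assms by (subst integral_eq_nn_integral) (auto simp: enn2real_le_iff enn2real_leI)
  ultimately show ?thesis by (simp add: mean_le_def)
qed

lemma mean_le_add: "mean_le M f c \<Longrightarrow> mean_le M g c' \<Longrightarrow> mean_le M (\<lambda>\<omega>. f \<omega> + g \<omega>) (c + c')"
  by (auto simp: mean_le_def intro: add_mono)

lemma mean_le_cmult: "0 \<le> a \<Longrightarrow> mean_le M f c \<Longrightarrow> mean_le M (\<lambda>\<omega>. a * f \<omega>) (a * c)"
  by (auto simp: mean_le_def intro: mult_left_mono)

lemma mean_le_sum:
  "(\<And>i. i \<in> I \<Longrightarrow> mean_le M (f i) (c i)) \<Longrightarrow> mean_le M (\<lambda>\<omega>. \<Sum>i\<in>I. f i \<omega>) (\<Sum>i\<in>I. c i)"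
  by (auto simp: mean_le_def intro!: sum_mono)

lemma mean_le_const: "prob_space M \<Longrightarrow> mean_le M (\<lambda>_. c) c"
  by (auto simp: mean_le_def prob_space.prob_space intro!: finite_measure.integrable_const prob_space.finite_measure)

lemma mean_le_mono: "mean_le M f c \<Longrightarrow> c \<le> c' \<Longrightarrow> mean_le M f c'"
  by (auto simp: mean_le_def)

lemma mean_le_AE:
  assumes "mean_le M g c" "f \<in> borel_measurable M" "\<And>\<omega>. 0 \<le> f \<omega>" "AE \<omega> in M. f \<omega> \<le> g \<omega>"
  shows "mean_le M f c"
proof -
  have g: "integrable M g" "integral\<^sup>L M g \<le> c" using assms(1) by (auto simp: mean_le_def)
  have f: "integrable M f"
    by (rule Bochner_Integration.integrable_bound[OF g(1) assms(2)])
       (use assms(4) in \<open>rule AE_mp\<close>, use assms(3) in \<open>auto intro!: AE_I2 intro: order_trans\<close>)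
  show ?thesis using integral_mono_AE[OF f g(1) assms(4)] f g(2) by (simp add: mean_le_def)
qed

text \<open>The last hypothesis says that the logarithm of the exact moment, with the normalisation
  \<open>c\<close> included, is nonpositive.\<close>

lemma gaussian_quadratic_mean_le:
  assumes iid: "iid_std_gaussian M n \<epsilon>" and on: "orthonormal n d e"
    and t: "0 \<le> t" "t < 1 / 2" and perp: "\<And>i. i < d \<Longrightarrow> inner_n n b (e i) = 0"
    and c: "c + real d * (- ln (1 - 2 * t) / 2) + sqnorm n b / 2 \<le> 0"
  shows "mean_le M (\<lambda>\<omega>. exp (t * (\<Sum>i<d. (inner_n n (\<lambda>i. \<epsilon> i \<omega>) (e i))\<^sup>2) + inner_n n (\<lambda>i. \<epsilon> i \<omega>) b + c)) 1"
proof (rule mean_le_nn)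
  note [measurable] = iid_inner_measurable[OF iid]
  let ?g = "\<lambda>\<omega>. exp (t * (\<Sum>i<d. (inner_n n (\<lambda>i. \<epsilon> i \<omega>) (e i))\<^sup>2) + inner_n n (\<lambda>i. \<epsilon> i \<omega>) b)"
  show "(\<lambda>\<omega>. exp (t * (\<Sum>i<d. (inner_n n (\<lambda>i. \<epsilon> i \<omega>) (e i))\<^sup>2) + inner_n n (\<lambda>i. \<epsilon> i \<omega>) b + c)) \<in> borel_measurable M"
    by measurable
  have "(\<integral>\<^sup>+\<omega>. ennreal (exp (t * (\<Sum>i<d. (inner_n n (\<lambda>i. \<epsilon> i \<omega>) (e i))\<^sup>2) + inner_n n (\<lambda>i. \<epsilon> i \<omega>) b + c)) \<partial>M)
      = (\<integral>\<^sup>+\<omega>. ennreal (exp c) * ennreal (?g \<omega>) \<partial>M)"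
    by (intro nn_integral_cong) (simp add: ennreal_mult[symmetric] exp_add[symmetric] add.commute del: ennreal_mult)
  also have "\<dots> = ennreal (exp c) * ennreal ((1 / sqrt (1 - 2 * t)) ^ d * exp (sqnorm n b / 2))"
    by (subst nn_integral_cmult) (measurable, simp only: gaussian_quadratic_mgf[OF iid on t perp])
  also have "1 / sqrt (1 - 2 * t) = exp (- ln (1 - 2 * t) / 2)"
  proof -
    have "sqrt (1 - 2 * t) = exp (ln (1 - 2 * t) / 2)" using t by (simp add: ln_sqrt[symmetric])
    then show ?thesis by (simp add: exp_minus inverse_eq_divide)
  qed
  also have "ennreal (exp c) * ennreal (exp (- ln (1 - 2 * t) / 2) ^ d * exp (sqnorm n b / 2)) =
      ennreal (exp (c + real d * (- ln (1 - 2 * t) / 2) + sqnorm n b / 2))"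
    by (simp only: exp_of_nat_mult[symmetric] ennreal_mult[symmetric] exp_ge_zero mult_nonneg_nonneg
        exp_add[symmetric] add.assoc)
  also have "\<dots> \<le> ennreal 1" using c by (intro ennreal_leI) simp
  finally show "(\<integral>\<^sup>+\<omega>. ennreal (exp (t * (\<Sum>i<d. (inner_n n (\<lambda>i. \<epsilon> i \<omega>) (e i))\<^sup>2) + inner_n n (\<lambda>i. \<epsilon> i \<omega>) b + c)) \<partial>M) \<le> ennreal 1" .
qed auto

lemma noise_mean_le:
  assumes iid: "iid_std_gaussian M n \<epsilon>"
  shows "mean_le M (\<lambda>\<omega>. sqnorm n (\<lambda>i. \<epsilon> i \<omega>)) (8 * real n)"
proof -
  have sq: "mean_le M (\<lambda>\<omega>. (\<epsilon> i \<omega>)\<^sup>2) 8" if i: "i \<in> {1..n}" for i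
  proof (rule mean_le_nn)
    note [measurable] = iid_measurable[OF iid i]
    show "(\<lambda>\<omega>. (\<epsilon> i \<omega>)\<^sup>2) \<in> borel_measurable M" by measurable
    \<comment> \<open>The exponent 1/4 lies below the critical 1/2; its Gaussian moment is
      \<open>sqrt 2\<close>, and 4 * sqrt 2 is below 8.\<close>
    have le: "x\<^sup>2 \<le> 4 * exp (1 / 4 * x\<^sup>2)" for x :: real
      using exp_ge_add_one_self[of "1 / 4 * x\<^sup>2"] by linarith
    have "(\<integral>\<^sup>+\<omega>. ennreal ((\<epsilon> i \<omega>)\<^sup>2) \<partial>M) \<le> (\<integral>\<^sup>+\<omega>. ennreal (4 * exp (1 / 4 * (\<epsilon> i \<omega>)\<^sup>2)) \<partial>M)"
      using le by (intro nn_integral_mono ennreal_leI) auto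
    also have "\<dots> = (\<integral>\<^sup>+x. ennreal (4 * exp (1 / 4 * x\<^sup>2)) \<partial>std_normal_distribution)"
      by (rule iid_nn_integral[OF iid i]) measurable
    also have "\<dots> = 4 * (\<integral>\<^sup>+x. ennreal (exp (1 / 4 * x\<^sup>2)) \<partial>std_normal_distribution)"
      by (subst nn_integral_cmult[symmetric]) (auto simp: ennreal_mult)
    also have "\<dots> = 4 * ennreal (1 / sqrt (1 - 2 * (1 / 4)))"
      by (subst nn_integral_std_normal_exp_square) auto
    also have "\<dots> = ennreal (4 * sqrt 2)"
      by (simp add: ennreal_mult real_sqrt_divide)
    also have "\<dots> \<le> ennreal 8"
      by (intro ennreal_leI) (use real_sqrt_le_mono[of 2 4] in simp)
    finally show "(\<integral>\<^sup>+\<omega>. ennreal ((\<epsilon> i \<omega>)\<^sup>2) \<partial>M) \<le> ennreal 8" .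
  qed auto
  have "mean_le M (\<lambda>\<omega>. \<Sum>i=1..n. (\<epsilon> i \<omega>)\<^sup>2) (\<Sum>i=1..n. 8)"
    by (rule mean_le_sum) (rule sq)
  then show ?thesis by (simp add: sqnorm_def inner_n_def power2_eq_square mult.commute)
qed


text \<open>Trades a variable for its exponential: if exp((z - y) / \<tau>) has mean at most 1, then
  \<open>z\<close> is pointwise at most \<open>y\<close> plus a term of mean at most \<tau>. Unlike
  a bound on the mean of \<open>z\<close>, this survives restriction to an event.\<close>

lemma le_exp_shift: "0 < \<tau> \<Longrightarrow> z \<le> y + \<tau> * exp (z / \<tau> - y / \<tau>)" for z y \<tau> :: real
proof -
  assume \<tau>: "0 < \<tau>"
  then have "\<tau> * (1 + (z / \<tau> - y / \<tau>)) \<le> \<tau> * exp (z / \<tau> - y / \<tau>)"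
    by (intro mult_left_mono exp_ge_add_one_self) auto
  moreover have "\<tau> * (1 + (z / \<tau> - y / \<tau>)) = \<tau> + z - y" using \<tau> by (simp add: algebra_simps)
  ultimately show ?thesis using \<tau> by linarith
qed

text \<open>The left side is the price of one dimension in the exponential moment: 11/40 is 11/10
  divided by the 4 of \<tau> = 4 \<sigma>^2. The fifth power bounds exp(22/25) from below by
  rational arithmetic.\<close>

lemma ln_fraction: "- ln (1 - 2 * (11/40)) / 2 \<le> (11/25 :: real)"
proof -
  have "20 / 9 \<le> (1 + 22/25 / of_nat 5 :: real) ^ 5" by (simp add: power_divide)
  also have "\<dots> \<le> exp (22/25)" by (rule exp_ge_one_plus_x_over_n_power_n) auto
  finally have "exp (- (22/25)) \<le> (9/20 :: real)"
    by (simp add: exp_minus field_simps)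
  then have "- (22/25) \<le> ln (9/20 :: real)" by (simp add: ln_ge_iff)
  then show ?thesis by simp
qed

lemma sqnorm_proj_scaled:
  assumes on: "orthonormal n d e" and S: "S = fun_vs.span (e ` {..<d})"
  shows "sqnorm n (proj n S (\<lambda>i. \<sigma> * y i)) = \<sigma>\<^sup>2 * (\<Sum>j<d. (inner_n n y (e j))\<^sup>2)"
  unfolding proj_orthonormal[OF on S] sqnorm_lincomb[OF on] inner_n_simps
  by (simp add: power_mult_distrib sum_distrib_left)

text \<open>After division by 4 \<sigma>^2 the squared bias enters with -9/40 per \<sigma>^2, while
  the Gaussian fluctuation along it costs only 1/8; the fitted noise costs at most 11/25 per
  dimension, paid by \<open>L\<close>. The two noises concern orthogonal directions, so the costs
  simply add.\<close>

lemma exponential_criterion_mean_le: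
  assumes iid: "iid_std_gaussian M n \<epsilon>" and \<sigma>: "0 < \<sigma>"
    and on: "orthonormal n d e" and S: "S = fun_vs.span (e ` {..<d})" and L: "11 * real d \<le> 25 * L"
    and \<xi>: "\<And>\<omega>. \<xi> \<omega> = (\<lambda>i. \<sigma> * \<epsilon> i \<omega>)"
  shows "mean_le M (\<lambda>\<omega>. exp ((- (9/10) * sqnorm n (\<mu> - proj n S \<mu>)
      - 2 * inner_n n (\<xi> \<omega>) (\<mu> - proj n S \<mu>) + 11/10 * sqnorm n (proj n S (\<xi> \<omega>))) / (4 * \<sigma>\<^sup>2) - L)) 1"
proof -
  let ?v = "\<mu> - proj n S \<mu>"
  \<comment> \<open>The factor is -2 \<sigma> / (4 \<sigma>^2).\<close>
  let ?b = "\<lambda>i. (- (1 / (2 * \<sigma>))) * ?v i"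
  let ?c = "- (9/40) * sqnorm n ?v / \<sigma>\<^sup>2 - L"
  have flat: "flat n S" using on S unfolding flat_def by blast
  have eS: "e i \<in> S" if "i < d" for i
    unfolding S using that by (intro fun_vs.span_base) auto
  have "inner_n n ?b (e i) = 0" if "i < d" for i
    using proj_perp[OF flat eS[OF that], of \<mu>] by (simp only: inner_n_simps mult_zero_right)
  moreover have "?c + real d * (- ln (1 - 2 * (11/40)) / 2) + sqnorm n ?b / 2 \<le> 0"
  proof -
    have "real d * (- ln (1 - 2 * (11/40)) / 2) \<le> real d * (11/25)"
      by (intro mult_left_mono ln_fraction) simp
    moreover have "sqnorm n ?b / 2 = 1/8 * sqnorm n ?v / \<sigma>\<^sup>2"
    proof -
      have "sqnorm n ?b = (- (1 / (2 * \<sigma>)))\<^sup>2 * sqnorm n ?v" by (rule sqnorm_scale)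
      moreover have "(- (1 / (2 * \<sigma>)))\<^sup>2 * a / 2 = 1/8 * a / \<sigma>\<^sup>2" for a by (simp add: power_divide)
      ultimately show ?thesis by (simp only:)
    qed
    moreover have "1/8 * sqnorm n ?v / \<sigma>\<^sup>2 \<le> 9/40 * sqnorm n ?v / \<sigma>\<^sup>2"
      by (intro divide_right_mono mult_right_mono) auto
    ultimately show ?thesis using L by simp
  qed
  ultimately have "mean_le M (\<lambda>\<omega>. exp (11/40 * (\<Sum>i<d. (inner_n n (\<lambda>i. \<epsilon> i \<omega>) (e i))\<^sup>2)
      + inner_n n (\<lambda>i. \<epsilon> i \<omega>) ?b + ?c)) 1"
    by (intro gaussian_quadratic_mean_le[OF iid on]) auto
  moreover have "11/40 * (\<Sum>i<d. (inner_n n (\<lambda>i. \<epsilon> i \<omega>) (e i))\<^sup>2) + inner_n n (\<lambda>i. \<epsilon> i \<omega>) ?b + ?c =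
     (- (9/10) * sqnorm n ?v - 2 * inner_n n (\<xi> \<omega>) ?v + 11/10 * sqnorm n (proj n S (\<xi> \<omega>))) / (4 * \<sigma>\<^sup>2) - L" for \<omega>
  proof -
    have 1: "sqnorm n (proj n S (\<xi> \<omega>)) = \<sigma>\<^sup>2 * (\<Sum>j<d. (inner_n n (\<lambda>i. \<epsilon> i \<omega>) (e j))\<^sup>2)"
      unfolding \<xi> by (rule sqnorm_proj_scaled[OF on S])
    have 2: "inner_n n (\<xi> \<omega>) ?v = \<sigma> * inner_n n (\<lambda>i. \<epsilon> i \<omega>) ?v" unfolding \<xi> inner_n_simps(5) ..
    have 3: "inner_n n (\<lambda>i. \<epsilon> i \<omega>) ?b = - (1 / (2 * \<sigma>)) * inner_n n (\<lambda>i. \<epsilon> i \<omega>) ?v"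
      by (rule inner_n_simps(6))
    have "11/40 * s + - (1 / (2 * \<sigma>)) * z + (- (9/40) * a / \<sigma>\<^sup>2 - L) =
       (- (9/10) * a - 2 * (\<sigma> * z) + 11/10 * (\<sigma>\<^sup>2 * s)) / (4 * \<sigma>\<^sup>2) - L" for s z a :: real
      using \<sigma> by (simp add: field_simps power2_eq_square)
    then show ?thesis unfolding 1 2 3 .
  qed
  ultimately show ?thesis by (simp only:)
qed

text \<open>The cases \<tau> \<le> \<open>T\<close> and \<open>T\<close> < \<tau> are majorised by
  one sum \<open>D\<close> of nonnegative terms, each with its own bound in mean. This avoids
  integrating over events, on which centred noise would not stay centred.\<close>

lemma mixture_oracle:
  fixes S :: "'i \<Rightarrow> (nat \<Rightarrow> real) set"
  assumes iid: "iid_std_gaussian M n \<epsilon>" and \<sigma>: "0 < \<sigma>" and n: "0 < n"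
    and I: "finite I" "i0 \<in> I" and q: "\<And>i. i \<in> I \<Longrightarrow> 0 < q i" "sum q I \<le> 1"
    and L: "\<And>i. i \<in> I \<Longrightarrow> 0 \<le> L i"
    and S: "\<And>i. i \<in> I \<Longrightarrow> \<exists>d e. orthonormal n d e \<and> S i = fun_vs.span (e ` {..<d}) \<and> 11 * real d \<le> 25 * L i"
    and SU: "\<And>i. i \<in> I \<Longrightarrow> S i \<subseteq> U" and U: "flat n U"
    and N: "N = n - fun_vs.dim U" "0 < N"
    and \<beta>: "0 < \<beta>" "4 * \<beta> < 1" "exp (- (real N * phi_fun (4 * \<beta>))) \<le> 1 / real n"
    and Y: "\<And>\<omega>. Y \<omega> = (\<lambda>i. \<mu> i + \<sigma> * \<epsilon> i \<omega>)"
    and V: "\<And>\<omega>. vv \<omega> = sqnorm n (Y \<omega> - proj n U (Y \<omega>)) / real N"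
    and w: "\<And>i \<omega>. i \<in> I \<Longrightarrow> w \<omega> i = q i * exp (\<beta> * sqnorm n (proj n (S i) (Y \<omega>)) / vv \<omega> - L i) /
              (\<Sum>i\<in>I. q i * exp (\<beta> * sqnorm n (proj n (S i) (Y \<omega>)) / vv \<omega> - L i))"
    and mh: "\<And>\<omega>. mh \<omega> = (\<lambda>k. \<Sum>i\<in>I. w \<omega> i * proj n (S i) (Y \<omega>) k)"
    and a0: "a0 = sqnorm n (\<mu> - proj n (S i0) \<mu>)" and c0: "c0 = L i0 - ln (q i0)"
  shows "mean_le M (\<lambda>\<omega>. sqnorm n (\<mu> - mh \<omega>)) (128 * \<sigma>\<^sup>2 + 20 * a0
     + 10 * c0 * ((2 * sqnorm n (\<mu> - proj n U \<mu>) + 16 * real n * \<sigma>\<^sup>2) / (real N * \<beta>)))"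
proof -
  interpret prob_space M using iid by (simp add: iid_std_gaussian_def)
  note [measurable] = iid_inner_measurable[OF iid]
  define \<xi> where "\<xi> \<omega> = (\<lambda>i. \<sigma> * \<epsilon> i \<omega>)" for \<omega>
  define \<tau> where "\<tau> = 4 * \<sigma>\<^sup>2"
  have \<tau>: "0 < \<tau>" using \<sigma> by (simp add: \<tau>_def)
  have Y': "Y \<omega> = \<mu> + \<xi> \<omega>" for \<omega> unfolding Y \<xi>_def by (simp add: fun_eq_iff)
  have flat: "flat n (S i)" if "i \<in> I" for i using S[OF that] unfolding flat_def by blast
  have inner\<xi>: "inner_n n (\<xi> \<omega>) v = \<sigma> * inner_n n (\<lambda>i. \<epsilon> i \<omega>) v" for \<omega> v
    unfolding \<xi>_def inner_n_simps(5) ..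
  have innerY: "inner_n n (Y \<omega>) v = inner_n n \<mu> v + \<sigma> * inner_n n (\<lambda>i. \<epsilon> i \<omega>) v" for \<omega> v
    unfolding Y' inner_n_simps(1) inner\<xi> ..
  have [measurable]: "(\<lambda>\<omega>. inner_n n (Y \<omega>) v) \<in> borel_measurable M" for v
    unfolding innerY by measurable
  from residual_basis[OF U] obtain d e f where U_basis: "orthonormal n d e" "U = fun_vs.span (e ` {..<d})"
    "d \<le> n" "fun_vs.dim U = d" "orthonormal n (n - d) f"
    "\<And>y. sqnorm n (y - proj n U y) = (\<Sum>i<n - d. (inner_n n y (f i))\<^sup>2)" by blast
  have Nd: "N = n - d" using N U_basis(4) by simp
  note f = U_basis(5)[folded Nd]
  \<comment> \<open>The part of the signal seen by the residual, in units of \<sigma>: the shift of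
    the noncentral sum of squares.\<close>
  define a where "a i = inner_n n \<mu> (f i) / \<sigma>" for i
  define Q where "Q \<omega> = (\<Sum>i<N. (a i + inner_n n (\<lambda>i. \<epsilon> i \<omega>) (f i))\<^sup>2)" for \<omega>
  have [measurable]: "Q \<in> borel_measurable M" unfolding Q_def by (rule residual_measurable[OF iid])
  have res: "sqnorm n (Y \<omega> - proj n U (Y \<omega>)) = \<sigma>\<^sup>2 * Q \<omega>" for \<omega>
    unfolding U_basis(6) Nd[symmetric] innerY Q_def sum_distrib_left a_def
    using \<sigma> by (intro sum.cong) (auto simp: power_mult_distrib[symmetric] distrib_left)
  have vv: "vv \<omega> = \<sigma>\<^sup>2 * Q \<omega> / real N" for \<omega> unfolding V res ..
  have [measurable]: "vv \<in> borel_measurable M" unfolding vv[abs_def] by measurable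
  define T where "T \<omega> = vv \<omega> / \<beta>" for \<omega>
  have [measurable]: "T \<in> borel_measurable M" unfolding T_def by measurable
  have T_nn: "0 \<le> T \<omega>" for \<omega>
    unfolding T_def vv Q_def using \<beta> by (auto intro!: divide_nonneg_nonneg mult_nonneg_nonneg sum_nonneg)
  have AE_pos: "AE \<omega> in M. 0 < T \<omega>"
    using residual_AE_pos[OF iid f N(2), of a]
    by (rule AE_mp) (use \<sigma> \<beta> N in \<open>auto intro!: AE_I2 simp: T_def vv Q_def\<close>)

  define P where "P \<omega> = (if T \<omega> < \<tau> then 1 else 0 :: real)" for \<omega>
  have P: "mean_le M P (1 / real n)"
  proof -
    \<comment> \<open>\<sigma>^2 cancels: the event compares Q / N with 4 \<beta>, the comparison
      for which \<beta> is calibrated.\<close>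
    have eq: "{\<omega>\<in>space M. T \<omega> < \<tau>} = {\<omega>\<in>space M. Q \<omega> < (4 * \<beta>) * real N}"
    proof -
      have "T \<omega> < \<tau> \<longleftrightarrow> Q \<omega> < (4 * \<beta>) * real N" for \<omega>
      proof -
        have "T \<omega> = \<sigma>\<^sup>2 * (Q \<omega> / (real N * \<beta>))" "\<tau> = \<sigma>\<^sup>2 * 4"
          by (simp_all add: T_def vv \<tau>_def)
        then have "T \<omega> < \<tau> \<longleftrightarrow> Q \<omega> / (real N * \<beta>) < 4"
          using \<sigma> by (simp only: mult_less_cancel_left_pos zero_less_power)
        also have "\<dots> \<longleftrightarrow> Q \<omega> < 4 * (real N * \<beta>)"
          using N(2) \<beta>(1) by (intro pos_divide_less_eq) simp
        finally show ?thesis by (simp only: mult_ac)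
      qed
      then show ?thesis by simp
    qed
    have "measure M {\<omega>\<in>space M. T \<omega> < \<tau>} \<le> exp (- (real N * phi_fun (4 * \<beta>)))"
      unfolding eq Q_def using \<beta> by (intro residual_lower_tail[OF iid f]) auto
    moreover have "P = (\<lambda>\<omega>. indicator {\<omega>. T \<omega> < \<tau>} \<omega>)"
      by (auto simp: P_def fun_eq_iff)
    moreover have "integrable M (\<lambda>\<omega>. indicator {\<omega>. T \<omega> < \<tau>} \<omega> :: real)"
      by (intro integrable_const_bound[where B=1]) auto
    moreover have "integral\<^sup>L M (indicator {\<omega>. T \<omega> < \<tau>}) = measure M {\<omega>\<in>space M. T \<omega> < \<tau>}"
      by (simp add: Int_def conj_commute)
    ultimately show ?thesis using \<beta>(3) by (simp add: mean_le_def)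
  qed

  define V1 where "V1 \<omega> = (\<Sum>i\<in>I. q i * exp ((- (9/10) * sqnorm n (\<mu> - proj n (S i) \<mu>)
      - 2 * inner_n n (\<xi> \<omega>) (\<mu> - proj n (S i) \<mu>)
      + 11/10 * sqnorm n (proj n (S i) (\<xi> \<omega>))) / \<tau> - L i))" for \<omega>
  have V1: "mean_le M V1 1"
  proof -
    have "mean_le M V1 (\<Sum>i\<in>I. q i * 1)"
      unfolding V1_def
    proof (intro mean_le_sum mean_le_cmult)
      fix i assume i: "i \<in> I"
      then show "0 \<le> q i" using q by (auto intro: less_imp_le)
      from S[OF i] obtain d e where "orthonormal n d e" "S i = fun_vs.span (e ` {..<d})" "11 * real d \<le> 25 * L i"
        by blast
      from exponential_criterion_mean_le[OF iid \<sigma> this \<xi>_def]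
      show "mean_le M (\<lambda>\<omega>. exp ((- (9/10) * sqnorm n (\<mu> - proj n (S i) \<mu>)
        - 2 * inner_n n (\<xi> \<omega>) (\<mu> - proj n (S i) \<mu>)
        + 11/10 * sqnorm n (proj n (S i) (\<xi> \<omega>))) / \<tau> - L i)) 1" unfolding \<tau>_def .
    qed
    then show ?thesis using q(2) by (auto intro: mean_le_mono)
  qed

  let ?v = "\<mu> - proj n (S i0) \<mu>"
  \<comment> \<open>The noise along the bias of \<open>i0\<close> has mean zero but is needed only
    where \<open>T\<close> is large; the exponential version bounds it pointwise at the cost of one
    more \<open>a0\<close>.\<close>
  define G1 where "G1 \<omega> = exp (2 * inner_n n (\<xi> \<omega>) ?v / \<tau> - a0 / \<tau>)" for \<omega>
  have G1: "mean_le M G1 1"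
  proof -
    let ?b = "\<lambda>i. (1 / (2 * \<sigma>)) * ?v i"
    have "mean_le M (\<lambda>\<omega>. exp (0 * (\<Sum>i<(0::nat). (inner_n n (\<lambda>i. \<epsilon> i \<omega>) 0)\<^sup>2)
       + inner_n n (\<lambda>i. \<epsilon> i \<omega>) ?b + - (a0 / \<tau>))) 1"
    proof (rule gaussian_quadratic_mean_le[OF iid, where d = 0 and e = "\<lambda>_. 0"])
      have "sqnorm n ?b = (1 / (2 * \<sigma>))\<^sup>2 * sqnorm n ?v" by (rule sqnorm_scale)
      also have "\<dots> = a0 / \<tau>" unfolding a0[symmetric] \<tau>_def by (simp add: power_divide)
      finally have "sqnorm n ?b = a0 / \<tau>" .
      moreover have "0 \<le> a0 / \<tau>" unfolding a0 using \<tau> by simp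
      ultimately show "- (a0 / \<tau>) + real 0 * (- ln (1 - 2 * 0) / 2) + sqnorm n ?b / 2 \<le> 0" by simp
    qed (auto simp: orthonormal_def)
    moreover have "inner_n n (\<lambda>i. \<epsilon> i \<omega>) ?b = 2 * inner_n n (\<xi> \<omega>) ?v / \<tau>" for \<omega>
    proof -
      have "1 / (2 * \<sigma>) * z = 2 * (\<sigma> * z) / (4 * \<sigma>\<^sup>2)" for z
        using \<sigma> by (simp add: field_simps power2_eq_square)
      then show ?thesis unfolding inner\<xi> inner_n_simps(6) \<tau>_def .
    qed
    ultimately show ?thesis unfolding G1_def[abs_def]
      by (simp only: lessThan_0 sum.empty mult_zero_left add_0_left diff_conv_add_uminus)
  qed

  \<comment> \<open>The noise in \<open>U\<close> is at most \<tau> times the dimension plus an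
    exponential excess, with \<open>real d\<close> compensating the moment at exponent 1/4. The
    dimension then gets multiplied by \<open>P\<close>, of mean at most 1/n, while the excess is
    bounded in mean on the whole space.\<close>
  define G2 where "G2 \<omega> = exp (sqnorm n (proj n U (\<xi> \<omega>)) / \<tau> - real d)" for \<omega>
  have G2: "mean_le M G2 1"
  proof -
    have "mean_le M (\<lambda>\<omega>. exp (1/4 * (\<Sum>i<d. (inner_n n (\<lambda>i. \<epsilon> i \<omega>) (e i))\<^sup>2)
       + inner_n n (\<lambda>i. \<epsilon> i \<omega>) 0 + - real d)) 1"
    proof (rule gaussian_quadratic_mean_le[OF iid U_basis(1)])
      have "- ln (1 - 2 * (1/4)) / 2 \<le> (1 :: real)" using ln_2_less_1 by (simp add: ln_div)
      then have "real d * (- ln (1 - 2 * (1/4)) / 2) \<le> real d * 1" by (intro mult_left_mono) auto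
      then show "- real d + real d * (- ln (1 - 2 * (1/4)) / 2) + sqnorm n 0 / 2 \<le> 0" by simp
    qed (auto simp: inner_n_simps)
    moreover have "1/4 * (\<Sum>i<d. (inner_n n (\<lambda>i. \<epsilon> i \<omega>) (e i))\<^sup>2) = sqnorm n (proj n U (\<xi> \<omega>)) / \<tau>" for \<omega>
      unfolding \<xi>_def sqnorm_proj_scaled[OF U_basis(1,2)] \<tau>_def using \<sigma> by simp
    ultimately show ?thesis unfolding G2_def[abs_def]
      by (simp only: inner_n_simps add_0_right diff_conv_add_uminus)
  qed

  let ?A = "sqnorm n (\<mu> - proj n U \<mu>)"
  \<comment> \<open>The penalty enters linearly, so the mean of \<open>T\<close> suffices. It is
    inflated by the part \<open>?A\<close> of the signal that \<open>U\<close> misses.\<close>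
  have ET: "mean_le M T ((2 * ?A + 16 * real n * \<sigma>\<^sup>2) / (real N * \<beta>))"
  proof (rule mean_le_AE)
    have "mean_le M (\<lambda>\<omega>. 2 * ?A + 2 * \<sigma>\<^sup>2 * sqnorm n (\<lambda>i. \<epsilon> i \<omega>)) (2 * ?A + 2 * \<sigma>\<^sup>2 * (8 * real n))"
      by (intro mean_le_add mean_le_cmult mean_le_const prob_space_axioms noise_mean_le[OF iid]) simp
    then have "mean_le M (\<lambda>\<omega>. 1 / (real N * \<beta>) * (2 * ?A + 2 * \<sigma>\<^sup>2 * sqnorm n (\<lambda>i. \<epsilon> i \<omega>)))
        (1 / (real N * \<beta>) * (2 * ?A + 2 * \<sigma>\<^sup>2 * (8 * real n)))"
      using \<beta> by (intro mean_le_cmult) auto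
    then show "mean_le M (\<lambda>\<omega>. 1 / (real N * \<beta>) * (2 * ?A + 2 * \<sigma>\<^sup>2 * sqnorm n (\<lambda>i. \<epsilon> i \<omega>)))
       ((2 * ?A + 16 * real n * \<sigma>\<^sup>2) / (real N * \<beta>))" by (simp add: mult.commute mult.left_commute)
    have "T \<omega> \<le> 1 / (real N * \<beta>) * (2 * ?A + 2 * \<sigma>\<^sup>2 * sqnorm n (\<lambda>i. \<epsilon> i \<omega>))" for \<omega>
    proof -
      have "sqnorm n (Y \<omega> - proj n U (Y \<omega>)) \<le> sqnorm n (Y \<omega> - proj n U \<mu>)"
        by (rule proj_best[OF U proj_in[OF U]])
      also have "\<dots> = sqnorm n ((\<mu> - proj n U \<mu>) + \<xi> \<omega>)"
        unfolding Y' by (rule arg_cong[where f="sqnorm n"]) simp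
      also have "\<dots> \<le> 2 * ?A + 2 * sqnorm n (\<xi> \<omega>)" by (rule sqnorm_add_le)
      also have "sqnorm n (\<xi> \<omega>) = \<sigma>\<^sup>2 * sqnorm n (\<lambda>i. \<epsilon> i \<omega>)" unfolding \<xi>_def sqnorm_scale ..
      finally have "sqnorm n (Y \<omega> - proj n U (Y \<omega>)) \<le> 2 * ?A + 2 * \<sigma>\<^sup>2 * sqnorm n (\<lambda>i. \<epsilon> i \<omega>)" by (simp only: mult.assoc)
      then have "1 / (real N * \<beta>) * sqnorm n (Y \<omega> - proj n U (Y \<omega>)) \<le>
          1 / (real N * \<beta>) * (2 * ?A + 2 * \<sigma>\<^sup>2 * sqnorm n (\<lambda>i. \<epsilon> i \<omega>))"
        using \<beta> by (intro mult_left_mono) auto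
      moreover have "T \<omega> = 1 / (real N * \<beta>) * sqnorm n (Y \<omega> - proj n U (Y \<omega>))"
        unfolding T_def V by simp
      ultimately show ?thesis by (simp only:)
    qed
    then show "AE \<omega> in M. T \<omega> \<le> 1 / (real N * \<beta>) * (2 * ?A + 2 * \<sigma>\<^sup>2 * sqnorm n (\<lambda>i. \<epsilon> i \<omega>))" by simp
  qed (auto simp: T_nn)

  have q1: "q i0 \<le> 1"
  proof -
    have "q i0 \<le> sum q I" using I q(1) by (intro member_le_sum) (auto intro: less_imp_le)
    then show ?thesis using q(2) by linarith
  qed
  then have "ln (q i0) \<le> 0" using q(1)[OF I(2)] by simp
  then have c0_nn: "0 \<le> c0" using L[OF I(2)] by (simp add: c0)
  have a0_nn: "0 \<le> a0" by (simp add: a0)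
  define D where "D \<omega> = 10 * \<tau> * V1 \<omega> + 10 * \<tau> * G1 \<omega> + 10 * c0 * T \<omega> + 24 * real n * \<sigma>\<^sup>2 * P \<omega>
     + 6 * \<tau> * G2 \<omega> + 20 * a0" for \<omega>
  have D: "mean_le M D (10 * \<tau> * 1 + 10 * \<tau> * 1 + 10 * c0 * ((2 * ?A + 16 * real n * \<sigma>\<^sup>2) / (real N * \<beta>))
     + 24 * real n * \<sigma>\<^sup>2 * (1 / real n) + 6 * \<tau> * 1 + 20 * a0)"
    unfolding D_def using \<tau> c0_nn
    by (intro mean_le_add mean_le_cmult mean_le_const prob_space_axioms V1 G1 ET P G2) auto
  have V1_nn: "0 \<le> V1 \<omega>" for \<omega>
    unfolding V1_def using q by (intro sum_nonneg mult_nonneg_nonneg) (auto intro: less_imp_le)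
  have loss: "sqnorm n (\<mu> - mh \<omega>) \<le> D \<omega>" if T: "0 < T \<omega>" for \<omega>
  proof -
    have vpos: "0 < vv \<omega>" using T \<beta> by (simp add: T_def zero_less_divide_iff)
    have div: "x / T \<omega> = \<beta> * x / vv \<omega>" for x using vpos \<beta> by (simp add: T_def)
    have w': "w \<omega> i = q i * exp (sqnorm n (proj n (S i) (Y \<omega>)) / T \<omega> - L i) /
       (\<Sum>i\<in>I. q i * exp (sqnorm n (proj n (S i) (Y \<omega>)) / T \<omega> - L i))" if "i \<in> I" for i
      unfolding div by (rule w[OF that])
    note mp = mixture_pointwise[OF I q L flat SU U T Y' refl w' mh refl]
    have D_ge: "10 * \<tau> * V1 \<omega> \<ge> 0" "10 * \<tau> * G1 \<omega> \<ge> 0" "10 * c0 * T \<omega> \<ge> 0"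
      "24 * real n * \<sigma>\<^sup>2 * P \<omega> \<ge> 0" "6 * \<tau> * G2 \<omega> \<ge> 0"
      using \<tau> V1_nn T c0_nn by (auto simp: G1_def G2_def P_def)
    show ?thesis
    proof (cases "\<tau> \<le> T \<omega>")
      case True
      have "sqnorm n (\<mu> - mh \<omega>) \<le> 10 * (\<tau> * V1 \<omega> + a0 + 2 * inner_n n (\<xi> \<omega>) ?v + T \<omega> * c0)"
        unfolding V1_def c0 a0 by (rule mp(1)) (assumption | rule \<tau> True)+
      moreover have "2 * inner_n n (\<xi> \<omega>) ?v \<le> a0 + \<tau> * G1 \<omega>"
        unfolding G1_def by (rule le_exp_shift[OF \<tau>])
      ultimately show ?thesis using D_ge unfolding D_def by (simp add: algebra_simps)
    next
      case False
      have "sqnorm n (\<mu> - mh \<omega>) \<le> 5 * a0 + 6 * sqnorm n (proj n U (\<xi> \<omega>)) + 2 * T \<omega> * c0"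
        unfolding c0 a0 by (rule mp(2)) assumption+
      moreover have "sqnorm n (proj n U (\<xi> \<omega>)) \<le> \<tau> * real d + \<tau> * G2 \<omega>"
        using le_exp_shift[OF \<tau>, of "sqnorm n (proj n U (\<xi> \<omega>))" "\<tau> * real d"] \<tau>
        unfolding G2_def by simp
      moreover have "\<tau> * real d \<le> \<tau> * real n * P \<omega>"
        using False \<tau> U_basis(3) by (simp add: P_def)
      moreover have "6 * (\<tau> * real n * P \<omega>) = 24 * real n * \<sigma>\<^sup>2 * P \<omega>" by (simp add: \<tau>_def)
      moreover have "2 * T \<omega> * c0 \<le> 10 * c0 * T \<omega>" using T c0_nn by simp
      ultimately show ?thesis using D_ge a0_nn unfolding D_def by linarith
    qed
  qed
  have proj_meas: "(\<lambda>\<omega>. proj n (S i) (Y \<omega>) k) \<in> borel_measurable M" if i: "i \<in> I" for i k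
  proof -
    from S[OF i] obtain d e where on: "orthonormal n d e" "S i = fun_vs.span (e ` {..<d})" by blast
    show ?thesis unfolding proj_orthonormal[OF on] lincomb_def by measurable
  qed
  have sq_meas: "(\<lambda>\<omega>. sqnorm n (proj n (S i) (Y \<omega>))) \<in> borel_measurable M" if i: "i \<in> I" for i
    unfolding sqnorm_def inner_n_def
    by (intro borel_measurable_sum borel_measurable_times proj_meas i)
  have raw_meas: "(\<lambda>\<omega>. q i * exp (\<beta> * sqnorm n (proj n (S i) (Y \<omega>)) / vv \<omega> - L i)) \<in> borel_measurable M"
    if i: "i \<in> I" for i
    using sq_meas[OF i] by measurable
  have w_meas: "(\<lambda>\<omega>. w \<omega> i) \<in> borel_measurable M" if i: "i \<in> I" for i
    unfolding w[OF i] by (intro borel_measurable_divide borel_measurable_sum raw_meas i)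
  have loss_meas: "(\<lambda>\<omega>. sqnorm n (\<mu> - mh \<omega>)) \<in> borel_measurable M"
    unfolding sqnorm_def inner_n_def mh fun_diff_def
    by (intro borel_measurable_sum borel_measurable_times borel_measurable_diff borel_measurable_const
        w_meas proj_meas)
  have "mean_le M (\<lambda>\<omega>. sqnorm n (\<mu> - mh \<omega>)) (10 * \<tau> * 1 + 10 * \<tau> * 1 + 10 * c0 * ((2 * ?A + 16 * real n * \<sigma>\<^sup>2) / (real N * \<beta>))
     + 24 * real n * \<sigma>\<^sup>2 * (1 / real n) + 6 * \<tau> * 1 + 20 * a0)"
  proof (rule mean_le_AE[OF D loss_meas])
    show "AE \<omega> in M. sqnorm n (\<mu> - mh \<omega>) \<le> D \<omega>"
      using AE_pos by eventually_elim (rule loss)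
  qed simp
  then show ?thesis
    \<comment> \<open>With \<tau> = 4 \<sigma>^2 the noise terms add up to 40 + 40 + 24 + 24 = 128
      times \<sigma>^2.\<close>
    by (rule mean_le_mono) (use n in \<open>simp add: \<tau>_def\<close>)
qed

section \<open>The rate of convergence\<close>

text \<open>\<open>J_star\<close> is the integer part of the binary logarithm of \<kappa> n / 2;
  that it is at least 1 excludes that \<open>nat\<close> has cut off a negative value.\<close>

lemma J_star_bounds:
  assumes "0 < \<kappa>" "0 < n" "1 \<le> J_star \<kappa> n"
  shows "2 ^ J_star \<kappa> n \<le> \<kappa> * real n / 2" "\<kappa> * real n / 2 < 2 * 2 ^ J_star \<kappa> n"
proof -
  define z where "z = \<kappa> * real n / 2"
  have z: "0 < z" using assms by (simp add: z_def)
  define y where "y = ln z / ln 2"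
  have J: "J_star \<kappa> n = nat \<lfloor>y\<rfloor>" by (simp add: J_star_def y_def z_def)
  have "1 \<le> \<lfloor>y\<rfloor>" using assms(3) unfolding J by linarith
  then have "real (J_star \<kappa> n) \<le> y" "y < real (J_star \<kappa> n) + 1"
    unfolding J by linarith+
  moreover have "z = 2 powr y" using z by (simp add: y_def powr_def)
  ultimately have "2 powr real (J_star \<kappa> n) \<le> z" "z < 2 powr (real (J_star \<kappa> n) + 1)"
    by simp_all
  then show "2 ^ J_star \<kappa> n \<le> \<kappa> * real n / 2" "\<kappa> * real n / 2 < 2 * 2 ^ J_star \<kappa> n"
    unfolding z_def by (simp_all add: powr_add powr_realpow)
qed

text \<open>The large space has fewer than 2^(J_star + 1) generators, which is at most \<kappa> n
  thanks to the factor 1/2 inside \<open>J_star\<close>. A fixed fraction of the degrees of freedom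
  is left for the variance.\<close>

lemma N_star_ge:
  assumes "0 < \<kappa>" "0 < n" "1 \<le> J_star \<kappa> n"
  shows "(1 - \<kappa>) * real n \<le> real (N_star \<kappa> \<phi> n x)"
proof -
  let ?m = "SIGMA j:{..J_star \<kappa> n}. {1..2^j::nat}"
  from model_space_onb[OF finite_full_index[of "J_star \<kappa> n"], of n \<phi> x] obtain d e where
    d: "orthonormal n d e" "full_space \<kappa> \<phi> n x = fun_vs.span (e ` {..<d})" "d \<le> card ?m"
    unfolding full_space_def by blast
  have "real d \<le> real (card ?m)" using d(3) by (simp only: of_nat_le_iff)
  also have "\<dots> \<le> real (2 ^ (J_star \<kappa> n + 1))"
    using card_full_index[of "J_star \<kappa> n"] by (simp only: of_nat_le_iff less_imp_le)
  also have "\<dots> \<le> \<kappa> * real n" using J_star_bounds(1)[OF assms] by simp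
  finally have "real d \<le> \<kappa> * real n" .
  moreover have "real n - real d \<le> real (N_star \<kappa> \<phi> n x)"
    unfolding N_star_def d(2) dim_orthonormal[OF d(1)] by linarith
  ultimately show ?thesis by (simp add: algebra_simps)
qed

lemma sqnorm_sample_le:
  assumes "\<And>i. i \<in> {1..n} \<Longrightarrow> \<bar>f (x i) - g (x i)\<bar> \<le> B"
  shows "sqnorm n ((\<lambda>i. f (x i)) - sample n x g) \<le> real n * B\<^sup>2"
proof -
  have "sqnorm n ((\<lambda>i. f (x i)) - sample n x g) = (\<Sum>i=1..n. (f (x i) - g (x i))\<^sup>2)"
    by (simp add: sqnorm_def inner_n_def sample_def power2_eq_square)
  also have "\<dots> \<le> (\<Sum>i=1..n. B\<^sup>2)"
  proof (rule sum_mono)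
    fix i assume "i \<in> {1..n}"
    then have "\<bar>f (x i) - g (x i)\<bar>\<^sup>2 \<le> B\<^sup>2" using assms by (intro power_mono) auto
    then show "(f (x i) - g (x i))\<^sup>2 \<le> B\<^sup>2" by simp
  qed
  finally show ?thesis by simp
qed

text \<open>The level at which \<open>2 ^ J\<close> is closest to \<open>s powr (- 1 / (2 * \<alpha> + 1))\<close> balances bias and
  variance, unless it falls outside \<open>{1..Js}\<close>.\<close>

lemma balancing_level:
  fixes s \<alpha> B :: real
  assumes s: "0 < s" and \<alpha>: "0 < \<alpha>" and Js: "1 \<le> Js" and B: "2 powr (- (2 * real Js * \<alpha>)) \<le> B"
  shows "\<exists>J\<in>{1..Js}. 2 powr (- (2 * real J * \<alpha>)) + 2 ^ J * s \<le>
     (1 + 2 powr (2 * \<alpha>)) * s powr (2 * \<alpha> / (2 * \<alpha> + 1)) + (2 powr (2 * \<alpha> + 1) + 2) * s + B"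
proof -
  let ?h = "s powr (2 * \<alpha> / (2 * \<alpha> + 1))"
  have B_nn: "0 \<le> B" using B powr_ge_zero order_trans by blast
  show ?thesis
  proof (cases "2 powr (- (2 * \<alpha> + 1)) \<le> s")
    \<comment> \<open>The balancing level would fall below 1. Here \<open>s\<close> is so large that
      the bias at J = 1, at most 1, is already covered by a multiple of \<open>s\<close>.\<close>
    case True
    have "1 = 2 powr (2 * \<alpha> + 1) * 2 powr (- (2 * \<alpha> + 1))" by (simp flip: powr_add)
    also have "\<dots> \<le> 2 powr (2 * \<alpha> + 1) * s" using True by (intro mult_left_mono) auto
    finally have 1: "1 \<le> 2 powr (2 * \<alpha> + 1) * s" .
    have "2 powr (- (2 * real 1 * \<alpha>)) \<le> (1 :: real)" 
      using powr_mono[of "- (2 * real 1 * \<alpha>)" 0 2] \<alpha> by simp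
    moreover have "0 \<le> (1 + 2 powr (2 * \<alpha>)) * ?h" by simp
    ultimately have "2 powr (- (2 * real 1 * \<alpha>)) + 2 ^ 1 * s \<le>
        (1 + 2 powr (2 * \<alpha>)) * ?h + (2 powr (2 * \<alpha> + 1) + 2) * s + B"
      using 1 B_nn unfolding distrib_right[of _ _ s] power_one_right by linarith
    then show ?thesis using Js by (intro bexI[of _ 1]) auto
  next
    case False
    \<comment> \<open>The real solution of t^(-2 \<alpha>) = t s, both sides being
      \<open>?h\<close>. \<open>J\<close> is its binary logarithm, rounded down and capped at
      \<open>Js\<close>: rounding costs 2^(2 \<alpha>) in the bias, capping costs
      \<open>B\<close>.\<close>
    define t where "t = s powr (- 1 / (2 * \<alpha> + 1))"
    have t2: "2 < t"
    proof -
      have "(2 powr (- (2 * \<alpha> + 1))) powr (- 1 / (2 * \<alpha> + 1)) < t"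
        unfolding t_def using False s \<alpha> by (intro powr_less_mono2_neg) (auto simp: divide_neg_pos)
      moreover have "(2 powr (- (2 * \<alpha> + 1))) powr (- 1 / (2 * \<alpha> + 1)) = 2 powr 1"
        unfolding powr_powr by (rule arg_cong[where f = "(powr) 2"]) (use \<alpha> in \<open>simp add: divide_eq_eq\<close>)
      ultimately show ?thesis by simp
    qed
    define J0 where "J0 = nat \<lfloor>log 2 t\<rfloor>"
    have "1 \<le> log 2 t" using t2 by (simp add: le_log_iff)
    then have J0: "1 \<le> J0" "real J0 \<le> log 2 t" "log 2 t < real J0 + 1"
      unfolding J0_def by linarith+
    have J0t: "2 ^ J0 \<le> t" using J0(2) t2 by (simp add: le_log_iff powr_realpow)
    have tJ0: "t < 2 powr (real J0 + 1)" using J0(3) t2 by (simp add: log_less_iff)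
    define J where "J = min J0 Js"
    have J: "J \<in> {1..Js}" using J0 Js by (auto simp: J_def)
    have ts: "t * s = ?h"
    proof -
      have "t * s = s powr (- 1 / (2 * \<alpha> + 1) + 1)"
        unfolding powr_add t_def using s by simp
      also have "- 1 / (2 * \<alpha> + 1) + 1 = 2 * \<alpha> / (2 * \<alpha> + 1)" using \<alpha> by (simp add: field_simps)
      finally show ?thesis .
    qed
    have "2 ^ J * s \<le> t * s"
    proof (rule mult_right_mono)
      have "(2::real) ^ J \<le> 2 ^ J0" by (intro power_increasing) (auto simp: J_def)
      then show "2 ^ J \<le> t" using J0t by linarith
    qed (use s in simp)
    then have var: "2 ^ J * s \<le> ?h" unfolding ts .
    have bias: "2 powr (- (2 * real J * \<alpha>)) \<le> 2 powr (2 * \<alpha>) * ?h + B"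
    proof (cases "J0 \<le> Js")
      case True
      then have JJ: "J = J0" by (simp add: J_def)
      have "2 powr (- (2 * real J0 * \<alpha>)) = 2 powr (2 * \<alpha>) * (2 powr (real J0 + 1)) powr (- (2 * \<alpha>))"
        by (simp add: powr_powr powr_add[symmetric] algebra_simps)
      also have "\<dots> \<le> 2 powr (2 * \<alpha>) * t powr (- (2 * \<alpha>))"
        using tJ0 t2 \<alpha> by (intro mult_left_mono powr_mono2') auto
      also have "t powr (- (2 * \<alpha>)) = ?h" by (simp add: t_def powr_powr)
      finally show ?thesis using B_nn by (simp add: JJ)
    next
      case False
      then have "J = Js" by (simp add: J_def)
      then show ?thesis using B by (simp add: add_increasing)
    qed
    have "0 \<le> (2 powr (2 * \<alpha> + 1) + 2) * s" using s by simp
    then have "2 powr (- (2 * real J * \<alpha>)) + 2 ^ J * s \<le>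
        (1 + 2 powr (2 * \<alpha>)) * ?h + (2 powr (2 * \<alpha> + 1) + 2) * s + B"
      using bias var unfolding distrib_right[of 1] by linarith
    then show ?thesis using J by blast
  qed
qed

text \<open>N times \<open>phi_fun\<close> at 4 \<open>beta\<close> is N ln n / (N - 2), at least ln
  n, whence the probability 1/n. Conversely N - 2 is at least N/3 and N at least (1 - \<kappa>) n,
  so the argument of the inverse stays below 3/(1 - \<kappa>), and \<open>beta\<close> is bounded
  away from 0 uniformly in n.\<close>

lemma beta_bounds:
  assumes \<kappa>: "0 < \<kappa>" "\<kappa> < 1" and n: "3 \<le> n" "1 \<le> J_star \<kappa> n" "2 < N_star \<kappa> \<phi> n x"
  shows "4 * beta \<kappa> \<phi> n x < 1" "exp (- (6 / (1 - \<kappa>)) - 1) / 4 \<le> beta \<kappa> \<phi> n x"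
    "exp (- (real (N_star \<kappa> \<phi> n x) * phi_fun (4 * beta \<kappa> \<phi> n x))) \<le> 1 / real n"
proof -
  define N where "N = real (N_star \<kappa> \<phi> n x)"
  have N3: "3 \<le> N" using n(3) unfolding N_def by linarith
  have N: "(1 - \<kappa>) * real n \<le> N" unfolding N_def using \<kappa> n by (intro N_star_ge) auto
  define y where "y = ln (real n) / (N - 2)"
  have ln_pos: "0 < ln (real n)" using n by simp
  have y: "0 < y" unfolding y_def using ln_pos N3 by simp
  have b: "4 * beta \<kappa> \<phi> n x = inv_into {0<..<1} phi_fun y"
    by (simp add: beta_def y_def N_def)
  note inv = inv_phi_fun[OF y, folded b]
  show "4 * beta \<kappa> \<phi> n x < 1" by (rule inv(2))
  have "y \<le> 3 / (1 - \<kappa>)"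
  proof -
    have "ln (real n) \<le> real n" using ln_le_minus_one[of "real n"] n by simp
    then have "ln (real n) * (1 - \<kappa>) \<le> real n * (1 - \<kappa>)" using \<kappa> by (intro mult_right_mono) auto
    also have "\<dots> \<le> 3 * (N - 2)" unfolding mult.commute[of "real n"] by (rule order_trans[OF N]) (use N3 in simp)
    finally have "ln (real n) * (1 - \<kappa>) \<le> 3 * (N - 2)" .
    moreover have "a / c \<le> 3 / b" if "a * b \<le> 3 * c" "0 < b" "0 < c" for a b c :: real
      using that by (simp add: field_simps)
    ultimately show ?thesis unfolding y_def using N3 \<kappa> by simp
  qed
  then have "exp (- (6 / (1 - \<kappa>)) - 1) \<le> exp (- (2 * y) - 1)" by simp
  then show "exp (- (6 / (1 - \<kappa>)) - 1) / 4 \<le> beta \<kappa> \<phi> n x" using inv(4) by linarith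
  have "ln (real n) \<le> N * y"
  proof -
    have "ln (real n) * (N - 2) \<le> ln (real n) * N" using ln_pos by (intro mult_left_mono) auto
    moreover have "a \<le> b * (a / c)" if "a * c \<le> a * b" "0 < c" for a b c :: real
      using that by (simp add: field_simps)
    ultimately show ?thesis unfolding y_def using N3 by simp
  qed
  then have "exp (- (N * y)) \<le> exp (- ln (real n))" by simp
  also have "\<dots> = 1 / real n" using n by (simp add: exp_minus inverse_eq_divide)
  finally show "exp (- (real (N_star \<kappa> \<phi> n x) * phi_fun (4 * beta \<kappa> \<phi> n x))) \<le> 1 / real n"
    unfolding inv(3) N_def .
qed

text \<open>\<open>k0\<close> bounds N \<open>beta\<close> / n from below. In 220 and 1760, the 10
  comes from the oracle inequality, the 11 from \<open>penalty_le\<close>, and the factors 2 and 16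
  from the mean of \<open>T\<close>.\<close>

lemma wavelet_oracle:
  assumes \<kappa>: "0 < \<kappa>" "\<kappa> < 1" and n: "3 \<le> n" "1 \<le> J_star \<kappa> n" "2 < N_star \<kappa> \<phi> n x"
    and \<sigma>: "0 < \<sigma>" and iid: "iid_std_gaussian M n \<epsilon>"
    and J: "J \<in> {1..J_star \<kappa> n}" and m: "m \<in> models_at (J_star \<kappa> n) J"
    and g: "g \<in> fun_vs.span ((\<lambda>(j, k). \<phi> j k) ` m)" "\<And>i. i \<in> {1..n} \<Longrightarrow> \<bar>f (x i) - g (x i)\<bar> \<le> B"
    and k0: "k0 = (1 - \<kappa>) * (exp (- (6 / (1 - \<kappa>)) - 1) / 4)"
  shows "mean_le M (\<lambda>\<omega>. sqnorm n ((\<lambda>i. f (x i)) - mu_hat \<kappa> \<phi> n x (\<lambda>i. f (x i) + \<sigma> * \<epsilon> i \<omega>)) / real n)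
     (128 * (\<sigma>\<^sup>2 / real n) + (20 + 220 / k0) * B\<^sup>2 + 1760 / k0 * (2 ^ J * (\<sigma>\<^sup>2 / real n)))"
proof -
  let ?Js = "J_star \<kappa> n" and ?\<mu> = "\<lambda>i. f (x i)"
  let ?U = "full_space \<kappa> \<phi> n x" and ?S = "model_space \<phi> n x"
  let ?Y = "\<lambda>\<omega> i. ?\<mu> i + \<sigma> * \<epsilon> i \<omega>"
  let ?N = "N_star \<kappa> \<phi> n x" and ?\<beta> = "beta \<kappa> \<phi> n x"
  note bb = beta_bounds[OF \<kappa> n]
  have k0_pos: "0 < k0" using \<kappa> unfolding k0 by (intro mult_pos_pos) auto
  have \<beta>: "0 < ?\<beta>" using bb(2) exp_gt_zero[of "- (6 / (1 - \<kappa>)) - 1"] by linarith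
  have npos: "0 < real n" using n by simp
  have mm: "m \<in> models ?Js" using J m by (auto simp: models_def)
  have U: "flat n ?U" unfolding full_space_def by (rule flat_model_space[OF finite_full_index])
  have Sm: "\<exists>d e. orthonormal n d e \<and> ?S m' = fun_vs.span (e ` {..<d}) \<and> 11 * real d \<le> 25 * L_pen ?Js m'"
    and SU: "?S m' \<subseteq> ?U" if "m' \<in> models ?Js" for m'
  proof -
    from that obtain J' where J': "J' \<in> {1..?Js}" "m' \<in> models_at ?Js J'" unfolding models_def by blast
    from model_space_onb[OF finite_model[OF J'(2)]] obtain d e where
      d: "orthonormal n d e" "?S m' = fun_vs.span (e ` {..<d})" "d \<le> card m'" by blast
    have "real d \<le> real (card m')" using d(3) by simp
    also have "\<dots> \<le> 5 / 2 * 2 ^ J'" using J' by (intro card_model) auto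
    finally have "11 * real d \<le> 25 * L_pen ?Js m'"
      unfolding L_pen_def model_index_eq[OF J'(2,1)] by simp
    then show "\<exists>d e. orthonormal n d e \<and> ?S m' = fun_vs.span (e ` {..<d}) \<and> 11 * real d \<le> 25 * L_pen ?Js m'"
      using d by blast
    show "?S m' \<subseteq> ?U" unfolding full_space_def by (rule model_space_mono[OF model_subset[OF J'(2)]])
  qed
  let ?A = "sqnorm n (?\<mu> - proj n ?U ?\<mu>)" and ?a0 = "sqnorm n (?\<mu> - proj n (?S m) ?\<mu>)"
  let ?c0 = "L_pen ?Js m - ln (prior ?Js m)"
  have "mean_le M (\<lambda>\<omega>. sqnorm n (?\<mu> - mu_hat \<kappa> \<phi> n x (?Y \<omega>))) (128 * \<sigma>\<^sup>2 + 20 * ?a0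
     + 10 * ?c0 * ((2 * ?A + 16 * real n * \<sigma>\<^sup>2) / (real ?N * ?\<beta>)))"
  proof (rule mixture_oracle[where I = "models ?Js" and q = "prior ?Js" and L = "L_pen ?Js" and S = ?S
        and U = ?U and Y = ?Y and vv = "\<lambda>\<omega>. var_est \<kappa> \<phi> n x (?Y \<omega>)"
        and w = "\<lambda>\<omega>. weight \<kappa> \<phi> n x (?Y \<omega>)" and ?i0.0 = m])
    show "iid_std_gaussian M n \<epsilon>" "0 < \<sigma>" by fact+
    show "sum (prior ?Js) (models ?Js) \<le> 1" by (rule sum_prior[OF n(2)])
    show "0 \<le> L_pen ?Js i" for i by (simp add: L_pen_def)
    show "0 < ?N" using n(3) by simp
  qed (use n mm Sm SU U \<beta> bb in \<open>simp_all add: finite_models prior_pos N_star_def var_est_def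
      weight_def raw_weight_def mu_hat_def\<close>)
  then have "mean_le M (\<lambda>\<omega>. 1 / real n * sqnorm n (?\<mu> - mu_hat \<kappa> \<phi> n x (?Y \<omega>))) (1 / real n * (128 * \<sigma>\<^sup>2 + 20 * ?a0
     + 10 * ?c0 * ((2 * ?A + 16 * real n * \<sigma>\<^sup>2) / (real ?N * ?\<beta>))))"
    using npos by (intro mean_le_cmult) auto
  moreover have "1 / real n * (128 * \<sigma>\<^sup>2 + 20 * ?a0 + 10 * ?c0 * ((2 * ?A + 16 * real n * \<sigma>\<^sup>2) / (real ?N * ?\<beta>)))
     \<le> 128 * (\<sigma>\<^sup>2 / real n) + (20 + 220 / k0) * B\<^sup>2 + 1760 / k0 * (2 ^ J * (\<sigma>\<^sup>2 / real n))"
  proof -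
    have "sample n x g \<in> ?S m" using g(1) unfolding model_space_def by blast
    from proj_best[OF flat_model_space[OF finite_model[OF m]] this, of ?\<mu>]
    have "?a0 \<le> sqnorm n (?\<mu> - sample n x g)" .
    also have "\<dots> \<le> real n * B\<^sup>2" by (rule sqnorm_sample_le) (rule g(2))
    finally have a0: "?a0 \<le> real n * B\<^sup>2" .
    have "proj n (?S m) ?\<mu> \<in> ?U"
      using SU[OF mm] proj_in[OF flat_model_space[OF finite_model[OF m]]] by blast
    then have A: "?A \<le> real n * B\<^sup>2" using proj_best[OF U, of "proj n (?S m) ?\<mu>" ?\<mu>] a0 by linarith
    have Nb: "real n * k0 \<le> real ?N * ?\<beta>"
    proof -
      have "((1 - \<kappa>) * real n) * (exp (- (6 / (1 - \<kappa>)) - 1) / 4) \<le> real ?N * ?\<beta>"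
        using \<kappa> n bb(2) N_star_ge[of \<kappa> n \<phi> x] by (intro mult_mono) auto
      then show ?thesis unfolding k0 by (simp only: mult_ac)
    qed
    \<comment> \<open>Needed for the product of penalty and bias created by the mean of
      \<open>T\<close>: after division by n, 2^J * B^2 stays below B^2.\<close>
    have J2: "2 ^ J \<le> real n"
    proof -
      have "(2::real) ^ J \<le> 2 ^ ?Js" using J by (intro power_increasing) auto
      also have "\<dots> \<le> \<kappa> * real n / 2" using \<kappa> n by (intro J_star_bounds) auto
      also have "\<dots> \<le> 1 * real n / 2" using \<kappa> npos by (intro divide_right_mono mult_right_mono) auto
      finally show ?thesis using npos by linarith
    qed
    let ?E = "2 * (real n * B\<^sup>2) + 16 * real n * \<sigma>\<^sup>2"
    have res: "(2 * ?A + 16 * real n * \<sigma>\<^sup>2) / (real ?N * ?\<beta>) \<le> ?E / (real n * k0)"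
      using A Nb npos k0_pos by (intro frac_le) auto
    have "10 * ?c0 * ((2 * ?A + 16 * real n * \<sigma>\<^sup>2) / (real ?N * ?\<beta>)) \<le> 10 * (11 * 2 ^ J) * (?E / (real n * k0))"
    proof (rule mult_mono)
      show "10 * ?c0 \<le> 10 * (11 * 2 ^ J)" by (intro mult_left_mono penalty_le[OF J m]) simp
    qed (use \<beta> res in auto)
    also have "\<dots> = 220 / k0 * (2 ^ J * B\<^sup>2) + 1760 / k0 * (2 ^ J * \<sigma>\<^sup>2)"
      using npos k0_pos by (simp add: field_simps)
    also have "\<dots> \<le> 220 / k0 * (real n * B\<^sup>2) + 1760 / k0 * (2 ^ J * \<sigma>\<^sup>2)"
      using J2 k0_pos by (intro add_right_mono mult_left_mono mult_right_mono) auto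
    finally have "128 * \<sigma>\<^sup>2 + 20 * ?a0 + 10 * ?c0 * ((2 * ?A + 16 * real n * \<sigma>\<^sup>2) / (real ?N * ?\<beta>)) \<le>
        128 * \<sigma>\<^sup>2 + 20 * (real n * B\<^sup>2) + (220 / k0 * (real n * B\<^sup>2) + 1760 / k0 * (2 ^ J * \<sigma>\<^sup>2))"
      using a0 by linarith
    then have "1 / real n * (128 * \<sigma>\<^sup>2 + 20 * ?a0 + 10 * ?c0 * ((2 * ?A + 16 * real n * \<sigma>\<^sup>2) / (real ?N * ?\<beta>))) \<le>
        1 / real n * (128 * \<sigma>\<^sup>2 + 20 * (real n * B\<^sup>2) + (220 / k0 * (real n * B\<^sup>2) + 1760 / k0 * (2 ^ J * \<sigma>\<^sup>2)))"
      using npos by (intro mult_left_mono) auto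
    also have "\<dots> = 128 * (\<sigma>\<^sup>2 / real n) + (20 + 220 / k0) * B\<^sup>2 + 1760 / k0 * (2 ^ J * (\<sigma>\<^sup>2 / real n))"
      using npos k0_pos by (simp add: field_simps)
    finally show ?thesis .
  qed
  ultimately have "mean_le M (\<lambda>\<omega>. 1 / real n * sqnorm n (?\<mu> - mu_hat \<kappa> \<phi> n x (?Y \<omega>)))
    (128 * (\<sigma>\<^sup>2 / real n) + (20 + 220 / k0) * B\<^sup>2 + 1760 / k0 * (2 ^ J * (\<sigma>\<^sup>2 / real n)))"
    by (rule mean_le_mono)
  then show ?thesis by simp
qed

theorem corollary2:
  fixes \<kappa> r p R \<alpha> :: real and \<phi> :: "nat \<Rightarrow> nat \<Rightarrow> real \<Rightarrow> real"
  assumes "0 < \<kappa>" and "\<kappa> < 1"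
    and "wavelet_basis \<phi> r"
    and "0 < p" and "0 < R" and "1 / p < \<alpha>" and "\<alpha> < r"
  shows "\<exists>C::real. \<forall>(n::nat) (\<sigma>::real) (x::nat \<Rightarrow> real) (f::real \<Rightarrow> real)
           (M::'a measure) (\<epsilon>::nat \<Rightarrow> 'a \<Rightarrow> real).
         3 \<le> n \<and> 1 \<le> J_star \<kappa> n \<and> 2 < N_star \<kappa> \<phi> n x \<and> 0 < \<sigma> \<and>
         (\<forall>i\<in>{1..n}. x i \<in> {0..1}) \<and> f \<in> besov_ball \<alpha> p R \<and> iid_std_gaussian M n \<epsilon> \<longrightarrow>
         (let \<mu> = (\<lambda>i. f (x i));
              Y = (\<lambda>\<omega> i. \<mu> i + \<sigma> * \<epsilon> i \<omega>);
              loss = (\<lambda>\<omega>. sqnorm n (\<mu> - mu_hat \<kappa> \<phi> n x (Y \<omega>)) / real n)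
          in integrable M loss \<and>
             prob_space.expectation M loss
               \<le> C * Max {(\<sigma>\<^sup>2 / real n) powr (2 * \<alpha> / (2 * \<alpha> + 1)),
                          1 / real n powr (2 * (\<alpha> - 1 / p)),
                          \<sigma>\<^sup>2 / real n})"
proof -
  note \<kappa> = assms(1,2)
  from wavelet_approximation[OF assms(3,4,6,7,5)] obtain C0 where C0: "0 < C0"
    "\<And>f J Js. f \<in> besov_ball \<alpha> p R \<Longrightarrow> J \<le> Js \<Longrightarrow>
     \<exists>m\<in>models_at Js J. \<exists>g\<in>fun_vs.span ((\<lambda>(j, k). \<phi> j k) ` m). \<forall>x\<in>{0..1}.
        \<bar>f x - g x\<bar> \<le> C0 * (2 powr (- (real J * \<alpha>)) + 2 powr (- (real Js * (\<alpha> - 1/p))))"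
    by blast
  define u where "u = \<alpha> - 1 / p"
  have u: "0 < u" "u \<le> \<alpha>" using assms by (auto simp: u_def)
  have \<alpha>: "0 < \<alpha>" using u by linarith
  define k0 where "k0 = (1 - \<kappa>) * (exp (- (6 / (1 - \<kappa>)) - 1) / 4)"
  have k0: "0 < k0" using \<kappa> unfolding k0_def by (intro mult_pos_pos) auto
  define Kb where "Kb = (20 + 220 / k0) * (2 * C0\<^sup>2)"
  define Kv where "Kv = 1760 / k0"
  \<comment> \<open>From 2^J_star > \<kappa> n / 4: the squared truncation error is at most
    \<open>K2\<close> times n^(-2 u).\<close>
  define K2 where "K2 = (\<kappa> / 4) powr (- (2 * u))"
  define K3 where "K3 = (1 + 2 powr (2 * \<alpha>)) + (2 powr (2 * \<alpha> + 1) + 2) + K2"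
  have K_nn: "0 \<le> Kb" "0 \<le> Kv" "0 \<le> K2" "0 \<le> K3" using k0 C0 by (auto simp: Kb_def Kv_def K2_def K3_def)
  \<comment> \<open>128 for the bare variance, \<open>Kb\<close> times \<open>K3 + K2\<close> for
    the squared approximation error, \<open>Kv * K3\<close> for the variance 2^J s. All are fixed
    before n, \<sigma>, the design and the function.\<close>
  define C where "C = 128 + Kb * K2 + (Kb + Kv) * K3"
  show ?thesis
  proof (intro exI[of _ C] allI impI)
    fix n :: nat and \<sigma> :: real and x f and M :: "'a measure" and \<epsilon>
    assume A: "3 \<le> n \<and> 1 \<le> J_star \<kappa> n \<and> 2 < N_star \<kappa> \<phi> n x \<and> 0 < \<sigma> \<and>
         (\<forall>i\<in>{1..n}. x i \<in> {0..1}) \<and> f \<in> besov_ball \<alpha> p R \<and> iid_std_gaussian M n \<epsilon>"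
    define s where "s = \<sigma>\<^sup>2 / real n"
    define h where "h = s powr (2 * \<alpha> / (2 * \<alpha> + 1))"
    define b where "b = 1 / real n powr (2 * u)"
    define mx where "mx = Max {h, b, s}"
    let ?Js = "J_star \<kappa> n"
    have npos: "0 < real n" and s: "0 < s" using A by (auto simp: s_def)
    have mx: "h \<le> mx" "b \<le> mx" "s \<le> mx" by (simp_all add: mx_def)
    have tail: "2 powr (- (2 * real ?Js * u)) \<le> K2 * b"
    proof -
      have "\<kappa> / 4 * real n \<le> 2 ^ ?Js"
        using J_star_bounds(2)[of \<kappa> n] \<kappa> A by simp
      then have "(2 ^ ?Js) powr (- (2 * u)) \<le> (\<kappa> / 4 * real n) powr (- (2 * u))"
        using \<kappa> npos u by (intro powr_mono2') auto
      also have "\<dots> = K2 * b"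
        unfolding K2_def b_def by (subst powr_mult) (use \<kappa> in \<open>simp_all add: powr_minus_divide\<close>)
      also have "(2 ^ ?Js) powr (- (2 * u)) = 2 powr (- (2 * real ?Js * u))"
        by (simp add: powr_realpow[symmetric] powr_powr mult_ac)
      finally show ?thesis .
    qed
    \<comment> \<open>If the balancing level is capped at \<open>?Js\<close>, its bias decays with
      \<alpha>, no slower than the truncation error because u \<le> \<alpha>; the same multiple of
      n^(-2 u) covers both.\<close>
    have "2 powr (- (2 * real ?Js * \<alpha>)) \<le> 2 powr (- (2 * real ?Js * u))"
      using u by (simp add: mult_left_mono)
    from balancing_level[OF s \<alpha> _ order_trans[OF this tail]] A obtain J where
      J: "J \<in> {1..?Js}" "2 powr (- (2 * real J * \<alpha>)) + 2 ^ J * s \<le>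
        (1 + 2 powr (2 * \<alpha>)) * h + (2 powr (2 * \<alpha> + 1) + 2) * s + K2 * b" unfolding h_def by auto
    have bal: "2 powr (- (2 * real J * \<alpha>)) + 2 ^ J * s \<le> K3 * mx"
    proof -
      have "(1 + 2 powr (2 * \<alpha>)) * h \<le> (1 + 2 powr (2 * \<alpha>)) * mx"
        "(2 powr (2 * \<alpha> + 1) + 2) * s \<le> (2 powr (2 * \<alpha> + 1) + 2) * mx" "K2 * b \<le> K2 * mx"
        using mx K_nn by (auto intro!: mult_left_mono add_nonneg_nonneg)
      then show ?thesis using J(2) unfolding K3_def distrib_right[of _ _ mx] by linarith
    qed
    have "J \<le> ?Js" using J(1) by simp
    from C0(2)[OF _ this] A obtain m g where m: "m \<in> models_at ?Js J"
      "g \<in> fun_vs.span ((\<lambda>(j, k). \<phi> j k) ` m)"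
      "\<And>x. x \<in> {0..1} \<Longrightarrow> \<bar>f x - g x\<bar> \<le> C0 * (2 powr (- (real J * \<alpha>)) + 2 powr (- (real ?Js * u)))"
      unfolding u_def by blast
    define B where "B = C0 * (2 powr (- (real J * \<alpha>)) + 2 powr (- (real ?Js * u)))"
    have B2: "B\<^sup>2 \<le> 2 * C0\<^sup>2 * (2 powr (- (2 * real J * \<alpha>)) + 2 powr (- (2 * real ?Js * u)))"
    proof -
      have sq: "(y + z)\<^sup>2 \<le> 2 * (y\<^sup>2 + z\<^sup>2)" for y z :: real
        using zero_le_power2[of "y - z"] by (simp add: power2_eq_square algebra_simps)
      have pw: "(2 powr (- (t * v)))\<^sup>2 = 2 powr (- (2 * t * v))" for t v :: real
        by (simp add: power2_eq_square powr_add[symmetric] mult.assoc)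
      have "B\<^sup>2 \<le> C0\<^sup>2 * (2 * ((2 powr (- (real J * \<alpha>)))\<^sup>2 + (2 powr (- (real ?Js * u)))\<^sup>2))"
        unfolding B_def power_mult_distrib by (intro mult_left_mono sq) simp
      then show ?thesis unfolding pw by (simp only: mult_ac)
    qed
    have "mean_le M (\<lambda>\<omega>. sqnorm n ((\<lambda>i. f (x i)) - mu_hat \<kappa> \<phi> n x (\<lambda>i. f (x i) + \<sigma> * \<epsilon> i \<omega>)) / real n)
       (128 * (\<sigma>\<^sup>2 / real n) + (20 + 220 / k0) * B\<^sup>2 + 1760 / k0 * (2 ^ J * (\<sigma>\<^sup>2 / real n)))"
      using A m(3) unfolding B_def[symmetric]
      by (intro wavelet_oracle[OF \<kappa> _ _ _ _ _ J(1) m(1,2)]) (auto simp: k0_def)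
    moreover have "128 * (\<sigma>\<^sup>2 / real n) + (20 + 220 / k0) * B\<^sup>2 + 1760 / k0 * (2 ^ J * (\<sigma>\<^sup>2 / real n)) \<le> C * mx"
    proof -
      have "(20 + 220 / k0) * B\<^sup>2 \<le> Kb * (2 powr (- (2 * real J * \<alpha>)) + 2 powr (- (2 * real ?Js * u)))"
        unfolding Kb_def mult.assoc using k0 B2 by (intro mult_left_mono) (auto simp: mult.assoc)
      also have "\<dots> \<le> Kb * (K3 * mx + K2 * mx)"
      proof (intro mult_left_mono add_mono K_nn)
        have "0 \<le> 2 ^ J * s" using s by simp
        then show "2 powr (- (2 * real J * \<alpha>)) \<le> K3 * mx" using bal by linarith
        show "2 powr (- (2 * real ?Js * u)) \<le> K2 * mx"
          using tail mult_left_mono[OF mx(2) K_nn(3)] by linarith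
      qed
      finally have 1: "(20 + 220 / k0) * B\<^sup>2 \<le> Kb * (K3 * mx + K2 * mx)" .
      have "2 ^ J * s \<le> K3 * mx" using bal powr_ge_zero[of 2 "- (2 * real J * \<alpha>)"] by linarith
      then have 2: "Kv * (2 ^ J * s) \<le> Kv * (K3 * mx)" using K_nn by (intro mult_left_mono)
      have "C * mx = 128 * mx + Kb * (K3 * mx + K2 * mx) + Kv * (K3 * mx)"
        by (simp add: C_def algebra_simps)
      then show ?thesis using 1 2 mx(3) unfolding s_def[symmetric] Kv_def[symmetric] by linarith
    qed
    ultimately have "mean_le M (\<lambda>\<omega>. sqnorm n ((\<lambda>i. f (x i)) - mu_hat \<kappa> \<phi> n x (\<lambda>i. f (x i) + \<sigma> * \<epsilon> i \<omega>)) / real n) (C * mx)"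
      by (rule mean_le_mono)
    then show "let \<mu> = (\<lambda>i. f (x i));
              Y = (\<lambda>\<omega> i. \<mu> i + \<sigma> * \<epsilon> i \<omega>);
              loss = (\<lambda>\<omega>. sqnorm n (\<mu> - mu_hat \<kappa> \<phi> n x (Y \<omega>)) / real n)
          in integrable M loss \<and>
             prob_space.expectation M loss
               \<le> C * Max {(\<sigma>\<^sup>2 / real n) powr (2 * \<alpha> / (2 * \<alpha> + 1)),
                          1 / real n powr (2 * (\<alpha> - 1 / p)),
                          \<sigma>\<^sup>2 / real n}"
      unfolding Let_def mean_le_def mx_def h_def b_def s_def u_def .
  qed
qed

end
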